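(* Let $F$ be a field of odd characteristic $p$, let $q$ be an odd prime power not divisible by $p$, let $d'\ge 0$ be an integer, and let $\mathfrak C_{2d'+1}$ be the dual polar scheme on $[C_{2d'+1}(q)]$. If the adjacency algebra $F\mathfrak C_{2d'+1}$ is a local algebra, then $$F\mathfrak C_{2d'+1}\cong P/W_{d'}\otimes_F P/W_1$$ as $F$-algebras, where $P=F[X_1,X_2,\dots]/(X_1^p,X_2^p,\dots)$ and, for $n\ge 0$, $W_n$ is the ideal of $P$ generated by the (images of the) monomials of weight greater than $n$.
   Context: $[C_d(q)]$ denotes $\mathbb F_q^{2d}$ equipped with a non-degenerate symplectic form. Let $X$ be the set of maximal totally isotropic subspaces (all of dimension $d$), and for $i=0,\dots,d$ let $R_i=\{(x,y):\dim(x\cap y)=d-i\}$. Then $(X,\{R_i\})$ is a symmetric association scheme of class $d$, the dual polar scheme on $[C_d(q)]$. Its adjacency matrices are $A_i$ with $(A_i)_{xy}=1$ if $(x,y)\in R_i$ and $0$ otherwise; the adjacency algebra over a field $F$ is $\bigoplus_{i=0}^d FA_i$ (matrices over $F$). A local algebra is one with a unique maximal ideal. Weight: a monomial $X_{i_1}^{k_1}\cdots X_{i_s}^{k_s}$ (distinct $i_j\ge1$) has weight $\sum_j k_j p^{i_j-1}$. *)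

theory Defs
  imports
    "HOL-Analysis.Cartesian_Space"
    "HOL-Library.Poly_Mapping"
    "HOL-Algebra.Module"
    "HOL-Algebra.QuotRing"
begin

section \<open>Algebras over a field\<close>

text \<open>
  Throughout, an algebra over a field (a type of class \<^class>\<open>field\<close>) is a record of type
  \<open>('f, 'a) module\<close>; every element of the type \<open>'f\<close> acts as a scalar.
\<close>

definition alg_isomorphic :: "('f::field, 'a) module \<Rightarrow> ('f, 'b) module \<Rightarrow> bool" where
  "alg_isomorphic A B \<longleftrightarrow>
     (\<exists>h \<in> ring_iso A B. \<forall>c. \<forall>a \<in> carrier A. h (c \<odot>\<^bsub>A\<^esub> a) = c \<odot>\<^bsub>B\<^esub> h a)"

definition local_algebra :: "('f::field, 'a) module \<Rightarrow> bool" where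
  "local_algebra A \<longleftrightarrow> (\<exists>!I. maximalideal I A)"

definition quot_alg :: "('f::field, 'a) module \<Rightarrow> 'a set \<Rightarrow> ('f, 'a set) module" where
  "quot_alg A I =
     \<lparr>carrier = carrier (A Quot I), mult = mult (A Quot I), one = one (A Quot I),
      zero = zero (A Quot I), add = add (A Quot I),
      smult = (\<lambda>c C. \<Union>x\<in>C. I +>\<^bsub>A\<^esub> (c \<odot>\<^bsub>A\<^esub> x))\<rparr>"


section \<open>Tensor product of algebras\<close>

definition monoid_alg :: "('m, 'z) monoid_scheme \<Rightarrow> ('f::field, 'm \<Rightarrow>\<^sub>0 'f) module" where
  "monoid_alg M =
     \<lparr>carrier = {u. Poly_Mapping.keys u \<subseteq> carrier M},
      mult = (\<lambda>u v. \<Sum>s\<in>Poly_Mapping.keys u. \<Sum>t\<in>Poly_Mapping.keys v.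
                Poly_Mapping.single (s \<otimes>\<^bsub>M\<^esub> t)
                  (Poly_Mapping.lookup u s * Poly_Mapping.lookup v t)),
      one = Poly_Mapping.single \<one>\<^bsub>M\<^esub> 1,
      zero = 0,
      add = (+),
      smult = (\<lambda>c u. Poly_Mapping.map ((*) c) u)\<rparr>"

definition tensor_rels :: "('f::field, 'a) module \<Rightarrow> ('f, 'b) module \<Rightarrow> ('a \<times> 'b \<Rightarrow>\<^sub>0 'f) set" where
  "tensor_rels A B =
     (let \<delta> = (\<lambda>a b. Poly_Mapping.single (a, b) (1::'f)) in
      {\<delta> (a \<oplus>\<^bsub>A\<^esub> a') b - \<delta> a b - \<delta> a' b | a a' b.
         a \<in> carrier A \<and> a' \<in> carrier A \<and> b \<in> carrier B} \<union>
      {\<delta> a (b \<oplus>\<^bsub>B\<^esub> b') - \<delta> a b - \<delta> a b' | a b b'.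
         a \<in> carrier A \<and> b \<in> carrier B \<and> b' \<in> carrier B} \<union>
      {\<delta> (c \<odot>\<^bsub>A\<^esub> a) b - Poly_Mapping.map ((*) c) (\<delta> a b) | c a b.
         a \<in> carrier A \<and> b \<in> carrier B} \<union>
      {\<delta> a (c \<odot>\<^bsub>B\<^esub> b) - Poly_Mapping.map ((*) c) (\<delta> a b) | c a b.
         a \<in> carrier A \<and> b \<in> carrier B})"

text \<open>
  The monoid algebra of the multiplicative monoid of \<open>A \<times> B\<close> is the free vector space on \<open>A \<times> B\<close>
  with product \<open>(a, b) (a', b') = (a a', b b')\<close>. Since a basis element times a bilinearity relation
  is again such a relation, the ideal generated by the relations is just their linear span, so
  this is the usual tensor product over the base field with its usual multiplication.
\<close>

definition tensor_alg ::
  "('f::field, 'a) module \<Rightarrow> ('f, 'b) module \<Rightarrow> ('f, ('a \<times> 'b \<Rightarrow>\<^sub>0 'f) set) module" where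
  "tensor_alg A B =
     quot_alg (monoid_alg (A \<times>\<times> B)) (genideal (monoid_alg (A \<times>\<times> B)) (tensor_rels A B))"


section \<open>The truncated polynomial algebras\<close>

text \<open>
  Variables are indexed from 0: the index \<open>i :: nat\<close> stands for the variable \<open>X\<^sub>i\<^sub>+\<^sub>1\<close>, whence
  the weight \<open>p ^ i\<close> of the variable with index \<open>i\<close>.
\<close>

type_synonym 'f inf_poly = "(nat \<Rightarrow>\<^sub>0 nat) \<Rightarrow>\<^sub>0 'f"

definition poly_alg :: "('f::field, 'f inf_poly) module" where
  "poly_alg =
     \<lparr>carrier = UNIV, mult = (*), one = 1, zero = 0, add = (+),
      smult = (\<lambda>c f. Poly_Mapping.map ((*) c) f)\<rparr>"

definition monomial :: "(nat \<Rightarrow>\<^sub>0 nat) \<Rightarrow> 'f::field inf_poly" where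
  "monomial m = Poly_Mapping.single m 1"

definition pvar :: "nat \<Rightarrow> 'f::field inf_poly" where
  "pvar i = monomial (Poly_Mapping.single i 1)"

definition weight :: "nat \<Rightarrow> (nat \<Rightarrow>\<^sub>0 nat) \<Rightarrow> nat" where
  "weight p m = (\<Sum>i\<in>Poly_Mapping.keys m. Poly_Mapping.lookup m i * p ^ i)"

definition pow_ideal :: "nat \<Rightarrow> 'f::field inf_poly set" where
  "pow_ideal p = genideal (poly_alg :: ('f, 'f inf_poly) module) {pvar i ^ p | i. True}"

definition P_alg :: "nat \<Rightarrow> ('f::field, 'f inf_poly set) module" where
  "P_alg p = quot_alg poly_alg (pow_ideal p)"

definition W_ideal :: "nat \<Rightarrow> nat \<Rightarrow> 'f::field inf_poly set set" where
  "W_ideal p n =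
     genideal (P_alg p :: ('f, 'f inf_poly set) module)
       {pow_ideal p +>\<^bsub>(poly_alg :: ('f, 'f inf_poly) module)\<^esub> monomial m | m. weight p m > n}"

definition PW_alg :: "nat \<Rightarrow> nat \<Rightarrow> ('f::field, 'f inf_poly set set) module" where
  "PW_alg p n = quot_alg (P_alg p) (W_ideal p n)"


section \<open>The dual polar scheme of a symplectic space\<close>

definition symplectic_form :: "('k::field ^ 'n \<Rightarrow> 'k ^ 'n \<Rightarrow> 'k) \<Rightarrow> bool" where
  "symplectic_form B \<longleftrightarrow>
     (\<forall>x. Vector_Spaces.linear (*s) (*) (\<lambda>y. B x y)) \<and>
     (\<forall>y. Vector_Spaces.linear (*s) (*) (\<lambda>x. B x y)) \<and>
     (\<forall>x. B x x = 0)"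

definition nondegenerate :: "('k::field ^ 'n \<Rightarrow> 'k ^ 'n \<Rightarrow> 'k) \<Rightarrow> bool" where
  "nondegenerate B \<longleftrightarrow> (\<forall>x. (\<forall>y. B x y = 0) \<longrightarrow> x = 0)"

definition totally_isotropic ::
  "('k::field ^ 'n \<Rightarrow> 'k ^ 'n \<Rightarrow> 'k) \<Rightarrow> ('k ^ 'n) set \<Rightarrow> bool" where
  "totally_isotropic B U \<longleftrightarrow> vec.subspace U \<and> (\<forall>x\<in>U. \<forall>y\<in>U. B x y = 0)"

definition max_isotropic_subspaces ::
  "('k::field ^ 'n \<Rightarrow> 'k ^ 'n \<Rightarrow> 'k) \<Rightarrow> ('k ^ 'n) set set" where
  "max_isotropic_subspaces B =
     {U. totally_isotropic B U \<and> (\<forall>U'. totally_isotropic B U' \<and> U \<subseteq> U' \<longrightarrow> U' = U)}"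

definition dual_polar_rel ::
  "('k::field ^ 'n \<Rightarrow> 'k ^ 'n \<Rightarrow> 'k) \<Rightarrow> nat \<Rightarrow> nat \<Rightarrow> (('k ^ 'n) set \<times> ('k ^ 'n) set) set" where
  "dual_polar_rel B d i =
     {(x, y). x \<in> max_isotropic_subspaces B \<and> y \<in> max_isotropic_subspaces B \<and>
              vec.dim (x \<inter> y) = d - i}"

text \<open>
  Matrices with rows and columns indexed by a finite set \<open>X\<close> are functions of two arguments
  vanishing outside \<open>X \<times> X\<close>.
\<close>

definition adjacency_matrix :: "('x \<times> 'x) set \<Rightarrow> 'x \<Rightarrow> 'x \<Rightarrow> 'f::field" where
  "adjacency_matrix R x y = (if (x, y) \<in> R then 1 else 0)"

definition adjacency_algebra ::
  "'x set \<Rightarrow> nat \<Rightarrow> (nat \<Rightarrow> ('x \<times> 'x) set) \<Rightarrow> ('f::field, 'x \<Rightarrow> 'x \<Rightarrow> 'f) module" where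
  "adjacency_algebra X d R =
     \<lparr>carrier = {(\<lambda>x y. \<Sum>i\<le>d. c i * adjacency_matrix (R i) x y) | c. True},
      mult = (\<lambda>M N x y. \<Sum>z\<in>X. M x z * N z y),
      one = (\<lambda>x y. if x \<in> X \<and> x = y then 1 else 0),
      zero = (\<lambda>x y. 0),
      add = (\<lambda>M N x y. M x y + N x y),
      smult = (\<lambda>c M x y. c * M x y)\<rparr>"

definition dual_polar_algebra ::
  "('k::field ^ 'n \<Rightarrow> 'k ^ 'n \<Rightarrow> 'k) \<Rightarrow> nat \<Rightarrow>
     ('f::field, ('k ^ 'n) set \<Rightarrow> ('k ^ 'n) set \<Rightarrow> 'f) module" where
  "dual_polar_algebra B d =
     adjacency_algebra (max_isotropic_subspaces B) d (dual_polar_rel B d)"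

end

theory Submission
  imports Defs "HOL-Algebra.Ring_Divisibility" "HOL-Computational_Algebra.Primes"
begin

text \<open>
  Let \<open>b\<^sub>k = \<Sum>\<^sub>j [d - j, d - k]\<^sub>q A\<^sub>j\<close>, with Gaussian binomial coefficients; these matrices form a basis of
  the adjacency algebra. Counting the neighbours of a maximal isotropic subspace yields the recursion
  \<open>A\<^sub>1 b\<^sub>k = [k + 1] b\<^sub>k\<^sub>+\<^sub>1 + (q [k] - [d - k]) b\<^sub>k\<close> over the integers, and from it explicit structure
  constants of the basis \<open>b\<^sub>0, \<dots>, b\<^sub>d\<close> that are polynomials in \<open>q\<close>.

  If the algebra is local, all the eigenvalues \<open>q [k] - [d - k]\<close> agree in the field, which forces \<open>q = - 1\<close>.
  At \<open>q = - 1\<close> and odd \<open>d\<close> the structure constants collapse to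
  \<open>b\<^sub>2\<^sub>i b\<^sub>2\<^sub>j = (i + j choose i) b\<^sub>2\<^sub>i\<^sub>+\<^sub>2\<^sub>j\<close>, \<open>b\<^sub>1 b\<^sub>2\<^sub>i = b\<^sub>2\<^sub>i\<^sub>+\<^sub>1\<close> and \<open>b\<^sub>1\<^sup>2 = 0\<close>. Hence the algebra is the
  tensor product of two truncated divided power algebras, of top degrees \<open>d'\<close> and \<open>1\<close>. In characteristic
  \<open>p\<close> a divided power algebra is generated by its elements of degree \<open>p\<^sup>i\<close>, subject only to their \<open>p\<close>-th
  powers being zero, so the truncated ones are \<open>P/W\<^sub>n\<close>.
\<close>

section \<open>Gaussian binomial coefficients\<close>

text \<open>Multiplication by \<open>A\<^sub>1\<close> is bidiagonal in the basis of the
  \<open>b\<^sub>k\<close>. The eigenvalues thus stand on the diagonal over every field, also where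
  \<open>A\<^sub>1\<close> is not diagonalizable, and this is what lets locality be tested on them.
  Their differences factor as \<open>[m - k] * (q ^ (d - m) + q ^ (k + 1))\<close>. The second
  factor governs both halves of the argument: the cases \<open>k = 0\<close> and
  \<open>m = 1, 2\<close> force \<open>q = - 1\<close>, while factors of the same shape in the
  structure constants vanish by parity once \<open>q = - 1\<close> and \<open>d\<close> is odd, so
  that a product of two even-indexed basis elements has at most one term. The isomorphism needs no
  dimension count. The reduced monomials of weight \<open>i \<le> d'\<close> and
  \<open>j \<le> 1\<close> are sent to nonzero multiples of \<open>b (2 * i)\<close> and
  \<open>b j\<close>, where Lucas' congruence supplies the nonvanishing, and the products of these
  run through \<open>b 0, ..., b d\<close> up to nonzero scalars. A spanning family of the tensor
  product is thus mapped to a basis, which leaves no room for a kernel.\<close>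

definition qint :: "'r::comm_ring_1 \<Rightarrow> nat \<Rightarrow> 'r" where
  "qint q n = (\<Sum>i<n. q ^ i)"

lemma qint_0 [simp]: "qint q 0 = 0" and qint_Suc: "qint q (Suc n) = qint q n + q ^ n"
  by (simp_all add: qint_def)

lemma qint_1 [simp]: "qint q (Suc 0) = 1"
  by (simp add: qint_Suc)

lemma qint_mult: "(q - 1) * qint q n = q ^ n - 1"
  by (induction n) (simp_all add: qint_Suc algebra_simps)

lemma qint_add: "qint q (a + b) = qint q a * q ^ b + qint q b"
  by (induction a) (simp_all add: qint_Suc algebra_simps power_add)

lemma qint_pos: "q > 0 \<Longrightarrow> n > 0 \<Longrightarrow> qint (q :: int) n > 0"
  unfolding qint_def by (rule sum_pos) auto

lemma qint_minus_one: "qint (- 1) n = (if even n then 0 else 1)"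
  by (induction n) (auto simp: qint_Suc)

fun gbinom :: "'r::comm_ring_1 \<Rightarrow> nat \<Rightarrow> nat \<Rightarrow> 'r" where
  "gbinom q n 0 = 1"
| "gbinom q 0 (Suc k) = 0"
| "gbinom q (Suc n) (Suc k) = q ^ Suc k * gbinom q n (Suc k) + gbinom q n k"

lemma gbinom_eq_0: "n < k \<Longrightarrow> gbinom q n k = 0"
  by (induction q n k rule: gbinom.induct) auto

lemma gbinom_same [simp]: "gbinom q n n = 1"
  by (induction n) (auto simp: gbinom_eq_0)

lemma of_int_gbinom: "of_int (gbinom q n k) = gbinom (of_int q) n k"
  by (induction q n k rule: gbinom.induct) auto

text \<open>The defining recursion puts the power of \<open>q\<close> on the term with
  \<open>Suc k\<close>, this mirror image on the other term. One expands by the defining rule,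
  applies the induction hypothesis to both terms and regroups; the mixed powers of \<open>q\<close>
  agree.\<close>

lemma gbinom_Suc_Suc': "k \<le> n \<Longrightarrow> gbinom q (Suc n) (Suc k) = gbinom q n (Suc k) + q ^ (n - k) * gbinom q n k"
proof (induction n arbitrary: k)
  case (Suc n)
  show ?case
  proof (cases k)
    case 0
    with Suc.IH[of 0] show ?thesis by (simp add: algebra_simps)
  next
    case (Suc k')
    show ?thesis
    proof (cases "k = Suc n")
      case True
      then show ?thesis by (simp add: gbinom_eq_0)
    next
      case False
      with Suc.prems have le: "k \<le> n" by simp
      have e: "n - k' = Suc (n - k)" using le Suc by simp
      have pw: "q ^ Suc k * q ^ (n - k) = q ^ (n - k') * q ^ k"
        by (simp add: e Suc algebra_simps)
      have "gbinom q (Suc (Suc n)) (Suc k)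
          = q ^ Suc k * gbinom q (Suc n) (Suc k) + gbinom q (Suc n) k"
        by simp
      also have "\<dots> = q ^ Suc k * (gbinom q n (Suc k) + q ^ (n - k) * gbinom q n k)
          + (gbinom q n k + q ^ (n - k') * gbinom q n k')"
        using Suc.IH[OF le] Suc.IH[of k'] le Suc by simp
      also have "\<dots> = (q ^ Suc k * gbinom q n (Suc k) + gbinom q n k)
          + q ^ (n - k') * (q ^ k * gbinom q n k + gbinom q n k')"
        using pw by (simp add: algebra_simps)
      finally show ?thesis using Suc by simp
    qed
  qed
qed simp

text \<open>The ratio of neighbouring coefficients in a row, in multiplied-out form because
  \<open>qint q (Suc k)\<close> may be zero in the ring; at \<open>q = - 1\<close> it is so for odd
  \<open>k\<close>.\<close>

lemma qint_mult_gbinom: "qint q (Suc k) * gbinom q n (Suc k) = qint q (n - k) * gbinom q n k"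
proof (induction n arbitrary: k)
  case (Suc n)
  show ?case
  proof (cases k)
    case 0
    have "qint q (Suc n) = 1 + q * qint q n"
      using qint_add[of q n 1] by (simp add: algebra_simps)
    with 0 Suc.IH[of 0] show ?thesis by (simp add: algebra_simps)
  next
    case (Suc k')
    show ?thesis
    proof (cases "k \<le> n")
      case False
      then show ?thesis by (cases "k = Suc n") (auto simp: gbinom_eq_0)
    next
      case True
      have e: "n - k' = Suc (n - k)" using True Suc by simp
      have a: "qint q (Suc (n - k)) = 1 + q * qint q (n - k)"
        using qint_add[of q "n - k" 1] by (simp add: algebra_simps)
      have b: "qint q (Suc k) = 1 + q * qint q k"
        using qint_add[of q k 1] by (simp add: algebra_simps)
      have ih1: "qint q (Suc k) * gbinom q n (Suc k) = qint q (n - k) * gbinom q n k"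
        by (rule Suc.IH)
      have ih2: "qint q k * gbinom q n k = qint q (Suc (n - k)) * gbinom q n k'"
        using Suc.IH[of k'] e Suc by simp
      have c: "qint q (Suc (n - k)) = qint q (n - k) + q ^ (n - k)" by (simp add: qint_Suc)
      have d: "qint q (Suc k) = qint q k + q ^ k" by (simp add: qint_Suc)
      have "qint q (Suc k) * gbinom q (Suc n) (Suc k)
         = q ^ Suc k * (qint q (n - k) * gbinom q n k) + qint q (Suc k) * gbinom q n k"
        using ih1 by (simp add: algebra_simps)
      also have "\<dots> = q ^ k * (1 + q * qint q (n - k)) * gbinom q n k + qint q k * gbinom q n k"
        by (simp add: d algebra_simps)
      also have "\<dots> = qint q (Suc (n - k)) * (q ^ k * gbinom q n k + gbinom q n k')"
        by (simp add: ih2 flip: a) (simp add: algebra_simps)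
      also have "\<dots> = qint q (Suc n - k) * gbinom q (Suc n) k"
        using Suc True by (simp add: Suc_diff_Suc)
      finally show ?thesis .
    qed
  qed
qed simp

text \<open>The ratio of neighbouring rows for a fixed lower index, again without division: Pascal's
  rule reduces it to the preceding identity and a splitting of
  \<open>qint q (Suc n)\<close>.\<close>

lemma qint_mult_gbinom': "qint q (Suc n - k) * gbinom q (Suc n) k = qint q (Suc n) * gbinom q n k"
proof (cases "k \<le> n")
  case True
  show ?thesis
  proof (cases k)
    case (Suc k')
    have s: "qint q (Suc n) = qint q (n - k') * q ^ k + qint q k"
      using qint_add[of q "n - k'" k] True Suc by simp
    have e: "Suc n - k = n - k'" using Suc by simp
    have "qint q (Suc n - k) * gbinom q (Suc n) k
        = qint q (n - k') * q ^ k * gbinom q n k + qint q (n - k') * gbinom q n k'"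
      unfolding e by (simp add: Suc algebra_simps)
    also have "\<dots> = qint q (n - k') * q ^ k * gbinom q n k + qint q k * gbinom q n k"
      using qint_mult_gbinom[of q k' n] Suc by simp
    also have "\<dots> = qint q (Suc n) * gbinom q n k"
      by (simp add: s algebra_simps)
    finally show ?thesis .
  qed simp
qed (auto simp: gbinom_eq_0 not_le)

text \<open>Two applications of Pascal's rule lead from \<open>2 * n\<close> to
  \<open>2 * Suc n\<close> and mix both parities of the lower index, so the two claims are proved
  together. This is the \<open>q\<close>-Lucas theorem at \<open>- 1\<close> for an even upper
  index.\<close>

lemma gbinom_minus_one_aux:
  "gbinom (- 1 :: 'r::comm_ring_1) (2 * n) (2 * k) = of_nat (n choose k) \<and> gbinom (- 1 :: 'r) (2 * n) (Suc (2 * k)) = 0"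
proof (induction n arbitrary: k)
  case 0
  show ?case by (cases k) auto
next
  case (Suc n)
  have e: "2 * Suc m = Suc (Suc (2 * m))" for m by simp
  have ih: "gbinom (- 1 :: 'r) (2 * n) (2 * j) = of_nat (n choose j)" "gbinom (- 1 :: 'r) (2 * n) (Suc (2 * j)) = 0" for j
    using Suc[of j] by simp_all
  show ?case
  proof (cases k)
    case 0
    show ?thesis unfolding 0 e using ih(1)[of 0] ih(2)[of 0] by simp
  next
    case (Suc k')
    show ?thesis unfolding Suc e gbinom.simps
      using ih(1)[of "Suc k'"] ih(2)[of k'] ih(1)[of k'] ih(2)[of "Suc k'"] unfolding e by simp
  qed
qed

lemma gbinom_minus_one: "gbinom (- 1) (2 * n) (2 * k) = of_nat (n choose k)"
  using gbinom_minus_one_aux by blast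

text \<open>With \<open>k = d - i\<close> this is the eigenvalue \<open>\<theta>\<^sub>i = q [d - i] - [i]\<close> of the dual polar graph.\<close>

definition t_eig :: "'r::comm_ring_1 \<Rightarrow> nat \<Rightarrow> nat \<Rightarrow> 'r" where
  "t_eig q d k = q * qint q k - qint q (d - k)"

text \<open>The coefficient of \<open>b m\<close> in the product of \<open>b k\<close> and
  \<open>b l\<close>. Its Gaussian coefficients multiply to the \<open>q\<close>-multinomial
  coefficient with parts \<open>m - k\<close>, \<open>m - l\<close> and \<open>k + l - m\<close>, so
  the formula is symmetric in \<open>k\<close> and \<open>l\<close>. It vanishes for
  \<open>m < k\<close>, which makes the products triangular.\<close>

definition lin_coeff :: "'r::comm_ring_1 \<Rightarrow> nat \<Rightarrow> nat \<Rightarrow> nat \<Rightarrow> nat \<Rightarrow> 'r" where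
  "lin_coeff q d k l m =
     (if m \<le> k + l
      then gbinom q m k * gbinom q k (k + l - m) * (\<Prod>h<k + l - m. q ^ (d - m) + q ^ Suc h)
      else 0)"

lemma of_int_lin_coeff: "of_int (lin_coeff q d k l m) = lin_coeff (of_int q) d k l m"
  by (simp add: lin_coeff_def of_int_gbinom)

lemma lin_coeff_0: "lin_coeff q d 0 l m = (if m = l then 1 else 0)"
  by (cases "l - m") (auto simp: lin_coeff_def)

text \<open>Both \<open>qint q m\<close> and \<open>qint q (d - k)\<close> split off a multiple of
  \<open>qint q (m - k)\<close>; the remainders \<open>qint q k\<close> and
  \<open>qint q (d - m)\<close> cancel.\<close>

lemma t_eig_diff:
  assumes "k \<le> m" "m \<le> d"
  shows "t_eig q d m - t_eig q d k = qint q (m - k) * (q ^ (d - m) + q ^ Suc k)"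
proof -
  have 1: "qint q m = qint q (m - k) * q ^ k + qint q k"
    using qint_add[of q "m - k" k] assms by simp
  have "qint q (d - k) = qint q (m - k) * q ^ (d - m) + qint q (d - m)"
    using qint_add[of q "m - k" "d - m"] assms by simp
  with 1 show ?thesis by (simp add: t_eig_def algebra_simps)
qed

text \<open>The recursion comes from comparing the coefficients of \<open>b m\<close> in
  \<open>A (b k b l)\<close>, computed once through \<open>A (b k)\<close> and once through the
  expansion of \<open>b k b l\<close>.\<close>

lemma lin_coeff_Suc:
  assumes "m \<le> d"
  shows "qint q (Suc k) * lin_coeff q d (Suc k) l m =
    (if m = 0 then 0 else qint q m * lin_coeff q d k l (m - 1))
    + (t_eig q d m - t_eig q d k) * lin_coeff q d k l m"
proof -
  consider "m < k" | "m = k" "k = 0" | "m > Suc (k + l)" | "m = Suc (k + l)" | "k \<le> m" "m \<le> k + l" "m > 0"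
    by linarith
  then show ?thesis
  proof cases
    case 1
    then show ?thesis by (auto simp: lin_coeff_def gbinom_eq_0)
  next
    case 2
    then show ?thesis by (auto simp: lin_coeff_def gbinom_eq_0)
  next
    case 3
    then show ?thesis by (auto simp: lin_coeff_def)
  next
    case 4
    have "qint q (Suc k) * gbinom q (Suc (k + l)) (Suc k) = qint q (Suc (k + l)) * gbinom q (k + l) k"
      using qint_mult_gbinom[of q k "Suc (k + l)"] qint_mult_gbinom'[of q "k + l" k] by simp
    with 4 show ?thesis by (simp add: lin_coeff_def del: gbinom.simps) (simp add: algebra_simps)
  next
    case 5
    then obtain m' where m: "m = Suc m'" by (cases m) auto
    define r where "r = k + l - m"
    define Q where "Q = q ^ (d - m)"
    define P where "P = (\<Prod>h<r. Q + q ^ Suc h)"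
    have r1: "Suc k + l - m = Suc r" "k + l - m' = Suc r" using 5 m by (auto simp: r_def)
    have dm: "d - m' = Suc (d - m)" using assms m by simp
    have P1: "(\<Prod>h<Suc r. Q + q ^ Suc h) = P * (Q + q ^ Suc r)" by (simp add: P_def)
    \<comment> \<open>Passing from \<open>m\<close> to \<open>m - 1\<close> raises the exponent
      \<open>d - m\<close> by one, so every factor is \<open>q\<close> times
      \<open>Q + q ^ h\<close>. In this shifted product the factor \<open>Q + 1\<close> for
      \<open>h = 0\<close> is new.\<close>
    have "(\<Prod>h<Suc r. q ^ (d - m') + q ^ Suc h) = (\<Prod>h<Suc r. q * (Q + q ^ h))"
      by (rule prod.cong) (simp_all add: dm Q_def algebra_simps)
    also have "\<dots> = q ^ Suc r * (\<Prod>h<Suc r. Q + q ^ h)"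
      by (simp only: prod.distrib prod_constant card_lessThan)
    also have "(\<Prod>h<Suc r. Q + q ^ h) = (Q + 1) * P"
      by (subst prod.lessThan_Suc_shift) (simp add: P_def)
    finally have P2: "(\<Prod>h<Suc r. q ^ (d - m') + q ^ Suc h) = q ^ Suc r * ((Q + 1) * P)" .
    have c1: "lin_coeff q d (Suc k) l m = gbinom q m (Suc k) * gbinom q (Suc k) (Suc r) * (P * (Q + q ^ Suc r))"
      using 5 unfolding lin_coeff_def r1 P1[symmetric] by (simp add: Q_def del: gbinom.simps prod.lessThan_Suc)
    have c2: "lin_coeff q d k l m' = gbinom q m' k * gbinom q k (Suc r) * (q ^ Suc r * ((Q + 1) * P))"
      using 5 m unfolding lin_coeff_def r1 P2 by simp
    have c3: "lin_coeff q d k l m = gbinom q m k * gbinom q k r * P"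
      using 5 by (simp add: lin_coeff_def Q_def P_def r_def)
    have g1: "qint q (Suc k) * gbinom q m (Suc k) = qint q (m - k) * gbinom q m k"
      by (rule qint_mult_gbinom)
    have g2: "qint q m * gbinom q m' k = qint q (m - k) * gbinom q m k"
      using qint_mult_gbinom'[of q m' k] m by simp
    have t: "t_eig q d m - t_eig q d k = qint q (m - k) * (Q + q ^ Suc k)"
      using t_eig_diff[of k m d q] 5 assms by (simp add: Q_def)
    \<comment> \<open>What is left once the absorption identities have taken out the common factors.
      The summand with \<open>Q\<close> is expanded by the defining Pascal rule, the one with
      \<open>q ^ Suc r\<close> by its mirror image.\<close>
    have key: "gbinom q (Suc k) (Suc r) * (Q + q ^ Suc r)
        = gbinom q k (Suc r) * (q ^ Suc r * (Q + 1)) + (Q + q ^ Suc k) * gbinom q k r"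
    proof (cases "r \<le> k")
      case True
      have pw: "q ^ Suc k = q ^ Suc r * q ^ (k - r)"
        using True by (metis Suc_diff_diff diff_Suc_Suc le_add_diff_inverse not_less_eq_eq power_add Suc_le_mono)
      have "gbinom q (Suc k) (Suc r) * (Q + q ^ Suc r)
        = gbinom q (Suc k) (Suc r) * Q + gbinom q (Suc k) (Suc r) * q ^ Suc r"
        by (simp add: algebra_simps del: gbinom.simps)
      also have "\<dots> = (q ^ Suc r * gbinom q k (Suc r) + gbinom q k r) * Q
          + (gbinom q k (Suc r) + q ^ (k - r) * gbinom q k r) * q ^ Suc r"
        by (subst (2) gbinom_Suc_Suc'[OF True]) simp
      also have "\<dots> = gbinom q k (Suc r) * (q ^ Suc r * (Q + 1)) + (Q + q ^ Suc k) * gbinom q k r"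
        unfolding pw by (simp add: algebra_simps)
      finally show ?thesis .
    qed (simp add: gbinom_eq_0)
    have "qint q (Suc k) * lin_coeff q d (Suc k) l m
        = (qint q (Suc k) * gbinom q m (Suc k)) * (gbinom q (Suc k) (Suc r) * (Q + q ^ Suc r)) * P"
      unfolding c1 by (simp add: algebra_simps del: gbinom.simps)
    also have "\<dots> = (qint q (m - k) * gbinom q m k) *
        (gbinom q k (Suc r) * (q ^ Suc r * (Q + 1)) + (Q + q ^ Suc k) * gbinom q k r) * P"
      unfolding g1 key ..
    also have "\<dots> = (qint q m * gbinom q m' k) * (gbinom q k (Suc r) * (q ^ Suc r * (Q + 1))) * P
       + (qint q (m - k) * (Q + q ^ Suc k)) * (gbinom q m k * gbinom q k r) * P"
      unfolding g2 by (simp add: algebra_simps)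
    also have "\<dots> = qint q m * lin_coeff q d k l m' + (t_eig q d m - t_eig q d k) * lin_coeff q d k l m"
      unfolding c2 c3 t by (simp add: algebra_simps)
    finally show ?thesis using m by simp
  qed
qed

text \<open>Over the integers the recursion determines \<open>b k\<close> as a polynomial in \<open>A\<close>, since \<open>qint q (Suc k)\<close>
  can be cancelled. The structure constants then also hold modulo a prime dividing \<open>qint q (Suc k)\<close>,
  where \<open>A\<close> no longer generates.\<close>

lemma three_term_linearization:
  fixes b :: "nat \<Rightarrow> 'x \<Rightarrow> 'x \<Rightarrow> int" and A :: "'x \<Rightarrow> 'x \<Rightarrow> int"
  assumes fin: "finite X" and q: "q > 0"
    and b0: "\<And>x y. x \<in> X \<Longrightarrow> y \<in> X \<Longrightarrow> b 0 x y = (if x = y then 1 else 0)"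
    and b_top: "\<And>x y. b (Suc d) x y = 0"
    and rec: "\<And>k x y. k \<le> d \<Longrightarrow> x \<in> X \<Longrightarrow> y \<in> X \<Longrightarrow>
       (\<Sum>z\<in>X. A x z * b k z y) = qint q (Suc k) * b (Suc k) x y + t_eig q d k * b k x y"
    and "k \<le> d" "l \<le> d" "x \<in> X" "y \<in> X"
  shows "(\<Sum>z\<in>X. b k x z * b l z y) = (\<Sum>m\<le>d. lin_coeff q d k l m * b m x y)"
  using \<open>k \<le> d\<close> \<open>x \<in> X\<close>
proof (induction k arbitrary: x)
  case 0
  have "(\<Sum>z\<in>X. b 0 x z * b l z y) = (\<Sum>z\<in>X. if x = z then b l z y else 0)"
    using 0 by (intro sum.cong) (auto simp: b0)
  also have "\<dots> = b l x y" using fin 0 by simp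
  also have "\<dots> = (\<Sum>m\<le>d. if m = l then b m x y else 0)"
    using \<open>l \<le> d\<close> by simp
  also have "\<dots> = (\<Sum>m\<le>d. lin_coeff q d 0 l m * b m x y)"
    by (intro sum.cong) (auto simp: lin_coeff_0)
  finally show ?case .
next
  case (Suc k)
  note ih = Suc.IH[OF Suc_leD[OF Suc.prems(1)]]
  let ?c = "lin_coeff q d k l" and ?t = "t_eig q d"
  have "qint q (Suc k) * (\<Sum>z\<in>X. b (Suc k) x z * b l z y)
      = (\<Sum>z\<in>X. (qint q (Suc k) * b (Suc k) x z) * b l z y)"
    by (simp add: sum_distrib_left mult.assoc)
  also have "\<dots> = (\<Sum>z\<in>X. ((\<Sum>w\<in>X. A x w * b k w z) - ?t k * b k x z) * b l z y)"
    using Suc.prems by (intro sum.cong) (simp_all add: rec)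
  also have "\<dots> = (\<Sum>z\<in>X. \<Sum>w\<in>X. A x w * (b k w z * b l z y)) - ?t k * (\<Sum>z\<in>X. b k x z * b l z y)"
    by (simp add: left_diff_distrib sum_subtractf sum_distrib_left sum_distrib_right mult.assoc)
  also have "(\<Sum>z\<in>X. \<Sum>w\<in>X. A x w * (b k w z * b l z y)) = (\<Sum>w\<in>X. A x w * (\<Sum>z\<in>X. b k w z * b l z y))"
    by (subst sum.swap) (simp add: sum_distrib_left)
  also have "\<dots> = (\<Sum>w\<in>X. A x w * (\<Sum>m\<le>d. ?c m * b m w y))"
    by (intro sum.cong) (simp_all add: ih)
  also have "\<dots> = (\<Sum>m\<le>d. ?c m * (\<Sum>w\<in>X. A x w * b m w y))"
    unfolding sum_distrib_left by (subst sum.swap) (simp add: algebra_simps)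
  also have "\<dots> = (\<Sum>m\<le>d. ?c m * (qint q (Suc m) * b (Suc m) x y + ?t m * b m x y))"
    using Suc.prems assms(9) by (intro sum.cong) (simp_all add: rec)
  also have "(\<Sum>z\<in>X. b k x z * b l z y) = (\<Sum>m\<le>d. ?c m * b m x y)"
    using Suc.prems by (simp add: ih)
  also have "(\<Sum>m\<le>d. ?c m * (qint q (Suc m) * b (Suc m) x y + ?t m * b m x y)) - ?t k * \<dots>
     = (\<Sum>m\<le>d. ?c m * qint q (Suc m) * b (Suc m) x y) + (\<Sum>m\<le>d. (?t m - ?t k) * ?c m * b m x y)"
    by (simp add: sum_distrib_left algebra_simps sum.distrib sum_subtractf)
  also have "(\<Sum>m\<le>d. ?c m * qint q (Suc m) * b (Suc m) x y)
     = (\<Sum>m\<le>Suc d. (if m = 0 then 0 else qint q m * ?c (m - 1)) * b m x y)"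
    by (subst sum.atMost_Suc_shift) (simp add: algebra_simps)
  also have "\<dots> = (\<Sum>m\<le>d. (if m = 0 then 0 else qint q m * ?c (m - 1)) * b m x y)"
    by (simp add: b_top)
  also have "\<dots> + (\<Sum>m\<le>d. (?t m - ?t k) * ?c m * b m x y)
     = (\<Sum>m\<le>d. qint q (Suc k) * lin_coeff q d (Suc k) l m * b m x y)"
    unfolding sum.distrib[symmetric] by (intro sum.cong) (simp_all only: lin_coeff_Suc atMost_iff distrib_right)
  also have "\<dots> = qint q (Suc k) * (\<Sum>m\<le>d. lin_coeff q d (Suc k) l m * b m x y)"
    by (simp add: sum_distrib_left mult.assoc)
  finally show ?case using qint_pos[OF q, of "Suc k"] by simp
qed

text \<open>Below the top index the product has a vanishing factor, with \<open>h = 1\<close> for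
  even \<open>m\<close> and \<open>h = 0\<close> for odd \<open>m\<close>; oddness of
  \<open>d\<close> fixes the sign of \<open>(- 1) ^ (d - m)\<close>. For even \<open>m\<close> the
  number of factors is even and positive, so \<open>h = 1\<close> does occur.\<close>

lemma lin_coeff_minus_one:
  assumes "odd d" "i \<le> d" "m \<le> d"
  shows "lin_coeff (- 1) d (2 * i) (2 * j) m = (if m = 2 * (i + j) then of_nat ((i + j) choose i) else 0)"
proof -
  consider "m > 2 * i + 2 * j" | "m = 2 * i + 2 * j" | "m < 2 * i + 2 * j" by linarith
  then show ?thesis
  proof cases
    case 2
    then show ?thesis using gbinom_minus_one[of "i + j" i] by (simp add: lin_coeff_def)
  next
    case 3
    define r where "r = 2 * i + 2 * j - m"
    have "\<exists>h\<in>{..<r}. (- 1 :: 'a) ^ (d - m) + (- 1) ^ Suc h = 0"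
    proof (cases "even m")
      case True
      then have "r \<ge> 2" "odd (d - m)" using 3 assms unfolding r_def by (presburger, simp)
      then show ?thesis by (intro bexI[of _ 1]) auto
    next
      case False
      then have "r \<ge> 1" "even (d - m)" using 3 assms unfolding r_def by auto
      then show ?thesis by (intro bexI[of _ 0]) auto
    qed
    then have "(\<Prod>h<r. (- 1 :: 'a) ^ (d - m) + (- 1) ^ Suc h) = 0"
      by (intro prod_zero) auto
    with 3 show ?thesis by (simp add: lin_coeff_def r_def)
  qed (auto simp: lin_coeff_def)
qed

section \<open>Maximal isotropic subspaces\<close>

lemma card_subspace:
  fixes U :: "('k::{field,finite} ^ 'n) set"
  assumes "vec.subspace U"
  shows "card U = CARD('k) ^ vec.dim U"
proof -
  have span: "card (vec.span S) = CARD('k) ^ card S" if "vec.independent S" for S :: "('k ^ 'n) set"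
  proof -
    have "finite S" by simp
    then show ?thesis using that
    proof (induction S)
      case empty
      show ?case by simp
    next
      case (insert a S)
      have ind: "vec.independent S" and a: "a \<notin> vec.span S"
        using insert.prems insert.hyps by (auto simp: vec.independent_insert)
      let ?f = "\<lambda>(c, u). c *s a + u"
      have "inj_on ?f (UNIV \<times> vec.span S)"
      proof (rule inj_onI, clarsimp)
        fix c u c' u'
        assume u: "u \<in> vec.span S" "u' \<in> vec.span S" and eq: "c *s a + u = c' *s a + u'"
        have "(c - c') *s a = u' - u" using eq by (simp add: vec.scale_left_diff_distrib algebra_simps)
        then have "(c - c') *s a \<in> vec.span S" using u by (simp add: vec.span_diff)
        then have "c = c'"
          using a vec.span_scale[of "(c - c') *s a" S "inverse (c - c')"] by (cases "c = c'") auto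
        then show "c = c' \<and> u = u'" using eq by simp
      qed
      moreover have "?f ` (UNIV \<times> vec.span S) = vec.span (insert a S)"
      proof (intro equalityI subsetI)
        fix x assume "x \<in> ?f ` (UNIV \<times> vec.span S)"
        then obtain c u where "u \<in> vec.span S" "x = c *s a + u" by auto
        then show "x \<in> vec.span (insert a S)"
          by (auto simp: vec.span_breakdown_eq intro!: exI[of _ c])
      next
        fix x assume "x \<in> vec.span (insert a S)"
        then obtain c where "x - c *s a \<in> vec.span S" by (auto simp: vec.span_breakdown_eq)
        then show "x \<in> ?f ` (UNIV \<times> vec.span S)"
          by (intro image_eqI[of _ _ "(c, x - c *s a)"]) auto
      qed
      ultimately have "card (vec.span (insert a S)) = card ((UNIV :: 'k set) \<times> vec.span S)"
        by (metis card_image)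
      then show ?case using insert ind by (simp add: card_cartesian_product)
    qed
  qed
  obtain S where S: "S \<subseteq> U" "vec.independent S" "U \<subseteq> vec.span S" "card S = vec.dim U"
    using vec.basis_exists[of U] by metis
  then have "vec.span S = U" using assms by (simp add: vec.span_subspace)
  with span[OF S(2)] S(4) show ?thesis by simp
qed

lemma span_insert_eq_subspace:
  fixes Z :: "('k::field ^ 'n) set"
  assumes "vec.subspace H" "vec.subspace Z" "H \<subseteq> Z" "vec.dim Z \<le> vec.dim H + 1" "v \<in> Z" "v \<notin> H"
  shows "vec.span (insert v H) = Z"
proof (rule vec.subspace_dim_equal)
  show "vec.span (insert v H) \<subseteq> Z"
    using assms by (intro vec.span_minimal) auto
  show "vec.dim Z \<le> vec.dim (vec.span (insert v H))"
    using assms by (simp add: vec.dim_insert vec.span_eq_iff[THEN iffD2])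
qed (use assms in auto)

text \<open>A vector \<open>v\<close> of \<open>Z \<inter> Y\<close> outside \<open>H\<close> spans
  \<open>Z\<close> together with \<open>H\<close>. Subtracting a multiple of \<open>v\<close> moves
  any vector of \<open>Z \<inter> Y\<close> into \<open>H\<close> without leaving
  \<open>Y\<close>.\<close>

lemma dim_Int_le_Suc:
  fixes Z :: "('k::field ^ 'n) set"
  assumes "vec.subspace H" "vec.subspace Z" "vec.subspace Y" "H \<subseteq> Z" "vec.dim Z \<le> vec.dim H + 1"
  shows "vec.dim (Z \<inter> Y) \<le> vec.dim (H \<inter> Y) + 1"
proof (cases "Z \<inter> Y \<subseteq> H")
  case True
  then have "Z \<inter> Y \<subseteq> H \<inter> Y" by auto
  then show ?thesis by (meson le_add1 le_trans vec.dim_subset)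
next
  case False
  then obtain v where v: "v \<in> Z" "v \<in> Y" "v \<notin> H" by auto
  have Z: "vec.span (insert v H) = Z" using assms v by (intro span_insert_eq_subspace) auto
  have "Z \<inter> Y \<subseteq> vec.span (insert v (H \<inter> Y))"
  proof
    fix w assume w: "w \<in> Z \<inter> Y"
    then obtain c where c: "w - c *s v \<in> H"
      using Z assms(1) by (metis IntD1 vec.span_breakdown_eq vec.span_eq_iff)
    moreover have "w - c *s v \<in> Y"
      using w v assms(3) by (simp add: vec.subspace_diff vec.subspace_scale)
    ultimately show "w \<in> vec.span (insert v (H \<inter> Y))"
      by (auto simp: vec.span_breakdown_eq intro!: exI[of _ c] vec.span_base)
  qed
  then have "vec.dim (Z \<inter> Y) \<le> vec.dim (insert v (H \<inter> Y))" by (rule vec.dim_mono)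
  also have "\<dots> \<le> vec.dim (H \<inter> Y) + 1" by (simp add: vec.dim_insert)
  finally show ?thesis .
qed

section \<open>Orthogonality in a symplectic space over a finite field\<close>

locale symplectic_space =
  fixes B :: "'k::{field,finite} ^ 'n \<Rightarrow> 'k ^ 'n \<Rightarrow> 'k" and d :: nat and Q :: int
  assumes form: "symplectic_form B" and nondeg: "nondegenerate B" and dimension: "CARD('n) = 2 * d"
    and Q_eq: "Q = int CARD('k)"
begin

definition perp :: "('k ^ 'n) set \<Rightarrow> ('k ^ 'n) set" where
  "perp U = {v. \<forall>u\<in>U. B u v = 0}"

abbreviation "X \<equiv> max_isotropic_subspaces B"

lemma B_add_right: "B x (y + z) = B x y + B x z"
  and B_scale_right: "B x (c *s y) = c * B x y"
proof -
  interpret Vector_Spaces.linear "(*s)" "(*)" "\<lambda>y. B x y"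
    using form by (simp add: symplectic_form_def)
  show "B x (y + z) = B x y + B x z" "B x (c *s y) = c * B x y"
    by (rule add, rule scale)
qed

lemma B_add_left: "B (x + y) z = B x z + B y z"
  and B_scale_left: "B (c *s x) z = c * B x z"
proof -
  interpret Vector_Spaces.linear "(*s)" "(*)" "\<lambda>y. B y z"
    using form by (simp add: symplectic_form_def)
  show "B (x + y) z = B x z + B y z" "B (c *s x) z = c * B x z"
    by (rule add, rule scale)
qed

lemma B_same [simp]: "B x x = 0"
  using form by (simp add: symplectic_form_def)

lemma B_zero [simp]: "B x 0 = 0" "B 0 x = 0"
  using B_scale_right[of x 0 0] B_scale_left[of 0 0 x] by simp_all

lemma B_skew: "B x y = - B y x"
proof -
  have "0 = B (x + y) (x + y)" by simp
  also have "\<dots> = B x y + B y x" unfolding B_add_left B_add_right by simp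
  finally show ?thesis by (metis eq_neg_iff_add_eq_0)
qed

lemma B_zero_sym: "B x y = 0 \<longleftrightarrow> B y x = 0"
  using B_skew[of x y] by auto

lemma subspace_perp [simp]: "vec.subspace (perp U)"
  by (rule vec.subspaceI) (auto simp: perp_def B_add_right B_scale_right)

lemma subspace_perp' : "vec.subspace {u. B u v = 0}"
  by (rule vec.subspaceI) (auto simp: B_add_left B_scale_left)

lemma perp_antimono: "U \<subseteq> W \<Longrightarrow> perp W \<subseteq> perp U"
  by (auto simp: perp_def)

lemma perp_span: "perp (vec.span S) = perp S"
proof
  show "perp (vec.span S) \<subseteq> perp S"
    by (intro perp_antimono vec.span_superset)
  show "perp S \<subseteq> perp (vec.span S)"
  proof
    fix v assume "v \<in> perp S"
    then have "vec.span S \<subseteq> {u. B u v = 0}"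
      by (intro vec.span_minimal subspace_perp') (auto simp: perp_def)
    then show "v \<in> perp (vec.span S)" by (auto simp: perp_def)
  qed
qed

lemma dim_Int_perp:
  assumes "vec.subspace T"
  shows "vec.dim T \<le> vec.dim (T \<inter> perp {v}) + 1"
proof (cases "T \<subseteq> perp {v}")
  case True
  then show ?thesis by (simp add: inf.absorb1)
next
  case False
  then obtain t where t: "t \<in> T" "B v t \<noteq> 0" by (auto simp: perp_def)
  have "T \<subseteq> vec.span (insert t (T \<inter> perp {v}))"
  proof
    fix w assume w: "w \<in> T"
    define c where "c = - (B v w / B v t)"
    have "B v (w + c *s t) = B v w + c * B v t" by (simp add: B_add_right B_scale_right)
    then have "B v (w + c *s t) = 0" using t by (simp add: c_def)
    moreover have "w + c *s t \<in> T" using w t assms by (simp add: vec.subspace_add vec.subspace_scale)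
    ultimately have "w - (- c) *s t \<in> vec.span (T \<inter> perp {v})"
      by (intro vec.span_base) (auto simp: perp_def)
    then show "w \<in> vec.span (insert t (T \<inter> perp {v}))"
      unfolding vec.span_breakdown_eq by blast
  qed
  then have "vec.dim T \<le> vec.dim (insert t (T \<inter> perp {v}))" by (rule vec.dim_mono)
  also have "\<dots> \<le> vec.dim (T \<inter> perp {v}) + 1" by (simp add: vec.dim_insert)
  finally show ?thesis .
qed

lemma dim_perp_union:
  "finite S \<Longrightarrow> vec.dim (perp T) \<le> vec.dim (perp (S \<union> T)) + card S"
proof (induction S rule: finite_induct)
  case (insert v S)
  have "perp (insert v S \<union> T) = perp (S \<union> T) \<inter> perp {v}" by (auto simp: perp_def)
  moreover have "vec.dim (perp (S \<union> T)) \<le> vec.dim (perp (S \<union> T) \<inter> perp {v}) + 1"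
    by (rule dim_Int_perp) simp
  ultimately show ?case using insert by simp
qed simp

text \<open>Along a basis of the whole space extending one of \<open>U\<close>, the dimension of the orthogonal space
  drops from \<open>2 * d\<close> to \<open>0\<close> in \<open>2 * d\<close> steps, each of size at most one.\<close>

lemma dim_perp:
  assumes "vec.subspace U"
  shows "vec.dim (perp U) + vec.dim U = 2 * d"
proof -
  obtain S where S: "S \<subseteq> U" "vec.independent S" "U \<subseteq> vec.span S" "card S = vec.dim U"
    using vec.basis_exists[of U] by metis
  then have spanS: "vec.span S = U" using assms by (simp add: vec.span_subspace)
  obtain E where E: "S \<subseteq> E" "vec.independent E" "UNIV \<subseteq> vec.span E"
    using vec.maximal_independent_subset_extend[OF subset_UNIV S(2)] by metis
  have cardE: "card E = 2 * d"
    using vec.basis_card_eq_dim[OF subset_UNIV E(3,2)] dimension by (simp only: vec_dim_card)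
  have "vec.span E = UNIV" using E(3) by auto
  then have "perp E = perp UNIV" using perp_span[of E] by simp
  also have "perp UNIV = {0}"
  proof -
    have "v = 0" if "\<forall>u. B u v = 0" for v
      using that nondeg B_zero_sym[of _ v] by (simp add: nondegenerate_def)
    then show ?thesis by (auto simp: perp_def)
  qed
  finally have pE: "vec.dim (perp E) = 0" by simp
  have "vec.dim (perp {}) \<le> vec.dim (perp S) + card S"
    using dim_perp_union[of S "{}"] by simp
  moreover have "vec.dim (perp {}) = 2 * d"
    using dimension by (simp add: perp_def vec_dim_card del: vec.dim_UNIV)
  moreover have "vec.dim (perp S) \<le> vec.dim (perp E) + card (E - S)"
    using dim_perp_union[of "E - S" S] E(1) by (simp add: Un_absorb2)
  moreover have "card (E - S) = card E - card S" using E(1) by (simp add: card_Diff_subset)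
  moreover have "card S \<le> card E" using E(1) by (simp add: card_mono)
  moreover have "perp S = perp U" using perp_span[of S] spanS by simp
  ultimately show ?thesis using pE cardE S(4) by simp
qed

lemma isotropic_insert:
  assumes "totally_isotropic B U" "v \<in> perp U"
  shows "totally_isotropic B (vec.span (insert v U))"
proof -
  have sub: "vec.subspace U" using assms by (simp add: totally_isotropic_def)
  have "B x y = 0" if xy: "x \<in> vec.span (insert v U)" "y \<in> vec.span (insert v U)" for x y
  proof -
    obtain a u where a: "u \<in> U" "x = u + a *s v"
      using xy(1) sub by (metis diff_add_cancel vec.span_breakdown_eq vec.span_eq_iff)
    obtain b w where b: "w \<in> U" "y = w + b *s v"
      using xy(2) sub by (metis diff_add_cancel vec.span_breakdown_eq vec.span_eq_iff)
    have "B u w = 0" "B u v = 0" "B w v = 0"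
      using assms a b by (auto simp: totally_isotropic_def perp_def)
    then show ?thesis using B_zero_sym[of v w]
      by (simp add: a b B_add_left B_add_right B_scale_left B_scale_right)
  qed
  then show ?thesis by (simp add: totally_isotropic_def)
qed

section \<open>Self-orthogonality and dimension of maximal isotropic subspaces\<close>

lemma X_subspace: "U \<in> X \<Longrightarrow> vec.subspace U"
  by (simp add: max_isotropic_subspaces_def totally_isotropic_def)

lemma X_isotropic: "U \<in> X \<Longrightarrow> totally_isotropic B U"
  by (simp add: max_isotropic_subspaces_def)

text \<open>A vector orthogonal to \<open>U\<close> but outside it would span a larger isotropic
  subspace with \<open>U\<close>, because the form is alternating.\<close>

lemma perp_X:
  assumes "U \<in> X"
  shows "perp U = U"
proof
  show "U \<subseteq> perp U" using X_isotropic[OF assms] by (auto simp: totally_isotropic_def perp_def)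
  show "perp U \<subseteq> U"
  proof
    fix v assume "v \<in> perp U"
    then have "totally_isotropic B (vec.span (insert v U))"
      using isotropic_insert X_isotropic[OF assms] by blast
    moreover have "insert v U \<subseteq> vec.span (insert v U)" by (rule vec.span_superset)
    ultimately have "vec.span (insert v U) = U"
      using assms by (auto simp: max_isotropic_subspaces_def)
    then show "v \<in> U" using \<open>insert v U \<subseteq> _\<close> by blast
  qed
qed

lemma dim_X: "U \<in> X \<Longrightarrow> vec.dim U = d"
  using dim_perp[OF X_subspace, of U] perp_X[of U] by simp

text \<open>Any isotropic subspace above \<open>U\<close> lies in \<open>perp U\<close>, which has
  dimension \<open>2 * d - d\<close> as well.\<close>

lemma X_I:
  assumes "totally_isotropic B U" "vec.dim U = d"
  shows "U \<in> X"
proof -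
  have "U' = U" if "totally_isotropic B U'" "U \<subseteq> U'" for U'
  proof -
    have "vec.subspace U" "vec.subspace U'" using assms that by (auto simp: totally_isotropic_def)
    moreover have "U' \<subseteq> perp U" using that by (auto simp: totally_isotropic_def perp_def)
    then have "vec.dim U' \<le> vec.dim (perp U)" by (rule vec.dim_subset)
    moreover have "vec.dim (perp U) = d" using dim_perp[of U] assms calculation by simp
    ultimately show ?thesis using that assms vec.subspace_dim_equal[of U U'] by simp
  qed
  then show ?thesis using assms by (auto simp: max_isotropic_subspaces_def)
qed

lemma X_nonempty: "\<exists>x. x \<in> X"
proof -
  have "totally_isotropic B {0}" by (simp add: totally_isotropic_def)
  then have ne: "{U. totally_isotropic B U} \<noteq> {}" by blast
  obtain U where "U \<in> {U. totally_isotropic B U}" "\<forall>W\<in>{U. totally_isotropic B U}. U \<subseteq> W \<longrightarrow> U = W"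
    using finite_has_maximal[OF _ ne] by auto
  then have "U \<in> X" by (auto simp: max_isotropic_subspaces_def)
  then show ?thesis ..
qed

text \<open>The unique neighbour of \<open>x\<close> in the dual polar graph that contains the vector \<open>v \<notin> x\<close>.\<close>

definition nb :: "('k ^ 'n) set \<Rightarrow> 'k ^ 'n \<Rightarrow> ('k ^ 'n) set" where
  "nb x v = vec.span (insert v (x \<inter> perp {v}))"

definition nbs :: "('k ^ 'n) set \<Rightarrow> ('k ^ 'n) set set" where
  "nbs x = {z \<in> X. vec.dim (x \<inter> z) = d - 1}"

text \<open>As \<open>x\<close> is its own orthogonal space, \<open>v\<close> is not orthogonal to
  all of \<open>x\<close>, so \<open>perp {v}\<close> cuts out a hyperplane. The claim
  \<open>d > 0\<close> guards the truncated \<open>d - 1\<close>.\<close>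

lemma dim_hyperplane:
  assumes x: "x \<in> X" and v: "v \<notin> x"
  shows "vec.dim (x \<inter> perp {v}) = d - 1" "d > 0"
proof -
  have "v \<notin> perp x" using v perp_X[OF x] by simp
  then obtain u where "u \<in> x" "B u v \<noteq> 0" by (auto simp: perp_def)
  then have u: "u \<in> x" "u \<notin> perp {v}" using B_zero_sym[of u v] by (auto simp: perp_def)
  have "vec.dim (x \<inter> perp {v}) < vec.dim x"
    using u X_subspace[OF x]
    by (intro vec.dim_psubset) (auto simp: vec.span_eq_iff[THEN iffD2] vec.subspace_inter)
  moreover have "vec.dim x \<le> vec.dim (x \<inter> perp {v}) + 1" by (intro dim_Int_perp X_subspace x)
  ultimately show "vec.dim (x \<inter> perp {v}) = d - 1" "d > 0" using dim_X[OF x] by simp_all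
qed

lemma nb_props:
  assumes x: "x \<in> X" and v: "v \<notin> x"
  shows "nb x v \<in> nbs x" "v \<in> nb x v" "x \<inter> nb x v = x \<inter> perp {v}"
proof -
  let ?H = "x \<inter> perp {v}"
  have H: "vec.subspace ?H" using X_subspace[OF x] by (simp add: vec.subspace_inter)
  have dH: "vec.dim ?H = d - 1" and d: "d > 0" using dim_hyperplane[OF x v] by auto
  have "totally_isotropic B ?H" using X_isotropic[OF x] H by (auto simp: totally_isotropic_def)
  moreover have "v \<in> perp ?H" using B_zero_sym by (auto simp: perp_def)
  ultimately have iso: "totally_isotropic B (nb x v)"
    unfolding nb_def by (rule isotropic_insert)
  have "v \<notin> vec.span ?H" using v H by (simp add: vec.span_eq_iff[THEN iffD2])
  then have dim: "vec.dim (nb x v) = d"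
    unfolding nb_def using dH d by (simp only: vec.dim_span vec.dim_insert) simp
  have nX: "nb x v \<in> X" using iso dim by (rule X_I)
  show vn: "v \<in> nb x v" unfolding nb_def by (simp add: vec.span_base)
  show eq: "x \<inter> nb x v = ?H"
  proof
    show "?H \<subseteq> x \<inter> nb x v" unfolding nb_def by (auto intro: vec.span_base)
    show "x \<inter> nb x v \<subseteq> ?H"
      using iso vn B_zero_sym by (auto simp: totally_isotropic_def perp_def)
  qed
  show "nb x v \<in> nbs x" using nX eq dH by (simp add: nbs_def)
qed

text \<open>Since \<open>z\<close> is isotropic, \<open>x \<inter> z\<close> is orthogonal to
  \<open>v\<close>; equal dimensions make it all of \<open>x \<inter> perp {v}\<close>, and this
  hyperplane of \<open>z\<close> spans \<open>z\<close> together with \<open>v\<close>.\<close>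

lemma nb_unique:
  assumes x: "x \<in> X" and z: "z \<in> nbs x" and v: "v \<in> z" "v \<notin> x"
  shows "nb x v = z"
proof -
  have zX: "z \<in> X" using z by (simp add: nbs_def)
  have "x \<inter> z \<subseteq> x \<inter> perp {v}"
    using X_isotropic[OF zX] v by (auto simp: totally_isotropic_def perp_def)
  moreover have "vec.dim (x \<inter> perp {v}) = d - 1" "d > 0" using dim_hyperplane[OF x v(2)] by auto
  ultimately have eq: "x \<inter> z = x \<inter> perp {v}"
    using z X_subspace[OF x] X_subspace[OF zX]
    by (intro vec.subspace_dim_equal) (auto simp: nbs_def vec.subspace_inter)
  show ?thesis unfolding nb_def eq[symmetric]
    using z v X_subspace[OF x] X_subspace[OF zX] dim_X[OF zX] \<open>d > 0\<close>
    by (intro span_insert_eq_subspace) (auto simp: nbs_def vec.subspace_inter)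
qed

text \<open>Double counting of the pairs \<open>(v, z)\<close> with \<open>v \<in> z \<inter> Y - x\<close>: the vector determines
  the neighbour \<open>z\<close> of \<open>x\<close>.\<close>

lemma count_nbs:
  assumes x: "x \<in> X" and N: "N \<subseteq> nbs x"
    and in_N: "\<And>v. v \<in> Y \<Longrightarrow> v \<notin> x \<Longrightarrow> nb x v \<in> N"
    and card_N: "\<And>z. z \<in> N \<Longrightarrow> card (z \<inter> Y - x) = c"
  shows "card N * c = card (Y - x)"
proof -
  have "Y - x = (\<Union>z\<in>N. z \<inter> Y - x)"
    using in_N nb_props[OF x] by blast
  moreover have "card (\<Union>z\<in>N. z \<inter> Y - x) = (\<Sum>z\<in>N. card (z \<inter> Y - x))"
  proof (rule card_UN_disjoint)
    show "\<forall>i\<in>N. \<forall>j\<in>N. i \<noteq> j \<longrightarrow> (i \<inter> Y - x) \<inter> (j \<inter> Y - x) = {}"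
      using nb_unique[OF x] N by blast
  qed simp_all
  ultimately show ?thesis using card_N by simp
qed

section \<open>Intersection numbers of the dual polar graph\<close>

lemma Q_gt_1: "Q > 1"
proof -
  have "card {0, 1 :: 'k} \<le> CARD('k)" by (rule card_mono) auto
  then show ?thesis by (simp add: Q_eq)
qed

text \<open>Turns double counts into \<open>q\<close>-integers: over \<open>int\<close>, where
  subtraction is not truncated, \<open>Q ^ a\<close> and \<open>Q - 1\<close> cancel. In the
  applications \<open>a\<close> is the dimension of \<open>x \<inter> z \<inter> Y\<close> for the
  set \<open>Y\<close> of the count.\<close>

lemma qint_from_card:
  assumes "N * (CARD('k) ^ Suc a - CARD('k) ^ a) = CARD('k) ^ (a + r + e) - CARD('k) ^ (a + e)"
  shows "int N = Q ^ e * qint Q r"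
proof -
  have le: "CARD('k) ^ a \<le> CARD('k) ^ Suc a" "CARD('k) ^ (a + e) \<le> CARD('k) ^ (a + r + e)"
    by (intro power_increasing, simp, simp add: Suc_leI)+
  have "int N * (Q ^ Suc a - Q ^ a) = Q ^ (a + r + e) - Q ^ (a + e)"
    using arg_cong[OF assms, of int] le by (simp add: of_nat_diff Q_eq del: power_Suc)
  then have "int N * (Q - 1) * Q ^ a = (Q ^ r - 1) * Q ^ e * Q ^ a"
    by (simp add: algebra_simps power_add)
  then have "int N * (Q - 1) = (Q - 1) * qint Q r * Q ^ e"
    using Q_gt_1 by (simp add: qint_mult)
  then have "(Q - 1) * int N = (Q - 1) * (Q ^ e * qint Q r)" by (simp only: mult_ac)
  then show ?thesis using Q_gt_1 by simp
qed

text \<open>\<open>x \<inter> z\<close> is a hyperplane of both \<open>x\<close> and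
  \<open>z\<close>, so replacing \<open>x\<close> by \<open>z\<close> changes the dimension of the
  intersection with \<open>y\<close> by at most one; whether \<open>z\<close> contains
  \<open>x \<inter> y\<close> decides the direction.\<close>

lemma nbs_Int:
  assumes x: "x \<in> X" and y: "y \<in> X" and z: "z \<in> nbs x" and d: "d > 0"
  shows nbs_Int_le: "vec.dim (z \<inter> y) \<le> vec.dim (x \<inter> y) + 1"
    and nbs_Int_sup: "vec.dim (z \<inter> y) = vec.dim (x \<inter> y) + 1 \<Longrightarrow> x \<inter> y \<subseteq> z"
    and nbs_Int_ge: "x \<inter> y \<subseteq> z \<Longrightarrow> vec.dim (z \<inter> y) \<ge> vec.dim (x \<inter> y)"
    and nbs_Int_not_sup: "\<not> x \<inter> y \<subseteq> z \<Longrightarrow> vec.dim (z \<inter> y) + 1 = vec.dim (x \<inter> y)"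
proof -
  have zX: "z \<in> X" and zd: "vec.dim (x \<inter> z) = d - 1" using z by (auto simp: nbs_def)
  note sub = X_subspace[OF x] X_subspace[OF y] X_subspace[OF zX]
  have subI: "vec.subspace (x \<inter> z)" "vec.subspace (x \<inter> y)" "vec.subspace (x \<inter> z \<inter> y)"
    using sub by (simp_all add: vec.subspace_inter)
  have dims: "vec.dim z \<le> vec.dim (x \<inter> z) + 1" "vec.dim x \<le> vec.dim (x \<inter> z) + 1"
    using zd dim_X[OF zX] dim_X[OF x] d by simp_all
  have h1: "vec.dim (z \<inter> y) \<le> vec.dim (x \<inter> z \<inter> y) + 1"
    using sub subI dims by (intro dim_Int_le_Suc) auto
  have h2: "vec.dim (x \<inter> y) \<le> vec.dim (x \<inter> z \<inter> y) + 1"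
    using sub subI dims by (intro dim_Int_le_Suc) auto
  have h3: "vec.dim (x \<inter> z \<inter> y) \<le> vec.dim (x \<inter> y)" by (intro vec.dim_subset) auto
  show "vec.dim (z \<inter> y) \<le> vec.dim (x \<inter> y) + 1" using h1 h3 by simp
  show "x \<inter> y \<subseteq> z" if "vec.dim (z \<inter> y) = vec.dim (x \<inter> y) + 1"
  proof -
    have "x \<inter> z \<inter> y = x \<inter> y"
      using that h1 subI by (intro vec.subspace_dim_equal) auto
    then show ?thesis by blast
  qed
  show "vec.dim (z \<inter> y) \<ge> vec.dim (x \<inter> y)" if "x \<inter> y \<subseteq> z"
    using that by (intro vec.dim_subset) auto
  show "vec.dim (z \<inter> y) + 1 = vec.dim (x \<inter> y)" if ns: "\<not> x \<inter> y \<subseteq> z"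
  proof -
    \<comment> \<open>A vector \<open>v\<close> of \<open>z \<inter> y\<close> outside
      \<open>x\<close> would determine \<open>z\<close> as \<open>nb x v\<close>, which contains
      \<open>x \<inter> perp {v}\<close> and hence \<open>x \<inter> y\<close>.\<close>
    have "z \<inter> y \<subseteq> x"
    proof (rule ccontr)
      assume "\<not> z \<inter> y \<subseteq> x"
      then obtain v where v: "v \<in> z" "v \<in> y" "v \<notin> x" by auto
      have "x \<inter> y \<subseteq> x \<inter> perp {v}"
        using X_isotropic[OF y] v by (auto simp: totally_isotropic_def perp_def)
      also have "\<dots> \<subseteq> nb x v" using nb_props[OF x v(3)] by auto
      also have "\<dots> = z" using nb_unique[OF x z v(1,3)] .
      finally show False using ns by simp
    qed
    then have eq: "z \<inter> y = x \<inter> z \<inter> y" by auto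
    have "x \<inter> z \<inter> y \<subset> x \<inter> y" using ns by auto
    then have "vec.dim (x \<inter> z \<inter> y) < vec.dim (x \<inter> y)"
      using subI by (intro vec.dim_psubset) (simp add: vec.span_eq_iff[THEN iffD2])
    then show ?thesis using h2 eq by simp
  qed
qed

lemma card_diff_subspace:
  fixes U :: "('k ^ 'n) set"
  assumes "vec.subspace U" "vec.subspace W"
  shows "card (U - W) = CARD('k) ^ vec.dim U - CARD('k) ^ vec.dim (W \<inter> U)"
proof -
  have "card (U - W) = card U - card (U \<inter> W)" by (rule card_Diff_subset_Int) simp
  then show ?thesis using assms by (simp add: card_subspace vec.subspace_inter Int_commute)
qed

text \<open>The count with \<open>Y = perp D\<close>: \<open>nb x v\<close> contains
  \<open>D\<close> exactly when \<open>v\<close> is orthogonal to \<open>D\<close>. A neighbour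
  containing \<open>D\<close> lies inside \<open>perp D\<close>, so all its vectors outside
  \<open>x\<close> are counted.\<close>

lemma card_nbs_sup:
  assumes x: "x \<in> X" and D: "D \<subseteq> x" "vec.subspace D" and d: "d > 0"
  shows "int (card {z \<in> nbs x. D \<subseteq> z}) = Q * qint Q (d - vec.dim D)"
proof -
  let ?N = "{z \<in> nbs x. D \<subseteq> z}"
  have le: "vec.dim D \<le> d" using vec.dim_subset[OF D(1)] dim_X[OF x] by simp
  have xp: "x \<subseteq> perp D" using perp_antimono[OF D(1)] perp_X[OF x] by simp
  have "card ?N * (CARD('k) ^ Suc (d - 1) - CARD('k) ^ (d - 1)) = card (perp D - x)"
  proof (rule count_nbs[OF x])
    show "nb x v \<in> ?N" if v: "v \<in> perp D" "v \<notin> x" for v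
    proof -
      have "D \<subseteq> x \<inter> perp {v}" using v D(1) B_zero_sym by (auto simp: perp_def)
      then show ?thesis using nb_props[OF x v(2)] by auto
    qed
    show "card (z \<inter> perp D - x) = CARD('k) ^ Suc (d - 1) - CARD('k) ^ (d - 1)" if "z \<in> ?N" for z
    proof -
      have zX: "z \<in> X" "vec.dim (x \<inter> z) = d - 1" "D \<subseteq> z" using that by (auto simp: nbs_def)
      have "z \<inter> perp D = z" using perp_antimono[OF zX(3)] perp_X[OF zX(1)] by auto
      then show ?thesis
        using card_diff_subspace[OF X_subspace[OF zX(1)] X_subspace[OF x]] zX dim_X[OF zX(1)] d by simp
    qed
  qed auto
  also have "card (perp D - x) = CARD('k) ^ (2 * d - vec.dim D) - CARD('k) ^ d"
  proof -
    have "vec.dim (perp D) = 2 * d - vec.dim D" using dim_perp[OF D(2)] by simp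
    then show ?thesis
      using card_diff_subspace[OF subspace_perp X_subspace[OF x], of D] xp dim_X[OF x]
      by (simp add: inf.absorb1)
  qed
  also have "2 * d - vec.dim D = d - 1 + (d - vec.dim D) + 1" using le d by simp
  also have "CARD('k) ^ d = CARD('k) ^ (d - 1 + 1)" using d by simp
  finally show ?thesis
    using qint_from_card[of "card ?N" "d - 1" "d - vec.dim D" 1] by simp
qed

lemma card_nbs: "x \<in> X \<Longrightarrow> d > 0 \<Longrightarrow> int (card (nbs x)) = Q * qint Q d"
  using card_nbs_sup[of x "{0}"] vec.subspace_0[OF X_subspace]
  by (simp add: nbs_def) (metis (no_types, lifting) Collect_cong X_subspace vec.subspace_0)

text \<open>The count with \<open>Y = y\<close>: the vectors of \<open>x \<inter> y\<close> are
  orthogonal to each \<open>v\<close> in \<open>y\<close>, so \<open>nb x v\<close> contains them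
  all and \<open>v\<close> besides.\<close>

lemma card_nbs_down:
  assumes x: "x \<in> X" and y: "y \<in> X" and d: "d > 0"
  shows "int (card {z \<in> nbs x. vec.dim (z \<inter> y) = Suc (vec.dim (x \<inter> y))}) = qint Q (d - vec.dim (x \<inter> y))"
proof -
  let ?j = "vec.dim (x \<inter> y)"
  let ?N = "{z \<in> nbs x. vec.dim (z \<inter> y) = Suc ?j}"
  have le: "?j \<le> d" using vec.dim_subset[of "x \<inter> y" x] dim_X[OF x] by simp
  have "card ?N * (CARD('k) ^ Suc ?j - CARD('k) ^ ?j) = card (y - x)"
  proof (rule count_nbs[OF x])
    show "nb x v \<in> ?N" if v: "v \<in> y" "v \<notin> x" for v
    proof -
      have nbx: "nb x v \<in> nbs x" using nb_props[OF x v(2)] by simp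
      then have sub: "vec.subspace (nb x v)" using X_subspace by (simp add: nbs_def)
      have "x \<inter> y \<subseteq> x \<inter> perp {v}"
        using X_isotropic[OF y] v by (auto simp: totally_isotropic_def perp_def)
      then have "x \<inter> y \<subset> nb x v \<inter> y" using nb_props[OF x v(2)] v by blast
      then have "?j < vec.dim (nb x v \<inter> y)"
        using sub X_subspace[OF x] X_subspace[OF y]
        by (intro vec.dim_psubset) (simp add: vec.span_eq_iff[THEN iffD2] vec.subspace_inter)
      then show ?thesis using nbs_Int_le[OF x y nbx d] nbx by simp
    qed
    show "card (z \<inter> y - x) = CARD('k) ^ Suc ?j - CARD('k) ^ ?j" if "z \<in> ?N" for z
    proof -
      have zX: "z \<in> X" "z \<in> nbs x" "vec.dim (z \<inter> y) = Suc ?j" using that by (auto simp: nbs_def)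
      then have "x \<inter> y \<subseteq> z" using nbs_Int_sup[OF x y zX(2) d] by simp
      then have "x \<inter> (z \<inter> y) = x \<inter> y" by auto
      then show ?thesis
        using card_diff_subspace[of "z \<inter> y" x] X_subspace[OF x] X_subspace[OF y] X_subspace[OF zX(1)] zX(3)
        by (simp add: vec.subspace_inter)
    qed
  qed auto
  also have "card (y - x) = CARD('k) ^ d - CARD('k) ^ ?j"
    using card_diff_subspace[of y x] X_subspace[OF x] X_subspace[OF y] dim_X[OF y] by simp
  finally show ?thesis using qint_from_card[of "card ?N" ?j "d - ?j" 0] le by simp
qed

text \<open>The coefficients are the numbers of neighbours of \<open>x\<close> that are nearer to
  \<open>y\<close>, equally far and farther away. For \<open>j = 0\<close> the last one is zero, so
  the truncated \<open>j - 1\<close> is harmless.\<close>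

lemma sum_nbs:
  fixes f :: "nat \<Rightarrow> int"
  assumes x: "x \<in> X" and y: "y \<in> X" and d: "d > 0"
  defines "j \<equiv> vec.dim (x \<inter> y)"
  shows "(\<Sum>z\<in>nbs x. f (vec.dim (z \<inter> y))) =
    qint Q (d - j) * f (Suc j) + (Q - 1) * qint Q (d - j) * f j + Q * (qint Q d - qint Q (d - j)) * f (j - 1)"
proof -
  let ?D = "{z \<in> nbs x. vec.dim (z \<inter> y) = Suc j}"
  let ?S = "{z \<in> nbs x. x \<inter> y \<subseteq> z}"
  let ?g = "\<lambda>z. f (vec.dim (z \<inter> y))"
  have DS: "?D \<subseteq> ?S" using nbs_Int_sup[OF x y _ d] by (auto simp: j_def)
  have "sum ?g (nbs x) = sum ?g (nbs x - ?S) + sum ?g ?S"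
    by (rule sum.subset_diff) auto
  also have "sum ?g ?S = sum ?g (?S - ?D) + sum ?g ?D"
    by (rule sum.subset_diff[OF DS]) auto
  also have "sum ?g ?D = of_nat (card ?D) * f (Suc j)" by simp
  also have "sum ?g (?S - ?D) = (\<Sum>z\<in>?S - ?D. f j)"
  proof (rule sum.cong[OF refl])
    fix z assume "z \<in> ?S - ?D"
    then show "?g z = f j"
      using nbs_Int_le[OF x y, of z] nbs_Int_ge[OF x y, of z] d by (auto simp: j_def le_Suc_eq)
  qed
  also have "(\<Sum>z\<in>?S - ?D. f j) = (int (card ?S) - int (card ?D)) * f j"
    using DS by (simp add: card_Diff_subset of_nat_diff card_mono)
  also have "sum ?g (nbs x - ?S) = (\<Sum>z\<in>nbs x - ?S. f (j - 1))"
  proof (rule sum.cong[OF refl])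
    fix z assume "z \<in> nbs x - ?S"
    then have "vec.dim (z \<inter> y) + 1 = j"
      using nbs_Int_not_sup[OF x y, of z] d by (auto simp: j_def)
    then show "?g z = f (j - 1)" by (metis diff_add_inverse2)
  qed
  also have "(\<Sum>z\<in>nbs x - ?S. f (j - 1)) = (int (card (nbs x)) - int (card ?S)) * f (j - 1)"
    by (subst sum_constant, subst card_Diff_subset) (auto simp: of_nat_diff card_mono)
  also have "int (card ?S) = Q * qint Q (d - j)"
    unfolding j_def using X_subspace[OF x] X_subspace[OF y] d
    by (intro card_nbs_sup[OF x]) (auto simp: vec.subspace_inter)
  also have "int (card ?D) = qint Q (d - j)"
    unfolding j_def by (rule card_nbs_down[OF x y d])
  also have "int (card (nbs x)) = Q * qint Q d" by (rule card_nbs[OF x d])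
  finally show ?thesis by (simp add: algebra_simps)
qed

text \<open>Descending induction: if every neighbour of \<open>x\<close> contained
  \<open>x \<inter> y\<close>, the count of such neighbours would be the full valency, contradicting
  the growth of \<open>qint Q\<close>. That every dimension occurs is what later yields linear
  independence.\<close>

lemma ex_dim_Int:
  assumes "j \<le> d"
  shows "\<exists>x\<in>X. \<exists>y\<in>X. vec.dim (x \<inter> y) = j"
  using assms
proof (induction rule: inc_induct)
  case base
  show ?case using X_nonempty dim_X by (metis inf.idem)
next
  case (step j)
  then obtain x y where xy: "x \<in> X" "y \<in> X" "vec.dim (x \<inter> y) = Suc j" by auto
  have d: "d > 0" using step by simp
  have "\<exists>z\<in>nbs x. \<not> x \<inter> y \<subseteq> z"
  proof (rule ccontr)
    assume "\<not> (\<exists>z\<in>nbs x. \<not> x \<inter> y \<subseteq> z)"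
    then have "{z \<in> nbs x. x \<inter> y \<subseteq> z} = nbs x" by auto
    then have "Q * qint Q (d - Suc j) = Q * qint Q d"
      using card_nbs_sup[of x "x \<inter> y"] card_nbs[of x] xy d X_subspace[OF xy(1)] X_subspace[OF xy(2)]
      by (auto simp: vec.subspace_inter)
    then have "qint Q (d - Suc j) = qint Q d" using Q_gt_1 by simp
    moreover have "qint Q d = qint Q (Suc j) * Q ^ (d - Suc j) + qint Q (d - Suc j)"
      using qint_add[of Q "Suc j" "d - Suc j"] step by simp
    moreover have "qint Q (Suc j) > 0" using Q_gt_1 by (intro qint_pos) auto
    ultimately show False using Q_gt_1 by simp
  qed
  then obtain z where z: "z \<in> nbs x" "\<not> x \<inter> y \<subseteq> z" by auto
  then have "vec.dim (z \<inter> y) = j" using nbs_Int_not_sup[OF xy(1,2) z(1) d] xy(3) by simp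
  then show ?case using z xy by (auto simp: nbs_def)
qed

section \<open>The subspace-counting matrices over the integers\<close>

lemma dim_Int_X_le: "x \<in> X \<Longrightarrow> vec.dim (x \<inter> y) \<le> d"
  using vec.dim_subset[of "x \<inter> y" x] dim_X by simp

lemma dim_Int_X_eq:
  assumes "x \<in> X" "y \<in> X"
  shows "vec.dim (x \<inter> y) = d \<longleftrightarrow> x = y"
proof
  assume dim: "vec.dim (x \<inter> y) = d"
  have sub: "vec.subspace (x \<inter> y)" using assms X_subspace by (simp add: vec.subspace_inter)
  have "x \<inter> y = x"
    using vec.subspace_dim_equal[OF sub X_subspace[OF assms(1)] inf_le1] dim dim_X[OF assms(1)] by simp
  moreover have "x \<inter> y = y"
    using vec.subspace_dim_equal[OF sub X_subspace[OF assms(2)] inf_le2] dim dim_X[OF assms(2)] by simp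
  ultimately show "x = y" by simp
qed (use assms dim_X in simp)

text \<open>The number of \<open>(d - k)\<close>-dimensional subspaces of \<open>x \<inter> y\<close>.\<close>

definition b_int :: "nat \<Rightarrow> ('k ^ 'n) set \<Rightarrow> ('k ^ 'n) set \<Rightarrow> int" where
  "b_int k x y = (if k \<le> d then gbinom Q (vec.dim (x \<inter> y)) (d - k) else 0)"

lemma b_int_rec:
  assumes x: "x \<in> X" and y: "y \<in> X" and d: "d > 0" and k: "k \<le> d"
  shows "(\<Sum>z\<in>X. (if z \<in> nbs x then 1 else 0) * b_int k z y) =
    qint Q (Suc k) * b_int (Suc k) x y + t_eig Q d k * b_int k x y"
proof -
  define j where "j = vec.dim (x \<inter> y)"
  define e where "e = d - k"
  have j: "j \<le> d" unfolding j_def by (rule dim_Int_X_le[OF x])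
  have "(\<Sum>z\<in>X. (if z \<in> nbs x then 1 else 0) * b_int k z y) = (\<Sum>z\<in>nbs x. gbinom Q (vec.dim (z \<inter> y)) e)"
    using k by (intro sum.mono_neutral_cong_right) (auto simp: b_int_def e_def nbs_def)
  also have "\<dots> = qint Q (d - j) * gbinom Q (Suc j) e + (Q - 1) * qint Q (d - j) * gbinom Q j e
      + Q * (qint Q d - qint Q (d - j)) * gbinom Q (j - 1) e"
    unfolding j_def by (rule sum_nbs[OF x y d])
  \<comment> \<open>The difference \<open>qint Q d - qint Q (d - j)\<close> is
    \<open>qint Q j * Q ^ (d - j)\<close>, and absorption between rows exchanges
    \<open>j - 1\<close> for \<open>j\<close> in the Gaussian coefficient. For \<open>j = 0\<close>
    both sides vanish.\<close>
  also have "Q * (qint Q d - qint Q (d - j)) * gbinom Q (j - 1) e = Q * Q ^ (d - j) * qint Q (j - e) * gbinom Q j e"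
  proof (cases j)
    case (Suc j')
    have "qint Q d - qint Q (d - j) = qint Q j * Q ^ (d - j)"
      using qint_add[of Q j "d - j"] j by simp
    then have "Q * (qint Q d - qint Q (d - j)) * gbinom Q (j - 1) e = Q * Q ^ (d - j) * (qint Q j * gbinom Q j' e)"
      using Suc by (simp add: algebra_simps)
    also have "qint Q j * gbinom Q j' e = qint Q (j - e) * gbinom Q j e"
      using qint_mult_gbinom'[of Q j' e] Suc by simp
    finally show ?thesis by (simp add: algebra_simps)
  qed simp
  finally have sum: "(\<Sum>z\<in>X. (if z \<in> nbs x then 1 else 0) * b_int k z y) =
      qint Q (d - j) * gbinom Q (Suc j) e + (Q - 1) * qint Q (d - j) * gbinom Q j e
      + Q * Q ^ (d - j) * qint Q (j - e) * gbinom Q j e" .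
  have bk: "b_int k x y = gbinom Q j e" using k by (simp add: b_int_def e_def j_def)
  have t: "t_eig Q d k = Q * qint Q (d - e) - qint Q e" using k by (simp add: t_eig_def e_def)
  show ?thesis
  proof (cases e)
    \<comment> \<open>Here \<open>b_int k\<close> is the all-one matrix on \<open>X\<close>, and the
      claim is that the graph is regular of valency \<open>Q * qint Q d\<close>.\<close>
    case 0
    then have "k = d" using k by (simp add: e_def)
    have "Q * qint Q d = Q * (qint Q j * Q ^ (d - j)) + Q * qint Q (d - j)"
      using qint_add[of Q j "d - j"] j by (simp add: algebra_simps)
    then show ?thesis unfolding sum bk t using 0 \<open>k = d\<close> by (simp add: b_int_def algebra_simps)
  next
    case (Suc e')
    have kd: "k < d" "Suc k = d - e'" using Suc k by (auto simp: e_def)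
    have bk1: "b_int (Suc k) x y = gbinom Q j e'" using kd Suc by (simp add: b_int_def j_def e_def)
    show ?thesis
    proof (cases "e' \<le> j")
      case False
      then show ?thesis unfolding sum bk bk1 using Suc by (simp add: gbinom_eq_0)
    next
      case True
      have r: "qint Q e * gbinom Q j e = qint Q (j - e') * gbinom Q j e'"
        using qint_mult_gbinom[of Q e' j] Suc by simp
      have a: "qint Q (Suc k) = qint Q (j - e') * Q ^ (d - j) + qint Q (d - j)"
        using qint_add[of Q "j - e'" "d - j"] True j kd by simp
      have pascal: "gbinom Q (Suc j) e = Q ^ e * gbinom Q j e + gbinom Q j e'" using Suc by simp
      \<comment> \<open>The total coefficients of \<open>gbinom Q j e\<close> on the two sides. They
        agree because \<open>qint Q (d - j + e)\<close> can be split in two ways; for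
        \<open>e > j\<close> the Gaussian coefficient is zero.\<close>
      have main: "(Q * Q ^ (d - j) * qint Q (j - e) + (Q - 1) * qint Q (d - j) + Q ^ e * qint Q (d - j)) * gbinom Q j e
         = (Q * qint Q (d - e) - qint Q e + Q ^ (d - j) * qint Q e) * gbinom Q j e"
      proof (cases "e \<le> j")
        case True
        have h1: "qint Q (d - e) = qint Q (j - e) * Q ^ (d - j) + qint Q (d - j)"
          using qint_add[of Q "j - e" "d - j"] True j by simp
        have h2: "qint Q (d - j + e) = qint Q (d - j) * Q ^ e + qint Q e"
          using qint_add[of Q "d - j" e] by simp
        have h3: "qint Q (d - j + e) = qint Q e * Q ^ (d - j) + qint Q (d - j)"
          using qint_add[of Q e "d - j"] by (simp add: add.commute)
        have "Q * Q ^ (d - j) * qint Q (j - e) + (Q - 1) * qint Q (d - j) + Q ^ e * qint Q (d - j)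
          = Q * qint Q (d - e) - qint Q e + Q ^ (d - j) * qint Q e"
          unfolding h1 using h2 h3 by (simp add: algebra_simps)
        then show ?thesis by simp
      qed (simp add: gbinom_eq_0)
      show ?thesis unfolding sum bk bk1 t a pascal using main r by (simp add: algebra_simps)
    qed
  qed
qed

lemma b_int_mult:
  assumes "d > 0" "k \<le> d" "l \<le> d" "x \<in> X" "y \<in> X"
  shows "(\<Sum>z\<in>X. b_int k x z * b_int l z y) = (\<Sum>m\<le>d. lin_coeff Q d k l m * b_int m x y)"
proof (rule three_term_linearization)
  show "b_int 0 x y = (if x = y then 1 else 0)" if "x \<in> X" "y \<in> X" for x y
    using that dim_Int_X_eq[OF that] dim_Int_X_le[OF that(1), of y]
    by (auto simp: b_int_def gbinom_eq_0 dim_X)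
  show "b_int (Suc d) x y = 0" for x y by (simp add: b_int_def)
qed (use assms Q_gt_1 b_int_rec in auto)

end

section \<open>Commutative algebras over a field\<close>

locale comm_algebra = cring A for A :: "('f::field, 'a) module" (structure) +
  assumes smult_closed [simp, intro]: "a \<in> carrier A \<Longrightarrow> c \<odot> a \<in> carrier A"
    and smult_l_distr: "a \<in> carrier A \<Longrightarrow> (c + c') \<odot> a = c \<odot> a \<oplus> c' \<odot> a"
    and smult_r_distr: "a \<in> carrier A \<Longrightarrow> b \<in> carrier A \<Longrightarrow> c \<odot> (a \<oplus> b) = c \<odot> a \<oplus> c \<odot> b"
    and smult_assoc1: "a \<in> carrier A \<Longrightarrow> (c * c') \<odot> a = c \<odot> (c' \<odot> a)"
    and smult_one [simp]: "a \<in> carrier A \<Longrightarrow> 1 \<odot> a = a"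
    and smult_assoc2: "a \<in> carrier A \<Longrightarrow> b \<in> carrier A \<Longrightarrow> (c \<odot> a) \<otimes> b = c \<odot> (a \<otimes> b)"
begin

lemma smult_0 [simp]: "a \<in> carrier A \<Longrightarrow> 0 \<odot> a = \<zero>"
  using smult_l_distr[of a 0 0] by (simp add: add.l_cancel_one)

lemma smult_zero [simp]: "c \<odot> \<zero> = \<zero>"
  using smult_assoc1[of \<zero> c 0] by simp

lemma smult_r: "a \<in> carrier A \<Longrightarrow> b \<in> carrier A \<Longrightarrow> a \<otimes> (c \<odot> b) = c \<odot> (a \<otimes> b)"
  by (metis m_comm smult_assoc2 smult_closed)

lemma smult_minus_one: "a \<in> carrier A \<Longrightarrow> (- 1) \<odot> a = \<ominus> a"
  using smult_l_distr[of a "- 1" 1] by (simp add: minus_equality)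

lemma ideal_smult:
  assumes "ideal I A" "i \<in> I"
  shows "c \<odot> i \<in> I"
proof -
  have i: "i \<in> carrier A" using assms by (rule ideal.Icarr)
  have "c \<odot> i = (c \<odot> \<one>) \<otimes> i" using i by (simp add: smult_assoc2)
  then show ?thesis using ideal.I_l_closed[OF assms, of "c \<odot> \<one>"] by simp
qed

end

definition alg_hom :: "('f::field, 'a) module \<Rightarrow> ('f, 'b) module \<Rightarrow> ('a \<Rightarrow> 'b) set" where
  "alg_hom A B = {h \<in> ring_hom A B. \<forall>c. \<forall>a \<in> carrier A. h (c \<odot>\<^bsub>A\<^esub> a) = c \<odot>\<^bsub>B\<^esub> h a}"

lemma alg_homD:
  assumes "h \<in> alg_hom A B"
  shows "h \<in> ring_hom A B" "a \<in> carrier A \<Longrightarrow> h a \<in> carrier B"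
    "a \<in> carrier A \<Longrightarrow> b \<in> carrier A \<Longrightarrow> h (a \<oplus>\<^bsub>A\<^esub> b) = h a \<oplus>\<^bsub>B\<^esub> h b"
    "a \<in> carrier A \<Longrightarrow> b \<in> carrier A \<Longrightarrow> h (a \<otimes>\<^bsub>A\<^esub> b) = h a \<otimes>\<^bsub>B\<^esub> h b"
    "h \<one>\<^bsub>A\<^esub> = \<one>\<^bsub>B\<^esub>" "a \<in> carrier A \<Longrightarrow> h (c \<odot>\<^bsub>A\<^esub> a) = c \<odot>\<^bsub>B\<^esub> h a"
  using assms by (auto simp: alg_hom_def ring_hom_def)

text \<open>\<open>quot_alg A I\<close> and \<open>A Quot I\<close> have different record types but
  the same operations; this carries the ring laws over.\<close>

lemma cring_cong:
  assumes "cring R" "carrier S = carrier R" "(\<otimes>\<^bsub>S\<^esub>) = (\<otimes>\<^bsub>R\<^esub>)" "\<one>\<^bsub>S\<^esub> = \<one>\<^bsub>R\<^esub>"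
    "\<zero>\<^bsub>S\<^esub> = \<zero>\<^bsub>R\<^esub>" "(\<oplus>\<^bsub>S\<^esub>) = (\<oplus>\<^bsub>R\<^esub>)"
  shows "cring S"
proof -
  interpret R: cring R by fact
  show ?thesis
  proof (rule cringI)
    show "abelian_group S"
    proof (rule abelian_groupI)
      show "\<exists>y\<in>carrier S. y \<oplus>\<^bsub>S\<^esub> x = \<zero>\<^bsub>S\<^esub>" if "x \<in> carrier S" for x
        using that assms by (intro bexI[of _ "\<ominus>\<^bsub>R\<^esub> x"]) (simp_all add: R.l_neg)
    qed (simp_all add: assms R.a_ac)
    show "Group.comm_monoid S"
      by (rule comm_monoidI) (simp_all add: assms R.m_ac)
  qed (simp add: assms R.l_distr)
qed

text \<open>The kernel of \<open>h\<close> is an ideal, so vanishing need only be tested on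
  generators.\<close>

lemma genideal_in_kernel:
  assumes "comm_algebra A" "comm_algebra C" "h \<in> alg_hom A C" "S \<subseteq> carrier A"
    and "\<And>s. s \<in> S \<Longrightarrow> h s = \<zero>\<^bsub>C\<^esub>"
    and "a \<in> genideal A S"
  shows "h a = \<zero>\<^bsub>C\<^esub>"
proof -
  interpret A: comm_algebra A by fact
  interpret C: comm_algebra C by fact
  interpret h: ring_hom_ring A C h
    by (rule ring_hom_ringI2[OF A.ring_axioms C.ring_axioms alg_homD(1)[OF assms(3)]])
  have "S \<subseteq> a_kernel A C h"
  proof
    fix s assume "s \<in> S"
    then show "s \<in> a_kernel A C h" using assms(4) assms(5)[of s] unfolding a_kernel_def' by blast
  qed
  then have "genideal A S \<subseteq> a_kernel A C h" by (intro A.genideal_minimal h.kernel_is_ideal)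
  then show ?thesis using assms(6) unfolding a_kernel_def' by blast
qed

context
  fixes A :: "('f::field, 'a) module" and I :: "'a set"
  assumes A: "comm_algebra A" and I: "ideal I A"
begin

interpretation A: comm_algebra A by (rule A)
interpretation I: ideal I A by (rule I)

text \<open>The union in \<open>quot_alg\<close> runs over all representatives; as an ideal is
  stable under scalars, the cosets united there coincide.\<close>

lemma coset_smult:
  assumes a: "a \<in> carrier A"
  shows "c \<odot>\<^bsub>quot_alg A I\<^esub> (I +>\<^bsub>A\<^esub> a) = I +>\<^bsub>A\<^esub> (c \<odot>\<^bsub>A\<^esub> a)"
proof -
  have eq: "I +>\<^bsub>A\<^esub> (c \<odot>\<^bsub>A\<^esub> x) = I +>\<^bsub>A\<^esub> (c \<odot>\<^bsub>A\<^esub> a)" if x: "x \<in> I +>\<^bsub>A\<^esub> a" for x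
  proof -
    obtain i where i: "i \<in> I" "x = i \<oplus>\<^bsub>A\<^esub> a" using x by (auto simp: a_r_coset_def')
    have ci: "c \<odot>\<^bsub>A\<^esub> i \<in> I" by (rule A.ideal_smult[OF I i(1)])
    have "c \<odot>\<^bsub>A\<^esub> x = c \<odot>\<^bsub>A\<^esub> i \<oplus>\<^bsub>A\<^esub> c \<odot>\<^bsub>A\<^esub> a"
      using i a by (simp add: A.smult_r_distr I.Icarr)
    then have "c \<odot>\<^bsub>A\<^esub> x \<in> I +>\<^bsub>A\<^esub> (c \<odot>\<^bsub>A\<^esub> a)" using ci by (auto simp: a_r_coset_def')
    then show ?thesis using a by (metis A.smult_closed I.a_repr_independence')
  qed
  have "a \<in> I +>\<^bsub>A\<^esub> a" using a by (simp add: I.a_rcos_self)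
  then have "(\<Union>x\<in>I +>\<^bsub>A\<^esub> a. I +>\<^bsub>A\<^esub> (c \<odot>\<^bsub>A\<^esub> x)) = I +>\<^bsub>A\<^esub> (c \<odot>\<^bsub>A\<^esub> a)"
    by (rule UN_constant_eq) (intro ballI eq)
  then show ?thesis unfolding quot_alg_def by simp
qed

lemma quot_alg_simps:
  "carrier (quot_alg A I) = (\<lambda>a. I +>\<^bsub>A\<^esub> a) ` carrier A"
  "\<one>\<^bsub>quot_alg A I\<^esub> = I +>\<^bsub>A\<^esub> \<one>\<^bsub>A\<^esub>"
  "\<zero>\<^bsub>quot_alg A I\<^esub> = I"
  "a \<in> carrier A \<Longrightarrow> b \<in> carrier A \<Longrightarrow> (I +>\<^bsub>A\<^esub> a) \<oplus>\<^bsub>quot_alg A I\<^esub> (I +>\<^bsub>A\<^esub> b) = I +>\<^bsub>A\<^esub> (a \<oplus>\<^bsub>A\<^esub> b)"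
  "a \<in> carrier A \<Longrightarrow> b \<in> carrier A \<Longrightarrow> (I +>\<^bsub>A\<^esub> a) \<otimes>\<^bsub>quot_alg A I\<^esub> (I +>\<^bsub>A\<^esub> b) = I +>\<^bsub>A\<^esub> (a \<otimes>\<^bsub>A\<^esub> b)"
  by (auto simp: quot_alg_def FactRing_def A_RCOSETS_def' I.a_rcos_sum I.rcoset_mult_add)

lemma comm_algebra_quot: "comm_algebra (quot_alg A I)"
proof -
  have "cring (A Quot I)" by (rule I.quotient_is_cring[OF A.cring_axioms])
  then interpret Q: cring "quot_alg A I"
    by (rule cring_cong) (simp_all add: quot_alg_def)
  show ?thesis
    by unfold_locales
      (auto simp: quot_alg_simps(1) coset_smult quot_alg_simps(4,5)
        A.smult_l_distr A.smult_r_distr A.smult_assoc1 A.smult_assoc2)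
qed

lemma proj_hom: "(\<lambda>a. I +>\<^bsub>A\<^esub> a) \<in> alg_hom A (quot_alg A I)"
  by (auto simp: alg_hom_def ring_hom_def quot_alg_simps coset_smult)

lemma coset_eq_zero: "a \<in> carrier A \<Longrightarrow> I +>\<^bsub>A\<^esub> a = I \<longleftrightarrow> a \<in> I"
  using I.a_rcos_self[of a] I.a_rcos_const[of a] by auto

lemma quot_hom:
  assumes C: "comm_algebra C" and h: "h \<in> alg_hom A C" and ker: "\<And>i. i \<in> I \<Longrightarrow> h i = \<zero>\<^bsub>C\<^esub>"
  shows "\<exists>k \<in> alg_hom (quot_alg A I) C. \<forall>a \<in> carrier A. k (I +>\<^bsub>A\<^esub> a) = h a"
proof -
  interpret C: comm_algebra C by (rule C)
  \<comment> \<open>A homomorphism that vanishes on \<open>I\<close> is constant on each coset;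
    \<open>k\<close> picks this single value.\<close>
  define k where "k Y = the_elem (h ` Y)" for Y
  have k: "k (I +>\<^bsub>A\<^esub> a) = h a" if a: "a \<in> carrier A" for a
  proof -
    have eq: "h x = h a" if x: "x \<in> I +>\<^bsub>A\<^esub> a" for x
    proof -
      obtain i where i: "i \<in> I" "x = i \<oplus>\<^bsub>A\<^esub> a" using x by (auto simp: a_r_coset_def')
      then show ?thesis using a alg_homD(2,3)[OF h] ker[OF i(1)] by (simp add: I.Icarr)
    qed
    have "a \<in> I +>\<^bsub>A\<^esub> a" using a by (simp add: I.a_rcos_self)
    then have "I +>\<^bsub>A\<^esub> a \<noteq> {}" by blast
    then show ?thesis unfolding k_def using eq by (rule the_elem_image_unique)
  qed
  have "k \<in> ring_hom (quot_alg A I) C"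
    by (rule ring_hom_memI)
      (auto simp: quot_alg_simps k alg_homD[OF h])
  moreover have "k (c \<odot>\<^bsub>quot_alg A I\<^esub> a) = c \<odot>\<^bsub>C\<^esub> k a" if "a \<in> carrier (quot_alg A I)" for c a
    using that by (auto simp: quot_alg_simps coset_smult k alg_homD(6)[OF h])
  ultimately have "k \<in> alg_hom (quot_alg A I) C"
    by (simp add: alg_hom_def)
  with k show ?thesis by blast
qed

text \<open>The first isomorphism theorem, directed from \<open>C\<close> to the quotient: the
  induced bijection is inverted, and its inverse inherits compatibility with scalars.\<close>

lemma alg_isomorphic_quot:
  assumes C: "comm_algebra C" and h: "h \<in> alg_hom A C" and surj: "h ` carrier A = carrier C"
    and ker: "\<And>a. a \<in> carrier A \<Longrightarrow> h a = \<zero>\<^bsub>C\<^esub> \<longleftrightarrow> a \<in> I"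
  shows "alg_isomorphic C (quot_alg A I)"
proof -
  interpret C: comm_algebra C by (rule C)
  interpret Q: comm_algebra "quot_alg A I" by (rule comm_algebra_quot)
  obtain k where k: "k \<in> alg_hom (quot_alg A I) C" "\<And>a. a \<in> carrier A \<Longrightarrow> k (I +>\<^bsub>A\<^esub> a) = h a"
    using quot_hom[OF C h] ker I.Icarr by metis
  have "inj_on k (carrier (quot_alg A I))"
  proof (rule inj_onI)
    fix x y assume xy: "x \<in> carrier (quot_alg A I)" "y \<in> carrier (quot_alg A I)" "k x = k y"
    obtain a b where ab: "a \<in> carrier A" "b \<in> carrier A" "x = I +>\<^bsub>A\<^esub> a" "y = I +>\<^bsub>A\<^esub> b"
      using xy by (auto simp: quot_alg_simps)
    have hab: "h a = h b" using k(2) ab xy by simp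
    have "h (a \<oplus>\<^bsub>A\<^esub> (- 1) \<odot>\<^bsub>A\<^esub> b) = h a \<oplus>\<^bsub>C\<^esub> (- 1) \<odot>\<^bsub>C\<^esub> h b"
      using ab alg_homD[OF h] by simp
    also have "\<dots> = \<zero>\<^bsub>C\<^esub>"
      using ab alg_homD(2)[OF h] by (simp add: hab C.smult_minus_one C.r_neg)
    finally have "a \<oplus>\<^bsub>A\<^esub> (- 1) \<odot>\<^bsub>A\<^esub> b \<in> I" using ker ab by simp
    then have "a \<ominus>\<^bsub>A\<^esub> b \<in> I" using ab by (simp add: A.smult_minus_one a_minus_def)
    then show "x = y" using ab A.quotient_eq_iff_same_a_r_cos[OF I] by simp
  qed
  moreover have "k ` carrier (quot_alg A I) = carrier C"
    using surj k(2) by (simp add: quot_alg_simps image_image)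
  ultimately have iso: "k \<in> ring_iso (quot_alg A I) C"
    using alg_homD(1)[OF k(1)] by (simp add: ring_iso_def bij_betw_def)
  let ?g = "inv_into (carrier (quot_alg A I)) k"
  have g: "?g \<in> ring_iso C (quot_alg A I)"
    using ring_iso_set_sym[OF Q.ring_axioms iso] .
  have "?g (c \<odot>\<^bsub>C\<^esub> y) = c \<odot>\<^bsub>quot_alg A I\<^esub> ?g y" if y: "y \<in> carrier C" for c y
  proof -
    have gy: "?g y \<in> carrier (quot_alg A I)" "k (?g y) = y"
      using y iso by (auto simp: ring_iso_def bij_betw_def inv_into_into f_inv_into_f)
    have "k (c \<odot>\<^bsub>quot_alg A I\<^esub> ?g y) = c \<odot>\<^bsub>C\<^esub> y" using alg_homD(6)[OF k(1) gy(1)] gy(2) by simp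
    then show ?thesis
      using gy iso by (intro inv_into_f_eq) (auto simp: ring_iso_def bij_betw_def)
  qed
  with g show ?thesis unfolding alg_isomorphic_def by blast
qed

end

section \<open>Maximal ideals and nonunits\<close>

lemma (in cring) ex_maximalideal:
  assumes a: "a \<in> carrier R" "a \<notin> Units R"
  shows "\<exists>M. maximalideal M R \<and> a \<in> M"
proof -
  define \<I> where "\<I> = {J. ideal J R \<and> a \<in> J \<and> \<one> \<notin> J}"
  have "\<one> \<notin> PIdl a"
  proof
    assume "\<one> \<in> PIdl a"
    then obtain x where "x \<in> carrier R" "\<one> = x \<otimes> a" by (auto simp: cgenideal_def)
    then have "a \<in> Units R" using a(1) m_comm[of x a] by (auto simp: Units_def)
    then show False using a(2) by simp
  qed
  then have ne: "PIdl a \<in> \<I>" using a by (simp add: \<I>_def cgenideal_ideal cgenideal_self)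
  \<comment> \<open>Zorn's lemma for the ideals that contain \<open>a\<close> but not the unit.
    Nonempty chains are bounded by their union, the empty chain by the principal ideal of
    \<open>a\<close>.\<close>
  have "\<exists>M\<in>\<I>. \<forall>J\<in>\<I>. M \<subseteq> J \<longrightarrow> J = M"
  proof (rule subset_Zorn)
    fix C assume C: "subset.chain \<I> C"
    show "\<exists>U\<in>\<I>. \<forall>J\<in>C. J \<subseteq> U"
    proof (cases "C = {}")
      case True
      then show ?thesis using ne by auto
    next
      case False
      have "subset.chain {J. ideal J R} C" using C by (auto simp: pred_on.chain_def \<I>_def)
      then have "ideal (\<Union>C) R" using chain_Union_is_ideal[of C] False by simp
      moreover have "C \<subseteq> \<I>" using C by (simp add: pred_on.chain_def)
      then have "a \<in> \<Union>C" "\<one> \<notin> \<Union>C"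
        using False by (auto simp: \<I>_def)
      ultimately have "\<Union>C \<in> \<I>" by (simp add: \<I>_def)
      then show ?thesis by blast
    qed
  qed
  then obtain M where M: "ideal M R" "a \<in> M" "\<one> \<notin> M" and
    max: "\<And>J. ideal J R \<Longrightarrow> a \<in> J \<Longrightarrow> \<one> \<notin> J \<Longrightarrow> M \<subseteq> J \<Longrightarrow> J = M"
    by (auto simp: \<I>_def)
  have "maximalideal M R"
  proof (rule maximalidealI[OF M(1)])
    show "carrier R \<noteq> M" using M(3) by auto
    fix J assume J: "ideal J R" "M \<subseteq> J" "J \<subseteq> carrier R"
    show "J = M \<or> J = carrier R"
    proof (cases "\<one> \<in> J")
      case True
      then show ?thesis using ideal.one_imp_carrier[OF J(1)] by simp
    next
      case False
      then show ?thesis using max J M(2) by blast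
    qed
  qed
  with M(2) show ?thesis by blast
qed

text \<open>Each nonunit lies in a maximal ideal, hence both in the only one, which is closed under
  linear combinations and contains no unit.\<close>

lemma local_algebra_nonunits:
  assumes A: "comm_algebra A" and loc: "local_algebra A"
    and a: "a \<in> carrier A" "a \<notin> Units A" and b: "b \<in> carrier A" "b \<notin> Units A"
  shows "a \<oplus>\<^bsub>A\<^esub> c \<odot>\<^bsub>A\<^esub> b \<notin> Units A"
proof
  interpret A: comm_algebra A by (rule A)
  assume u: "a \<oplus>\<^bsub>A\<^esub> c \<odot>\<^bsub>A\<^esub> b \<in> Units A" (is "?s \<in> _")
  obtain M N where MN: "maximalideal M A" "a \<in> M" "maximalideal N A" "b \<in> N"
    using A.ex_maximalideal a b by metis
  then have "N = M" using loc by (auto simp: local_algebra_def)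
  interpret M: maximalideal M A by fact
  have "?s \<in> M"
    using MN \<open>N = M\<close> by (intro M.a_closed A.ideal_smult) (auto intro: M.is_ideal)
  then have "inv\<^bsub>A\<^esub> ?s \<otimes>\<^bsub>A\<^esub> ?s \<in> M" using u by (intro M.I_l_closed) auto
  then have "\<one>\<^bsub>A\<^esub> \<in> M" using u by simp
  then show False using M.one_imp_carrier M.I_notcarr by simp
qed

section \<open>Monoid algebras\<close>

lemma poly_mapping_sum_single:
  "(\<Sum>s\<in>Poly_Mapping.keys u. Poly_Mapping.single s (Poly_Mapping.lookup u s)) = u"
proof (rule poly_mapping_eqI)
  fix k
  have "Poly_Mapping.lookup (\<Sum>s\<in>Poly_Mapping.keys u. Poly_Mapping.single s (Poly_Mapping.lookup u s)) k
     = (\<Sum>s\<in>Poly_Mapping.keys u. if s = k then Poly_Mapping.lookup u s else 0)"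
    unfolding lookup_sum by (intro sum.cong) (auto simp: lookup_single when_def)
  also have "\<dots> = Poly_Mapping.lookup u k" by (simp add: in_keys_iff)
  finally show "Poly_Mapping.lookup (\<Sum>s\<in>Poly_Mapping.keys u. Poly_Mapping.single s (Poly_Mapping.lookup u s)) k
     = Poly_Mapping.lookup u k" .
qed

text \<open>The support condition is carried along because the laws of a monoid hold on its carrier
  only.\<close>

lemma poly_mapping_single_induct [consumes 1, case_names zero single add]:
  fixes u :: "'m \<Rightarrow>\<^sub>0 'f::field"
  assumes "Poly_Mapping.keys u \<subseteq> S" and "P 0" and "\<And>s c. s \<in> S \<Longrightarrow> P (Poly_Mapping.single s c)"
    and add: "\<And>u v. Poly_Mapping.keys u \<subseteq> S \<Longrightarrow> Poly_Mapping.keys v \<subseteq> S \<Longrightarrow> P u \<Longrightarrow> P v \<Longrightarrow> P (u + v)"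
  shows "P u"
proof -
  have "P (\<Sum>s\<in>K. Poly_Mapping.single s (Poly_Mapping.lookup u s)) \<and>
      Poly_Mapping.keys (\<Sum>s\<in>K. Poly_Mapping.single s (Poly_Mapping.lookup u s)) \<subseteq> S"
    if "finite K" "K \<subseteq> S" for K
    using that
  proof (induction K rule: finite_induct)
    case (insert s K)
    have "Poly_Mapping.keys (Poly_Mapping.single s (Poly_Mapping.lookup u s)) \<subseteq> S" using insert by simp
    moreover have "P (Poly_Mapping.single s (Poly_Mapping.lookup u s))" using insert assms(3) by simp
    ultimately show ?case using insert add
      by (simp add: order_trans[OF Poly_Mapping.keys_add])
  qed (simp add: assms(2))
  from this[OF finite_keys assms(1)] show ?thesis by (simp add: poly_mapping_sum_single)
qed

lemma lookup_map_times: "Poly_Mapping.lookup (Poly_Mapping.map ((*) (c :: 'f::field)) u) s = c * Poly_Mapping.lookup u s"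
  by (simp add: Poly_Mapping.map.rep_eq when_def)

lemma map_times_add: "Poly_Mapping.map ((*) (c :: 'f::field)) (u + v)
    = Poly_Mapping.map ((*) c) u + Poly_Mapping.map ((*) c) v"
  by (rule poly_mapping_eqI) (simp add: lookup_map_times lookup_add algebra_simps)

lemma map_times_zero [simp]: "Poly_Mapping.map ((*) (c :: 'f::field)) 0 = 0"
  by (simp add: map_eq_zero_iff)

lemma keys_map_times: "Poly_Mapping.keys (Poly_Mapping.map ((*) (c :: 'f::field)) u) \<subseteq> Poly_Mapping.keys u"
  by (auto simp: in_keys_iff lookup_map_times)

text \<open>The linear extension of \<open>\<mu>\<close> from a monoid to its algebra. It provides
  the maps out of the tensor product as well as those out of the polynomial algebra.\<close>

definition mext :: "('f::field, 'c) module \<Rightarrow> ('m \<Rightarrow> 'c) \<Rightarrow> ('m \<Rightarrow>\<^sub>0 'f) \<Rightarrow> 'c" where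
  "mext C \<mu> u = (\<Oplus>\<^bsub>C\<^esub>s\<in>Poly_Mapping.keys u. Poly_Mapping.lookup u s \<odot>\<^bsub>C\<^esub> \<mu> s)"

context
  fixes M :: "('m, 'z) monoid_scheme"
  assumes M: "Group.comm_monoid M"
begin

interpretation M: Group.comm_monoid M by (rule M)

abbreviation (input) MA :: "('f::field, 'm \<Rightarrow>\<^sub>0 'f) module" where "MA \<equiv> monoid_alg M"

lemma monoid_alg_simps:
  "carrier (MA :: ('f::field, _) module) = {u. Poly_Mapping.keys u \<subseteq> carrier M}"
  "\<one>\<^bsub>MA\<^esub> = Poly_Mapping.single \<one>\<^bsub>M\<^esub> (1 :: 'f)"
  "\<zero>\<^bsub>(MA :: ('f::field, _) module)\<^esub> = 0"
  "(\<oplus>\<^bsub>(MA :: ('f::field, _) module)\<^esub>) = (+)"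
  "c \<odot>\<^bsub>(MA :: ('f::field, _) module)\<^esub> u = Poly_Mapping.map ((*) c) u"
  by (simp_all add: monoid_alg_def)

lemma monoid_alg_mult_add_left: "(u + u') \<otimes>\<^bsub>(MA :: ('f::field, _) module)\<^esub> v = u \<otimes>\<^bsub>MA\<^esub> v + u' \<otimes>\<^bsub>MA\<^esub> v"
proof -
  let ?f = "\<lambda>s (a :: 'f). \<Sum>t\<in>Poly_Mapping.keys v. Poly_Mapping.single (s \<otimes>\<^bsub>M\<^esub> t) (a * Poly_Mapping.lookup v t)"
  have "(\<Sum>s\<in>Poly_Mapping.keys (u + u'). ?f s (Poly_Mapping.lookup (u + u') s)) =
    (\<Sum>s\<in>Poly_Mapping.keys u. ?f s (Poly_Mapping.lookup u s)) +
    (\<Sum>s\<in>Poly_Mapping.keys u'. ?f s (Poly_Mapping.lookup u' s))"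
    by (rule setsum_keys_plus_distrib) (simp_all add: algebra_simps single_add sum.distrib)
  then show ?thesis by (simp add: monoid_alg_def)
qed

lemma monoid_alg_mult_add_right: "v \<otimes>\<^bsub>(MA :: ('f::field, _) module)\<^esub> (u + u') = v \<otimes>\<^bsub>MA\<^esub> u + v \<otimes>\<^bsub>MA\<^esub> u'"
proof -
  let ?f = "\<lambda>s t (a :: 'f). Poly_Mapping.single (s \<otimes>\<^bsub>M\<^esub> t) (Poly_Mapping.lookup v s * a)"
  have "(\<Sum>t\<in>Poly_Mapping.keys (u + u'). ?f s t (Poly_Mapping.lookup (u + u') t)) =
    (\<Sum>t\<in>Poly_Mapping.keys u. ?f s t (Poly_Mapping.lookup u t)) +
    (\<Sum>t\<in>Poly_Mapping.keys u'. ?f s t (Poly_Mapping.lookup u' t))" for s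
    by (rule setsum_keys_plus_distrib) (simp_all add: algebra_simps single_add)
  then show ?thesis by (simp add: monoid_alg_def sum.distrib)
qed

lemma monoid_alg_mult_single:
  "Poly_Mapping.single s a \<otimes>\<^bsub>(MA :: ('f::field, _) module)\<^esub> Poly_Mapping.single t b
    = Poly_Mapping.single (s \<otimes>\<^bsub>M\<^esub> t) (a * b)"
  by (simp add: monoid_alg_def)

lemma monoid_alg_mult_zero [simp]:
  "0 \<otimes>\<^bsub>(MA :: ('f::field, _) module)\<^esub> v = 0" "v \<otimes>\<^bsub>(MA :: ('f::field, _) module)\<^esub> 0 = 0"
  by (simp_all add: monoid_alg_def)

lemmas monoid_alg_mult = monoid_alg_mult_add_left monoid_alg_mult_add_right monoid_alg_mult_single

lemma monoid_alg_mult_closed: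
  assumes "Poly_Mapping.keys u \<subseteq> carrier M" "Poly_Mapping.keys v \<subseteq> carrier M"
  shows "Poly_Mapping.keys (u \<otimes>\<^bsub>(MA :: ('f::field, _) module)\<^esub> v) \<subseteq> carrier M"
proof -
  have "Poly_Mapping.keys (u \<otimes>\<^bsub>(MA :: ('f::field, _) module)\<^esub> v) \<subseteq>
     (\<Union>s\<in>Poly_Mapping.keys u. \<Union>t\<in>Poly_Mapping.keys v. {s \<otimes>\<^bsub>M\<^esub> t})"
    unfolding monoid_alg_def
    by (simp, rule order_trans[OF Poly_Mapping.keys_sum], rule UN_mono[OF order.refl],
        rule order_trans[OF Poly_Mapping.keys_sum], rule UN_mono[OF order.refl]) auto
  then show ?thesis using assms by blast
qed

lemma monoid_alg_assoc:
  assumes "Poly_Mapping.keys u \<subseteq> carrier M" "Poly_Mapping.keys v \<subseteq> carrier M" "Poly_Mapping.keys w \<subseteq> carrier M"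
  shows "(u \<otimes>\<^bsub>(MA :: ('f::field, _) module)\<^esub> v) \<otimes>\<^bsub>MA\<^esub> w = u \<otimes>\<^bsub>MA\<^esub> (v \<otimes>\<^bsub>MA\<^esub> w)"
  using assms(1)
proof (induction rule: poly_mapping_single_induct)
  case (single s a)
  note s = this
  show ?case using assms(2)
  proof (induction rule: poly_mapping_single_induct)
    case (single t b)
    note t = this
    show ?case using assms(3)
      by (induction rule: poly_mapping_single_induct)
        (use s t in \<open>simp_all add: monoid_alg_mult M.m_assoc mult.assoc\<close>)
  qed (simp_all add: monoid_alg_mult)
qed (simp_all add: monoid_alg_mult)

lemma monoid_alg_comm:
  assumes "Poly_Mapping.keys u \<subseteq> carrier M" "Poly_Mapping.keys v \<subseteq> carrier M"
  shows "u \<otimes>\<^bsub>(MA :: ('f::field, _) module)\<^esub> v = v \<otimes>\<^bsub>MA\<^esub> u"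
  using assms(1)
proof (induction rule: poly_mapping_single_induct)
  case (single s a)
  note s = this
  show ?case using assms(2)
    by (induction rule: poly_mapping_single_induct)
      (use s in \<open>simp_all add: monoid_alg_mult M.m_comm mult.commute\<close>)
qed (simp_all add: monoid_alg_mult)

lemma monoid_alg_one:
  assumes "Poly_Mapping.keys u \<subseteq> carrier M"
  shows "Poly_Mapping.single \<one>\<^bsub>M\<^esub> 1 \<otimes>\<^bsub>(MA :: ('f::field, _) module)\<^esub> u = u"
  using assms
  by (induction rule: poly_mapping_single_induct) (simp_all add: monoid_alg_mult)

lemma monoid_alg_smult_mult:
  assumes "Poly_Mapping.keys u \<subseteq> carrier M" "Poly_Mapping.keys v \<subseteq> carrier M"
  shows "Poly_Mapping.map ((*) c) u \<otimes>\<^bsub>(MA :: ('f::field, _) module)\<^esub> v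
    = Poly_Mapping.map ((*) c) (u \<otimes>\<^bsub>MA\<^esub> v)"
  using assms(1)
proof (induction rule: poly_mapping_single_induct)
  case (single s a)
  show ?case using assms(2)
    by (induction rule: poly_mapping_single_induct)
      (simp_all add: monoid_alg_mult map_times_add map_eq_zero_iff mult.assoc)
qed (simp_all add: monoid_alg_mult map_times_add map_eq_zero_iff)

lemma comm_algebra_monoid_alg: "comm_algebra (monoid_alg M :: ('f::field, 'm \<Rightarrow>\<^sub>0 'f) module)"
proof -
  let ?A = "monoid_alg M :: ('f, 'm \<Rightarrow>\<^sub>0 'f) module"
  have add: "Poly_Mapping.keys (u + v) \<subseteq> carrier M"
    if "Poly_Mapping.keys u \<subseteq> carrier M" "Poly_Mapping.keys v \<subseteq> carrier M" for u v :: "'m \<Rightarrow>\<^sub>0 'f"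
    using that Poly_Mapping.keys_add[of u v] by blast
  interpret cring ?A
  proof (rule cringI)
    show "abelian_group ?A"
    proof (rule abelian_groupI)
      show "\<exists>y\<in>carrier ?A. y \<oplus>\<^bsub>?A\<^esub> x = \<zero>\<^bsub>?A\<^esub>" if "x \<in> carrier ?A" for x
        using that by (intro bexI[of _ "- x"]) (simp_all add: monoid_alg_simps)
    qed (simp_all add: monoid_alg_simps add algebra_simps)
    show "Group.comm_monoid ?A"
    proof (rule comm_monoidI)
      show "x \<otimes>\<^bsub>?A\<^esub> y = y \<otimes>\<^bsub>?A\<^esub> x" if "x \<in> carrier ?A" "y \<in> carrier ?A" for x y
        using that by (simp add: monoid_alg_simps monoid_alg_comm)
    qed (simp_all add: monoid_alg_simps monoid_alg_mult_closed monoid_alg_assoc monoid_alg_one)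
  qed (simp add: monoid_alg_simps monoid_alg_mult_add_left)
  show ?thesis
  proof
    show "c \<odot>\<^bsub>?A\<^esub> a \<in> carrier ?A" if "a \<in> carrier ?A" for a c
      using that keys_map_times[of c a] by (auto simp: monoid_alg_simps)
    show "(c \<odot>\<^bsub>?A\<^esub> a) \<otimes>\<^bsub>?A\<^esub> b = c \<odot>\<^bsub>?A\<^esub> (a \<otimes>\<^bsub>?A\<^esub> b)" if "a \<in> carrier ?A" "b \<in> carrier ?A" for a b c
      using that by (simp add: monoid_alg_simps monoid_alg_smult_mult)
  qed (simp_all add: monoid_alg_simps poly_mapping_eq_iff fun_eq_iff lookup_map_times lookup_add algebra_simps)
qed

section \<open>Homomorphisms out of a monoid algebra\<close>

context
  fixes C :: "('f::field, 'c) module" and \<mu> :: "'m \<Rightarrow> 'c"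
  assumes C: "comm_algebra C"
    and \<mu>_closed: "\<And>s. s \<in> carrier M \<Longrightarrow> \<mu> s \<in> carrier C"
    and \<mu>_mult: "\<And>s t. s \<in> carrier M \<Longrightarrow> t \<in> carrier M \<Longrightarrow> \<mu> (s \<otimes>\<^bsub>M\<^esub> t) = \<mu> s \<otimes>\<^bsub>C\<^esub> \<mu> t"
    and \<mu>_one: "\<mu> \<one>\<^bsub>M\<^esub> = \<one>\<^bsub>C\<^esub>"
begin

interpretation C: comm_algebra C by (rule C)

lemma mext_superset:
  assumes "finite S" "Poly_Mapping.keys u \<subseteq> S" "S \<subseteq> carrier M"
  shows "mext C \<mu> u = (\<Oplus>\<^bsub>C\<^esub>s\<in>S. Poly_Mapping.lookup u s \<odot>\<^bsub>C\<^esub> \<mu> s)"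
  unfolding mext_def
  by (rule C.add.finprod_mono_neutral_cong_left)
    (use assms \<mu>_closed in \<open>auto simp: in_keys_iff\<close>)

lemma mext_closed: "Poly_Mapping.keys u \<subseteq> carrier M \<Longrightarrow> mext C \<mu> u \<in> carrier C"
  unfolding mext_def by (intro C.finsum_closed) (auto simp: \<mu>_closed)

lemma mext_add:
  assumes "Poly_Mapping.keys u \<subseteq> carrier M" "Poly_Mapping.keys v \<subseteq> carrier M"
  shows "mext C \<mu> (u + v) = mext C \<mu> u \<oplus>\<^bsub>C\<^esub> mext C \<mu> v"
proof -
  let ?S = "Poly_Mapping.keys u \<union> Poly_Mapping.keys v"
  have S: "finite ?S" "?S \<subseteq> carrier M" using assms by auto
  have "mext C \<mu> (u + v) = (\<Oplus>\<^bsub>C\<^esub>s\<in>?S. Poly_Mapping.lookup (u + v) s \<odot>\<^bsub>C\<^esub> \<mu> s)"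
    using S by (intro mext_superset Poly_Mapping.keys_add)
  also have "\<dots> = (\<Oplus>\<^bsub>C\<^esub>s\<in>?S. Poly_Mapping.lookup u s \<odot>\<^bsub>C\<^esub> \<mu> s \<oplus>\<^bsub>C\<^esub> Poly_Mapping.lookup v s \<odot>\<^bsub>C\<^esub> \<mu> s)"
    by (intro C.finsum_cong') (use S \<mu>_closed in \<open>auto simp: lookup_add C.smult_l_distr\<close>)
  also have "\<dots> = (\<Oplus>\<^bsub>C\<^esub>s\<in>?S. Poly_Mapping.lookup u s \<odot>\<^bsub>C\<^esub> \<mu> s) \<oplus>\<^bsub>C\<^esub> (\<Oplus>\<^bsub>C\<^esub>s\<in>?S. Poly_Mapping.lookup v s \<odot>\<^bsub>C\<^esub> \<mu> s)"
    by (intro C.finsum_addf) (use S \<mu>_closed in auto)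
  also have "\<dots> = mext C \<mu> u \<oplus>\<^bsub>C\<^esub> mext C \<mu> v"
    using S by (simp add: mext_superset[symmetric])
  finally show ?thesis .
qed

lemma mext_zero [simp]: "mext C \<mu> 0 = \<zero>\<^bsub>C\<^esub>"
  by (simp add: mext_def)

lemma mext_single: "s \<in> carrier M \<Longrightarrow> mext C \<mu> (Poly_Mapping.single s c) = c \<odot>\<^bsub>C\<^esub> \<mu> s"
  by (subst mext_superset[of "{s}"]) (auto simp: \<mu>_closed)

lemma mext_smult:
  assumes "Poly_Mapping.keys u \<subseteq> carrier M"
  shows "mext C \<mu> (Poly_Mapping.map ((*) c) u) = c \<odot>\<^bsub>C\<^esub> mext C \<mu> u"
  using assms
proof (induction rule: poly_mapping_single_induct)
  case zero
  show ?case by simp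
next
  case (single s a)
  then show ?case by (simp add: mext_single C.smult_assoc1 \<mu>_closed)
next
  case (add u v)
  have "Poly_Mapping.keys (Poly_Mapping.map ((*) c) u) \<subseteq> carrier M" "Poly_Mapping.keys (Poly_Mapping.map ((*) c) v) \<subseteq> carrier M"
    by (rule order_trans[OF keys_map_times add.hyps(1)], rule order_trans[OF keys_map_times add.hyps(2)])
  with add show ?case by (simp add: map_times_add mext_add C.smult_r_distr mext_closed)
qed

lemma mext_mult:
  assumes "Poly_Mapping.keys u \<subseteq> carrier M" "Poly_Mapping.keys v \<subseteq> carrier M"
  shows "mext C \<mu> (u \<otimes>\<^bsub>monoid_alg M\<^esub> v) = mext C \<mu> u \<otimes>\<^bsub>C\<^esub> mext C \<mu> v"
  using assms(1)
proof (induction rule: poly_mapping_single_induct)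
  case (single s a)
  note s = this
  show ?case using assms(2)
  proof (induction rule: poly_mapping_single_induct)
    case (single t b)
    then show ?case
      using s by (simp add: monoid_alg_mult mext_single \<mu>_mult \<mu>_closed C.smult_assoc2 C.smult_r
          flip: C.smult_assoc1) (simp add: mult.commute)
  next
    case (add v w)
    then show ?case using s
      by (simp add: monoid_alg_mult mext_add mext_single \<mu>_closed C.r_distr mext_closed monoid_alg_mult_closed)
  qed (use s in \<open>simp_all add: mext_single \<mu>_closed\<close>)
next
  case (add u w)
  then show ?case using assms(2)
    by (simp add: monoid_alg_mult mext_add C.l_distr mext_closed monoid_alg_mult_closed)
qed (use assms(2) in \<open>simp_all add: mext_closed\<close>)

lemma mext_hom: "mext C \<mu> \<in> alg_hom (monoid_alg M) C"
proof -
  have "mext C \<mu> \<in> ring_hom (monoid_alg M) C"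
    by (rule ring_hom_memI)
      (simp_all add: monoid_alg_simps mext_closed mext_mult mext_add mext_single \<mu>_one)
  then show ?thesis by (simp add: alg_hom_def monoid_alg_simps mext_smult)
qed

end

end

section \<open>Tensor products\<close>

definition lin_closed :: "('f::field, 'a) module \<Rightarrow> 'a set \<Rightarrow> bool" where
  "lin_closed A S \<longleftrightarrow> \<zero>\<^bsub>A\<^esub> \<in> S \<and> (\<forall>a\<in>S. \<forall>b\<in>S. a \<oplus>\<^bsub>A\<^esub> b \<in> S) \<and> (\<forall>c. \<forall>a\<in>S. c \<odot>\<^bsub>A\<^esub> a \<in> S)"

text \<open>Spanning is phrased through subspaces instead of linear combinations, so that it serves
  directly as an induction principle.\<close>

definition spans :: "('f::field, 'a) module \<Rightarrow> 'a set \<Rightarrow> bool" where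
  "spans A E \<longleftrightarrow> (\<forall>S \<subseteq> carrier A. lin_closed A S \<and> E \<subseteq> S \<longrightarrow> carrier A \<subseteq> S)"

lemma spansD:
  "spans A E \<Longrightarrow> S \<subseteq> carrier A \<Longrightarrow> lin_closed A S \<Longrightarrow> E \<subseteq> S \<Longrightarrow> carrier A \<subseteq> S"
  by (simp add: spans_def)

lemma map_times_minus_one: "Poly_Mapping.map ((*) (- 1 :: 'f::field)) u = - u"
  by (rule poly_mapping_eqI) (simp add: lookup_map_times)

text \<open>A criterion for \<open>C\<close> to be the tensor product: \<open>e\<close> and
  \<open>x\<close> span, and the products of their images form a basis of \<open>C\<close>.
  Independence in \<open>C\<close> then forces independence of the tensors.\<close>

locale tensor_setup =
  A: comm_algebra A + B: comm_algebra B + C: comm_algebra C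
  for A :: "('f::field, 'a) module" and B :: "('f, 'b) module" and C :: "('f, 'c) module" +
  fixes \<phi> :: "'a \<Rightarrow> 'c" and \<psi> :: "'b \<Rightarrow> 'c" and I :: "'i set" and J :: "'j set"
    and e :: "'i \<Rightarrow> 'a" and x :: "'j \<Rightarrow> 'b"
  assumes \<phi>: "\<phi> \<in> alg_hom A C" and \<psi>: "\<psi> \<in> alg_hom B C"
    and fin: "finite I" "finite J"
    and e_closed: "i \<in> I \<Longrightarrow> e i \<in> carrier A" and x_closed: "j \<in> J \<Longrightarrow> x j \<in> carrier B"
    and spans_e: "spans A (e ` I)" and spans_x: "spans B (x ` J)"
    and basis_gen: "y \<in> carrier C \<Longrightarrow>
      \<exists>c. y = (\<Oplus>\<^bsub>C\<^esub>k\<in>I \<times> J. c k \<odot>\<^bsub>C\<^esub> (\<phi> (e (fst k)) \<otimes>\<^bsub>C\<^esub> \<psi> (x (snd k))))"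
    and basis_indep: "(\<Oplus>\<^bsub>C\<^esub>k\<in>I \<times> J. c k \<odot>\<^bsub>C\<^esub> (\<phi> (e (fst k)) \<otimes>\<^bsub>C\<^esub> \<psi> (x (snd k)))) = \<zero>\<^bsub>C\<^esub> \<Longrightarrow>
      k \<in> I \<times> J \<Longrightarrow> c k = 0"
begin

abbreviation "M \<equiv> A \<times>\<times> B"
abbreviation "T \<equiv> genideal (monoid_alg M) (tensor_rels A B)"
abbreviation \<mu> where "\<mu> \<equiv> \<lambda>s. \<phi> (fst s) \<otimes>\<^bsub>C\<^esub> \<psi> (snd s)"
abbreviation "H \<equiv> mext C \<mu>"

lemma M_comm_monoid: "Group.comm_monoid M"
  by (rule comm_monoidI)
    (auto simp: DirProd_def A.m_ac B.m_ac)

sublocale MA: comm_algebra "monoid_alg M :: ('f, 'a \<times> 'b \<Rightarrow>\<^sub>0 'f) module"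
  by (rule comm_algebra_monoid_alg[OF M_comm_monoid])

lemma carrier_MA: "carrier (monoid_alg M :: ('f, 'a \<times> 'b \<Rightarrow>\<^sub>0 'f) module)
    = {u. Poly_Mapping.keys u \<subseteq> carrier A \<times> carrier B}"
  by (simp add: monoid_alg_def DirProd_def)

lemma \<mu>_closed: "s \<in> carrier M \<Longrightarrow> \<mu> s \<in> carrier C"
  using alg_homD(2)[OF \<phi>] alg_homD(2)[OF \<psi>] by (auto simp: DirProd_def)

lemma \<mu>_mult: "s \<in> carrier M \<Longrightarrow> t \<in> carrier M \<Longrightarrow> \<mu> (s \<otimes>\<^bsub>M\<^esub> t) = \<mu> s \<otimes>\<^bsub>C\<^esub> \<mu> t"
  using alg_homD(2)[OF \<phi>] alg_homD(2)[OF \<psi>]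
  by (auto simp: DirProd_def alg_homD(4)[OF \<phi>] alg_homD(4)[OF \<psi>] C.m_ac)

lemma \<mu>_one: "\<mu> \<one>\<^bsub>M\<^esub> = \<one>\<^bsub>C\<^esub>"
  by (simp add: DirProd_def alg_homD(5)[OF \<phi>] alg_homD(5)[OF \<psi>])

lemmas \<mu>_props = M_comm_monoid C.comm_algebra_axioms \<mu>_closed \<mu>_mult \<mu>_one

lemma H_hom: "H \<in> alg_hom (monoid_alg M) C"
  by (rule mext_hom) (fact \<mu>_props)+

lemma H_add: "u \<in> carrier (monoid_alg M) \<Longrightarrow> v \<in> carrier (monoid_alg M) \<Longrightarrow> H (u + v) = H u \<oplus>\<^bsub>C\<^esub> H v"
  using alg_homD(3)[OF H_hom, of u v] by (simp add: monoid_alg_def)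

lemma minus_MA: "v \<in> carrier (monoid_alg M) \<Longrightarrow> - v \<in> carrier (monoid_alg M)"
  by (simp add: monoid_alg_def)

lemma H_diff:
  assumes "u \<in> carrier (monoid_alg M)" "v \<in> carrier (monoid_alg M)"
  shows "H (u - v) = H u \<ominus>\<^bsub>C\<^esub> H v"
proof -
  have "H (- v) = (- 1) \<odot>\<^bsub>C\<^esub> H v"
    using alg_homD(6)[OF H_hom assms(2), of "- 1"] by (simp add: monoid_alg_def map_times_minus_one)
  also have "\<dots> = \<ominus>\<^bsub>C\<^esub> H v" using alg_homD(2)[OF H_hom assms(2)] by (simp add: C.smult_minus_one)
  finally show ?thesis using H_add[OF assms(1) minus_MA[OF assms(2)]] by (simp add: a_minus_def)
qed

lemma H_single: "a \<in> carrier A \<Longrightarrow> b \<in> carrier B \<Longrightarrow> H (Poly_Mapping.single (a, b) c) = c \<odot>\<^bsub>C\<^esub> (\<phi> a \<otimes>\<^bsub>C\<^esub> \<psi> b)"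
  using mext_single[of M C \<mu> "(a, b)" c, OF \<mu>_props] by (simp add: DirProd_def)

lemma rels_closed: "tensor_rels A B \<subseteq> carrier (monoid_alg M)"
proof -
  have diff: "u - v \<in> carrier (monoid_alg M)" if "u \<in> carrier (monoid_alg M)" "v \<in> carrier (monoid_alg M)"
    for u v :: "'a \<times> 'b \<Rightarrow>\<^sub>0 'f"
    using that Poly_Mapping.keys_diff[of u v] by (auto simp: carrier_MA)
  have single: "Poly_Mapping.single (a, b) c \<in> carrier (monoid_alg M)" if "a \<in> carrier A" "b \<in> carrier B" for a b and c :: 'f
    using that by (simp add: carrier_MA)
  show ?thesis unfolding tensor_rels_def Let_def
    by (auto intro!: diff single)
qed

lemma T_ideal: "ideal T (monoid_alg M)"
  by (rule MA.genideal_ideal[OF rels_closed])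

text \<open>The four families of relations express bilinearity, and the product of
  \<open>\<phi> a\<close> and \<open>\<psi> b\<close> in \<open>C\<close> is bilinear in
  \<open>a\<close> and \<open>b\<close>.\<close>

lemma H_T: "t \<in> T \<Longrightarrow> H t = \<zero>\<^bsub>C\<^esub>"
proof (rule genideal_in_kernel[OF MA.comm_algebra_axioms C.comm_algebra_axioms H_hom rels_closed])
  have single: "Poly_Mapping.single (a, b) c \<in> carrier (monoid_alg M)" if "a \<in> carrier A" "b \<in> carrier B" for a b and c :: 'f
    using that by (simp add: carrier_MA)
  have diff: "u - v \<in> carrier (monoid_alg M)" if "u \<in> carrier (monoid_alg M)" "v \<in> carrier (monoid_alg M)"
    for u v :: "'a \<times> 'b \<Rightarrow>\<^sub>0 'f"
    using that Poly_Mapping.keys_diff[of u v] by (auto simp: carrier_MA)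
  note cl = alg_homD(2)[OF \<phi>] alg_homD(2)[OF \<psi>]
  have canc: "y \<oplus>\<^bsub>C\<^esub> z \<ominus>\<^bsub>C\<^esub> y \<ominus>\<^bsub>C\<^esub> z = \<zero>\<^bsub>C\<^esub>" if "y \<in> carrier C" "z \<in> carrier C" for y z
  proof -
    have "y \<oplus>\<^bsub>C\<^esub> z \<ominus>\<^bsub>C\<^esub> y \<ominus>\<^bsub>C\<^esub> z = (y \<oplus>\<^bsub>C\<^esub> \<ominus>\<^bsub>C\<^esub> y) \<oplus>\<^bsub>C\<^esub> (z \<oplus>\<^bsub>C\<^esub> \<ominus>\<^bsub>C\<^esub> z)"
      using that by (simp add: a_minus_def C.a_ac)
    then show ?thesis using that by (simp add: C.r_neg)
  qed
  fix s assume "s \<in> tensor_rels A B"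
  then show "H s = \<zero>\<^bsub>C\<^esub>"
    unfolding tensor_rels_def Let_def
  proof (elim UnE CollectE exE conjE, goal_cases)
    case (1 a a' b)
    then show ?case
      by (simp add: H_diff H_single single diff alg_homD(3)[OF \<phi>] cl C.l_distr canc)
  next
    case (2 a b b')
    then show ?case
      by (simp add: H_diff H_single single diff alg_homD(3)[OF \<psi>] cl C.r_distr canc)
  next
    case (3 c a b)
    then show ?case
      by (simp add: H_diff H_single single diff alg_homD(6)[OF \<phi>] cl C.smult_assoc2 a_minus_def C.r_neg)
  next
    case (4 c a b)
    then show ?case
      by (simp add: H_diff H_single single diff alg_homD(6)[OF \<psi>] cl C.smult_r a_minus_def C.r_neg)
  qed
qed

definition R :: "('i \<times> 'j \<Rightarrow> 'f) \<Rightarrow> ('a \<times> 'b \<Rightarrow>\<^sub>0 'f)" where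
  "R c = (\<Sum>k\<in>I \<times> J. Poly_Mapping.single (e (fst k), x (snd k)) (c k))"

lemma H_R: "H (R c) = (\<Oplus>\<^bsub>C\<^esub>k\<in>I \<times> J. c k \<odot>\<^bsub>C\<^esub> (\<phi> (e (fst k)) \<otimes>\<^bsub>C\<^esub> \<psi> (x (snd k))))"
  and R_closed: "R c \<in> carrier (monoid_alg M)"
proof -
  have "H (\<Sum>k\<in>K. Poly_Mapping.single (e (fst k), x (snd k)) (c k))
      = (\<Oplus>\<^bsub>C\<^esub>k\<in>K. c k \<odot>\<^bsub>C\<^esub> (\<phi> (e (fst k)) \<otimes>\<^bsub>C\<^esub> \<psi> (x (snd k)))) \<and>
      (\<Sum>k\<in>K. Poly_Mapping.single (e (fst k), x (snd k)) (c k)) \<in> carrier (monoid_alg M)"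
    if "finite K" "K \<subseteq> I \<times> J" for K
    using that
  proof (induction K rule: finite_induct)
    case empty
    show ?case using mext_zero[of M C \<mu>, OF \<mu>_props] MA.zero_closed by (simp add: monoid_alg_def)
  next
    case (insert k K)
    have k: "e (fst k) \<in> carrier A" "x (snd k) \<in> carrier B" using insert by (auto simp: e_closed x_closed)
    have cl: "c k \<odot>\<^bsub>C\<^esub> (\<phi> (e (fst k)) \<otimes>\<^bsub>C\<^esub> \<psi> (x (snd k))) \<in> carrier C" if "k \<in> I \<times> J" for k
      using that alg_homD(2)[OF \<phi>] alg_homD(2)[OF \<psi>] e_closed x_closed by auto
    have s: "Poly_Mapping.single (e (fst k), x (snd k)) (c k) \<in> carrier (monoid_alg M)" using k by (simp add: carrier_MA)
    have r: "(\<Sum>k\<in>K. Poly_Mapping.single (e (fst k), x (snd k)) (c k)) \<in> carrier (monoid_alg M)"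
      using insert by simp
    have "(\<Oplus>\<^bsub>C\<^esub>k\<in>insert k K. c k \<odot>\<^bsub>C\<^esub> (\<phi> (e (fst k)) \<otimes>\<^bsub>C\<^esub> \<psi> (x (snd k)))) =
      c k \<odot>\<^bsub>C\<^esub> (\<phi> (e (fst k)) \<otimes>\<^bsub>C\<^esub> \<psi> (x (snd k))) \<oplus>\<^bsub>C\<^esub>
      (\<Oplus>\<^bsub>C\<^esub>k\<in>K. c k \<odot>\<^bsub>C\<^esub> (\<phi> (e (fst k)) \<otimes>\<^bsub>C\<^esub> \<psi> (x (snd k))))"
      using insert cl by (intro C.finsum_insert) auto
    then show ?case
      using insert k H_add[OF s r] MA.a_closed[OF s r]
      by (simp add: H_single) (simp add: monoid_alg_def)
  qed
  from this[of "I \<times> J"] show "H (R c) = (\<Oplus>\<^bsub>C\<^esub>k\<in>I \<times> J. c k \<odot>\<^bsub>C\<^esub> (\<phi> (e (fst k)) \<otimes>\<^bsub>C\<^esub> \<psi> (x (snd k))))"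
    "R c \<in> carrier (monoid_alg M)"
    using fin by (simp_all add: R_def)
qed

lemma T_closed:
  shows "0 \<in> T" and "u \<in> T \<Longrightarrow> v \<in> T \<Longrightarrow> u + v \<in> T" and "u \<in> T \<Longrightarrow> Poly_Mapping.map ((*) c) u \<in> T"
    and "u \<in> T \<Longrightarrow> u \<in> carrier (monoid_alg M)"
proof -
  interpret T: ideal T "monoid_alg M" by (rule T_ideal)
  show "0 \<in> T" using T.zero_closed by (simp add: monoid_alg_def)
  show "u + v \<in> T" if "u \<in> T" "v \<in> T" using T.a_closed[OF that] by (simp add: monoid_alg_def)
  show "Poly_Mapping.map ((*) c) u \<in> T" if "u \<in> T"
    using MA.ideal_smult[OF T_ideal that, of c] by (simp add: monoid_alg_def)
  show "u \<in> carrier (monoid_alg M)" if "u \<in> T" using that by (rule T.Icarr)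
qed

text \<open>The combinations \<open>R c\<close> of the products of basis vectors meet every class modulo \<open>T\<close>.\<close>

definition N :: "('a \<times> 'b \<Rightarrow>\<^sub>0 'f) set" where
  "N = {u. \<exists>c. u - R c \<in> T}"

lemma N_closed:
  shows "t \<in> T \<Longrightarrow> t \<in> N" and "u \<in> N \<Longrightarrow> v \<in> N \<Longrightarrow> u + v \<in> N"
    and "u \<in> N \<Longrightarrow> Poly_Mapping.map ((*) c) u \<in> N"
proof -
  show "t \<in> N" if "t \<in> T"
    unfolding N_def using that by (auto intro!: exI[of _ "\<lambda>_. 0"] simp: R_def)
  show "u + v \<in> N" if uv: "u \<in> N" "v \<in> N"
  proof -
    obtain c c' where "u - R c \<in> T" "v - R c' \<in> T" using uv by (auto simp: N_def)
    then have "(u - R c) + (v - R c') \<in> T" by (rule T_closed)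
    moreover have "R (\<lambda>k. c k + c' k) = R c + R c'" by (simp add: R_def single_add sum.distrib)
    ultimately have "u + v - R (\<lambda>k. c k + c' k) \<in> T" by (simp add: algebra_simps)
    then show ?thesis by (auto simp: N_def)
  qed
  show "Poly_Mapping.map ((*) c) u \<in> N" if u: "u \<in> N"
  proof -
    obtain c' where "u - R c' \<in> T" using u by (auto simp: N_def)
    then have "Poly_Mapping.map ((*) c) (u - R c') \<in> T" by (rule T_closed)
    moreover have "Poly_Mapping.map ((*) c) (u - R c') = Poly_Mapping.map ((*) c) u - R (\<lambda>k. c * c' k)"
      by (rule poly_mapping_eqI)
        (simp add: lookup_map_times lookup_minus R_def lookup_sum right_diff_distrib sum_distrib_left
          lookup_single when_def if_distrib cong: if_cong)
    ultimately show ?thesis by (auto simp: N_def)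
  qed
qed

abbreviation dl :: "'a \<Rightarrow> 'b \<Rightarrow> ('a \<times> 'b \<Rightarrow>\<^sub>0 'f)" where "dl a b \<equiv> Poly_Mapping.single (a, b) 1"

lemma rels_T: "s \<in> tensor_rels A B \<Longrightarrow> s \<in> T"
  using MA.genideal_self[OF rels_closed] by blast

text \<open>Bilinearity modulo \<open>T\<close> is used in one argument at a time: the spanning
  property of \<open>x\<close> frees the second entry while the first is some \<open>e i\<close>,
  then that of \<open>e\<close> frees the first.\<close>

lemma dl_in_N:
  assumes "a \<in> carrier A" "b \<in> carrier B"
  shows "dl a b \<in> N"
proof -
  have base: "dl (e i) (x j) \<in> N" if "i \<in> I" "j \<in> J" for i j
  proof -
    have "R (\<lambda>k. if k = (i, j) then 1 else 0) = (\<Sum>k\<in>I \<times> J. if k = (i, j) then dl (e i) (x j) else 0)"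
      unfolding R_def by (intro sum.cong) auto
    also have "\<dots> = dl (e i) (x j)" using that fin by simp
    finally have "dl (e i) (x j) - R (\<lambda>k. if k = (i, j) then 1 else 0) \<in> T" using T_closed(1) by simp
    then show ?thesis unfolding N_def by blast
  qed
  have right: "dl (e i) b \<in> N" if i: "i \<in> I" and b: "b \<in> carrier B" for i b
  proof -
    let ?S = "{b \<in> carrier B. dl (e i) b \<in> N}"
    have ei: "e i \<in> carrier A" using i by (rule e_closed)
    have sm: "dl (e i) (c \<odot>\<^bsub>B\<^esub> b) \<in> N" if "b \<in> ?S" for b c
    proof -
      have "dl (e i) (c \<odot>\<^bsub>B\<^esub> b) - Poly_Mapping.map ((*) c) (dl (e i) b) \<in> tensor_rels A B"
        unfolding tensor_rels_def Let_def using ei that by blast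
      then have "(dl (e i) (c \<odot>\<^bsub>B\<^esub> b) - Poly_Mapping.map ((*) c) (dl (e i) b)) + Poly_Mapping.map ((*) c) (dl (e i) b) \<in> N"
        using that by (intro N_closed(2)[OF N_closed(1)[OF rels_T] N_closed(3)]) auto
      then show ?thesis by simp
    qed
    have ze: "dl (e i) \<zero>\<^bsub>B\<^esub> \<in> N"
    proof -
      have "dl (e i) (0 \<odot>\<^bsub>B\<^esub> \<zero>\<^bsub>B\<^esub>) - Poly_Mapping.map ((*) 0) (dl (e i) \<zero>\<^bsub>B\<^esub>) \<in> tensor_rels A B"
        unfolding tensor_rels_def Let_def using ei by blast
      moreover have "Poly_Mapping.map ((*) 0) (dl (e i) \<zero>\<^bsub>B\<^esub>) = 0" by (simp add: map_eq_zero_iff)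
      ultimately show ?thesis using N_closed(1)[OF rels_T] by fastforce
    qed
    have ad: "dl (e i) (b \<oplus>\<^bsub>B\<^esub> b') \<in> N" if "b \<in> ?S" "b' \<in> ?S" for b b'
    proof -
      have "dl (e i) (b \<oplus>\<^bsub>B\<^esub> b') - dl (e i) b - dl (e i) b' \<in> tensor_rels A B"
        unfolding tensor_rels_def Let_def using ei that by blast
      then have "(dl (e i) (b \<oplus>\<^bsub>B\<^esub> b') - dl (e i) b - dl (e i) b') + (dl (e i) b + dl (e i) b') \<in> N"
        using that by (intro N_closed(2)[OF N_closed(1)[OF rels_T] N_closed(2)]) auto
      then show ?thesis by (simp add: algebra_simps)
    qed
    have "lin_closed B ?S" unfolding lin_closed_def using sm ze ad by simp
    moreover have "x ` J \<subseteq> ?S" using base[OF i] x_closed by auto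
    ultimately have "carrier B \<subseteq> ?S" by (intro spansD[OF spans_x]) simp_all
    then show ?thesis using b by blast
  qed
  let ?S = "{a \<in> carrier A. dl a b \<in> N}"
  have b: "b \<in> carrier B" by fact
  have sm: "dl (c \<odot>\<^bsub>A\<^esub> a) b \<in> N" if "a \<in> ?S" for a c
  proof -
    have "dl (c \<odot>\<^bsub>A\<^esub> a) b - Poly_Mapping.map ((*) c) (dl a b) \<in> tensor_rels A B"
      unfolding tensor_rels_def Let_def using b that by blast
    then have "(dl (c \<odot>\<^bsub>A\<^esub> a) b - Poly_Mapping.map ((*) c) (dl a b)) + Poly_Mapping.map ((*) c) (dl a b) \<in> N"
        using that by (intro N_closed(2)[OF N_closed(1)[OF rels_T] N_closed(3)]) auto
    then show ?thesis by simp
  qed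
  have ze: "dl \<zero>\<^bsub>A\<^esub> b \<in> N"
  proof -
    have "dl (0 \<odot>\<^bsub>A\<^esub> \<zero>\<^bsub>A\<^esub>) b - Poly_Mapping.map ((*) 0) (dl \<zero>\<^bsub>A\<^esub> b) \<in> tensor_rels A B"
      unfolding tensor_rels_def Let_def using b by blast
    moreover have "Poly_Mapping.map ((*) 0) (dl \<zero>\<^bsub>A\<^esub> b) = 0" by (simp add: map_eq_zero_iff)
    ultimately show ?thesis using N_closed(1)[OF rels_T] by fastforce
  qed
  have ad: "dl (a \<oplus>\<^bsub>A\<^esub> a') b \<in> N" if "a \<in> ?S" "a' \<in> ?S" for a a'
  proof -
    have "dl (a \<oplus>\<^bsub>A\<^esub> a') b - dl a b - dl a' b \<in> tensor_rels A B"
      unfolding tensor_rels_def Let_def using b that by blast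
    then have "(dl (a \<oplus>\<^bsub>A\<^esub> a') b - dl a b - dl a' b) + (dl a b + dl a' b) \<in> N"
        using that by (intro N_closed(2)[OF N_closed(1)[OF rels_T] N_closed(2)]) auto
    then show ?thesis by (simp add: algebra_simps)
  qed
  have "lin_closed A ?S" unfolding lin_closed_def using sm ze ad by simp
  moreover have "e ` I \<subseteq> ?S" using right[OF _ b] e_closed by auto
  ultimately have "carrier A \<subseteq> ?S" by (intro spansD[OF spans_e]) simp_all
  then show ?thesis using assms by blast
qed

lemma carrier_N: "u \<in> carrier (monoid_alg M) \<Longrightarrow> u \<in> N"
proof -
  assume "u \<in> carrier (monoid_alg M)"
  then have "Poly_Mapping.keys u \<subseteq> carrier A \<times> carrier B" by (simp add: carrier_MA)
  then show ?thesis
  proof (induction rule: poly_mapping_single_induct)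
    case zero
    show ?case by (rule N_closed(1)[OF T_closed(1)])
  next
    case (single s c)
    then have "Poly_Mapping.map ((*) c) (dl (fst s) (snd s)) \<in> N" by (intro N_closed(3) dl_in_N) auto
    then show ?case by simp
  next
    case (add u v)
    then show ?case by (intro N_closed(2))
  qed
qed

lemma alg_isomorphic_tensor: "alg_isomorphic C (tensor_alg A B)"
  unfolding tensor_alg_def
proof (rule alg_isomorphic_quot[OF MA.comm_algebra_axioms T_ideal C.comm_algebra_axioms H_hom])
  show "H ` carrier (monoid_alg M) = carrier C"
  proof
    show "H ` carrier (monoid_alg M) \<subseteq> carrier C" using alg_homD(2)[OF H_hom] by auto
    show "carrier C \<subseteq> H ` carrier (monoid_alg M)"
    proof
      fix y assume "y \<in> carrier C"
      then obtain c where "y = H (R c)" using basis_gen H_R by metis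
      then show "y \<in> H ` carrier (monoid_alg M)" using R_closed by blast
    qed
  qed
  show "H u = \<zero>\<^bsub>C\<^esub> \<longleftrightarrow> u \<in> T" if u: "u \<in> carrier (monoid_alg M)" for u
  proof
    assume "H u = \<zero>\<^bsub>C\<^esub>"
    \<comment> \<open>Modulo \<open>T\<close> the element is a combination of the products of
      spanning vectors. Its image is the same combination of a basis of \<open>C\<close>, so all
      coefficients vanish.\<close>
    obtain c where c: "u - R c \<in> T" using carrier_N[OF u] by (auto simp: N_def)
    have "H u = H ((u - R c) + R c)" by simp
    also have "\<dots> = H (u - R c) \<oplus>\<^bsub>C\<^esub> H (R c)" by (rule H_add[OF T_closed(4)[OF c] R_closed])
    also have "\<dots> = H (R c)" using H_T[OF c] alg_homD(2)[OF H_hom R_closed] by simp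
    finally have "H (R c) = \<zero>\<^bsub>C\<^esub>" using \<open>H u = \<zero>\<^bsub>C\<^esub>\<close> by simp
    then have "c k = 0" if "k \<in> I \<times> J" for k using that basis_indep H_R by metis
    then have "R c = 0" unfolding R_def by (intro sum.neutral) auto
    then show "u \<in> T" using c by simp
  qed (rule H_T)
qed

end

section \<open>Truncated polynomial algebras and divided powers\<close>

text \<open>\<open>p ^ N\<close> divides \<open>k\<close> times the binomial coefficient. Were the
  latter prime to \<open>p\<close>, then \<open>p ^ N\<close> would divide \<open>k\<close>.\<close>

lemma of_nat_choose_prime_power:
  assumes "CHAR('f::field) = p" "Factorial_Ring.prime p" "0 < k" "k < p ^ N"
  shows "of_nat (p ^ N choose k) = (0 :: 'f)"
proof (rule ccontr)
  assume "of_nat (p ^ N choose k) \<noteq> (0 :: 'f)"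
  then have "\<not> p dvd (p ^ N choose k)" using assms(1) by (simp add: of_nat_eq_0_iff_char_dvd)
  then have "coprime (p ^ N) (p ^ N choose k)" using assms(2) by (simp add: prime_imp_coprime)
  moreover have "p ^ N dvd k * (p ^ N choose k)"
    using times_binomial_minus1_eq[OF assms(3), of "p ^ N"] by simp
  ultimately have "p ^ N dvd k" by (simp add: coprime_dvd_mult_left_iff)
  then show False using assms(3,4) by (simp add: nat_dvd_not_less)
qed

text \<open>A case of Lucas' congruence: in Vandermonde's sum only the terms \<open>0\<close> and
  \<open>p ^ N\<close> survive in characteristic \<open>p\<close>, so raising \<open>a\<close> by
  one adds one to the value.\<close>

lemma of_nat_choose_leading_digit:
  assumes "CHAR('f::field) = p" "Factorial_Ring.prime p" "b < p ^ N"
  shows "of_nat ((a * p ^ N + b) choose (p ^ N)) = (of_nat a :: 'f)"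
proof (induction a)
  case 0
  then show ?case using assms by (simp add: binomial_eq_0)
next
  case (Suc a)
  let ?P = "p ^ N" and ?n = "a * p ^ N + b"
  have P: "?P > 0" using assms(2) by (simp add: prime_gt_0_nat)
  have "of_nat ((?P + ?n) choose ?P) = (\<Sum>k\<le>?P. of_nat (?P choose k) * of_nat (?n choose (?P - k)) :: 'f)"
    by (simp flip: vandermonde)
  also have "\<dots> = (\<Sum>k\<in>{0, ?P}. of_nat (?P choose k) * of_nat (?n choose (?P - k)))"
  proof (rule sum.mono_neutral_right)
    show "\<forall>k\<in>{..?P} - {0, ?P}. of_nat (?P choose k) * of_nat (?n choose (?P - k)) = (0 :: 'f)"
    proof
      fix k assume "k \<in> {..?P} - {0, ?P}"
      then have "0 < k" "k < ?P" by auto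
      then have "of_nat (?P choose k) = (0 :: 'f)" by (rule of_nat_choose_prime_power[OF assms(1,2)])
      then show "of_nat (?P choose k) * of_nat (?n choose (?P - k)) = (0 :: 'f)" by simp
    qed
  qed auto
  also have "\<dots> = of_nat (?n choose ?P) + 1" using P by simp
  finally show ?case using Suc by (simp add: algebra_simps)
qed

section \<open>Base \<open>p\<close> expansions and reduced monomials\<close>

lemma weight_eq_sum:
  assumes "Poly_Mapping.keys m \<subseteq> {..<N}"
  shows "weight p m = (\<Sum>i<N. Poly_Mapping.lookup m i * p ^ i)"
  unfolding weight_def using assms by (intro sum.mono_neutral_left) (auto simp: in_keys_iff)

lemma keys_bound: "\<exists>N. Poly_Mapping.keys (m :: nat \<Rightarrow>\<^sub>0 nat) \<subseteq> {..<N}"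
  using finite_nat_iff_bounded[of "Poly_Mapping.keys m"] by simp

lemma digit_of_sum:
  fixes p :: nat
  assumes "\<And>j. f j < p"
  shows "(\<Sum>j<N. f j * p ^ j) div p ^ i mod p = (if i < N then f i else 0)"
  using assms
proof (induction i arbitrary: f N)
  case 0
  show ?case
  proof (cases N)
    case (Suc N')
    have "(\<Sum>j<N. f j * p ^ j) = f 0 + p * (\<Sum>j<N'. f (Suc j) * p ^ j)"
      unfolding Suc sum.lessThan_Suc_shift by (simp add: sum_distrib_left algebra_simps)
    then show ?thesis using 0 Suc by simp
  qed simp
next
  case (Suc i)
  show ?case
  proof (cases N)
    case (Suc N')
    have p: "p > 0" using Suc.prems[of 0] by simp
    have "(\<Sum>j<N. f j * p ^ j) = f 0 + p * (\<Sum>j<N'. f (Suc j) * p ^ j)"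
      unfolding Suc sum.lessThan_Suc_shift by (simp add: sum_distrib_left algebra_simps)
    then have "(\<Sum>j<N. f j * p ^ j) div p ^ Suc i = (\<Sum>j<N'. f (Suc j) * p ^ j) div p ^ i"
      using Suc.prems[of 0] p by (simp add: div_mult2_eq)
    then show ?thesis using Suc.IH[of "\<lambda>j. f (Suc j)" N'] Suc.prems Suc by simp
  qed simp
qed

lemma sum_digits: "(\<Sum>i<N. (w div p ^ i mod p) * p ^ i) = w mod (p :: nat) ^ N"
proof (induction N)
  case (Suc N)
  then show ?case using mod_mult2_eq[of w "p ^ N" p] by (simp add: algebra_simps)
qed simp

text \<open>The exponent vector of the unique monomial of weight \<open>w\<close> with all exponents
  below \<open>p\<close>.\<close>

definition digits :: "nat \<Rightarrow> nat \<Rightarrow> (nat \<Rightarrow>\<^sub>0 nat)" where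
  "digits p w = Abs_poly_mapping (\<lambda>i. w div p ^ i mod p)"

lemma lookup_digits:
  assumes "p > 1"
  shows "Poly_Mapping.lookup (digits p w) i = w div p ^ i mod p"
proof -
  have "{i. w div p ^ i mod p \<noteq> 0} \<subseteq> {..<w}"
  proof
    fix i assume i: "i \<in> {i. w div p ^ i mod p \<noteq> 0}"
    have "p ^ i \<le> w" using i by (metis (mono_tags) div_less mem_Collect_eq mod_0 not_le)
    moreover have "i < p ^ i" using assms by (simp add: power_gt_expt)
    ultimately show "i \<in> {..<w}" by simp
  qed
  then have "finite {i. w div p ^ i mod p \<noteq> 0}" by (rule finite_subset) simp
  then show ?thesis unfolding digits_def by (simp add: lookup_Abs_poly_mapping)
qed

lemma weight_digits:
  assumes "p > 1"
  shows "weight p (digits p w) = w"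
proof -
  obtain N where N: "Poly_Mapping.keys (digits p w) \<subseteq> {..<N}" using keys_bound by blast
  then have N': "Poly_Mapping.keys (digits p w) \<subseteq> {..<max N w}" by auto
  have "w < p ^ w" using assms by (simp add: power_gt_expt)
  also have "p ^ w \<le> p ^ max N w" using assms by (intro power_increasing) auto
  finally show ?thesis
    using assms by (simp add: weight_eq_sum[OF N'] lookup_digits sum_digits)
qed

lemma digits_weight:
  assumes "p > 1" and red: "\<And>i. Poly_Mapping.lookup m i < p"
  shows "digits p (weight p m) = m"
proof (rule poly_mapping_eqI)
  fix i
  obtain N where N: "Poly_Mapping.keys m \<subseteq> {..<N}" using keys_bound by blast
  have "Poly_Mapping.lookup (digits p (weight p m)) i = (if i < N then Poly_Mapping.lookup m i else 0)"
    using assms(1) by (simp add: lookup_digits weight_eq_sum[OF N] digit_of_sum[OF red])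
  also have "\<dots> = Poly_Mapping.lookup m i" using N by (auto simp: in_keys_iff)
  finally show "Poly_Mapping.lookup (digits p (weight p m)) i = Poly_Mapping.lookup m i" .
qed

section \<open>The polynomial algebra and its quotients\<close>

abbreviation exp_monoid :: "(nat \<Rightarrow>\<^sub>0 nat) monoid" where
  "exp_monoid \<equiv> \<lparr>carrier = UNIV, monoid.mult = (+), one = 0\<rparr>"

lemma comm_monoid_exp: "Group.comm_monoid exp_monoid"
  by (rule comm_monoidI) (auto simp: algebra_simps)

lemma poly_alg_eq: "poly_alg = monoid_alg exp_monoid"
proof -
  have "u * v = (\<Sum>s\<in>Poly_Mapping.keys u. \<Sum>t\<in>Poly_Mapping.keys v.
      Poly_Mapping.single (s + t) (Poly_Mapping.lookup u s * Poly_Mapping.lookup v t))" for u v :: "'f::field inf_poly"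
  proof -
    have "u * v = (\<Sum>s\<in>Poly_Mapping.keys u. Poly_Mapping.single s (Poly_Mapping.lookup u s)) *
       (\<Sum>t\<in>Poly_Mapping.keys v. Poly_Mapping.single t (Poly_Mapping.lookup v t))"
      by (simp only: poly_mapping_sum_single)
    also have "\<dots> = (\<Sum>s\<in>Poly_Mapping.keys u. \<Sum>t\<in>Poly_Mapping.keys v.
      Poly_Mapping.single (s + t) (Poly_Mapping.lookup u s * Poly_Mapping.lookup v t))"
      by (simp only: sum_product mult_single)
    finally show ?thesis .
  qed
  then show ?thesis unfolding poly_alg_def monoid_alg_def by (auto simp: fun_eq_iff)
qed

lemma comm_algebra_poly: "comm_algebra poly_alg"
  unfolding poly_alg_eq by (rule comm_algebra_monoid_alg[OF comm_monoid_exp])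

lemma carrier_poly [simp]: "carrier poly_alg = UNIV"
  by (simp add: poly_alg_def)

lemma ideal_pow: "ideal (pow_ideal p :: 'f::field inf_poly set) poly_alg"
proof -
  interpret comm_algebra "poly_alg :: ('f, 'f inf_poly) module" by (rule comm_algebra_poly)
  show ?thesis unfolding pow_ideal_def by (rule genideal_ideal) (simp add: poly_alg_def)
qed

lemma comm_algebra_P: "comm_algebra (P_alg p)"
  unfolding P_alg_def by (rule comm_algebra_quot[OF comm_algebra_poly ideal_pow])

definition P_class :: "nat \<Rightarrow> 'f::field inf_poly \<Rightarrow> 'f inf_poly set" where
  "P_class p f = pow_ideal p +>\<^bsub>poly_alg\<^esub> f"

definition PW_class :: "nat \<Rightarrow> nat \<Rightarrow> 'f::field inf_poly \<Rightarrow> 'f inf_poly set set" where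
  "PW_class p n f = W_ideal p n +>\<^bsub>P_alg p\<^esub> P_class p f"

lemma P_class_closed: "P_class p f \<in> carrier (P_alg p)"
  unfolding P_class_def P_alg_def quot_alg_simps(1)[OF comm_algebra_poly ideal_pow]
  by (simp add: poly_alg_def)

lemma carrier_P: "carrier (P_alg p) = range (P_class p)"
  unfolding P_class_def[abs_def] P_alg_def quot_alg_simps(1)[OF comm_algebra_poly ideal_pow]
  by (simp add: poly_alg_def)

lemma W_ideal_eq: "W_ideal p n = genideal (P_alg p) {P_class p (monomial m) | m. weight p m > n}"
  by (simp add: W_ideal_def P_class_def)

lemma W_gens_closed: "{P_class p (monomial m) | m. weight p m > n} \<subseteq> carrier (P_alg p)"
  using P_class_closed by blast

lemma ideal_W: "ideal (W_ideal p n :: 'f::field inf_poly set set) (P_alg p)"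
proof -
  interpret comm_algebra "P_alg p :: ('f, 'f inf_poly set) module" by (rule comm_algebra_P)
  show ?thesis unfolding W_ideal_eq by (rule genideal_ideal[OF W_gens_closed])
qed

lemma comm_algebra_PW: "comm_algebra (PW_alg p n)"
  unfolding PW_alg_def by (rule comm_algebra_quot[OF comm_algebra_P ideal_W])

lemma carrier_PW: "carrier (PW_alg p n) = range (PW_class p n)"
  unfolding PW_class_def[abs_def] PW_alg_def quot_alg_simps(1)[OF comm_algebra_P ideal_W]
  by (simp add: carrier_P image_image)

lemma P_class_hom: "P_class p \<in> alg_hom poly_alg (P_alg p)"
  unfolding P_class_def[abs_def] P_alg_def by (rule proj_hom[OF comm_algebra_poly ideal_pow])

lemma PW_class_hom:
  "PW_class p n (f + g) = PW_class p n f \<oplus>\<^bsub>PW_alg p n\<^esub> PW_class p n g"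
  "PW_class p n (Poly_Mapping.map ((*) c) f) = c \<odot>\<^bsub>PW_alg p n\<^esub> PW_class p n f"
proof -
  have *: "(\<lambda>a. W_ideal p n +>\<^bsub>P_alg p\<^esub> a) \<in> alg_hom (P_alg p) (PW_alg p n)"
    unfolding PW_alg_def by (rule proj_hom[OF comm_algebra_P ideal_W])
  have "P_class p (f + g) = P_class p f \<oplus>\<^bsub>P_alg p\<^esub> P_class p g"
    using alg_homD(3)[OF P_class_hom, of f g p] by (simp add: poly_alg_def)
  then show "PW_class p n (f + g) = PW_class p n f \<oplus>\<^bsub>PW_alg p n\<^esub> PW_class p n g"
    using alg_homD(3)[OF *, of "P_class p f" "P_class p g"] P_class_closed[of p f] P_class_closed[of p g]
    by (simp add: PW_class_def)
  have "P_class p (Poly_Mapping.map ((*) c) f) = c \<odot>\<^bsub>P_alg p\<^esub> P_class p f"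
    using alg_homD(6)[OF P_class_hom, of f p c] by (simp add: poly_alg_def)
  then show "PW_class p n (Poly_Mapping.map ((*) c) f) = c \<odot>\<^bsub>PW_alg p n\<^esub> PW_class p n f"
    using alg_homD(6)[OF *, of "P_class p f" c] P_class_closed[of p f]
    by (simp add: PW_class_def)
qed

lemma pvar_power: "pvar i ^ k = (monomial (Poly_Mapping.single i k) :: 'f::field inf_poly)"
  by (induction k) (simp_all add: pvar_def monomial_def mult_single flip: single_add)

lemma PW_class_zero: "PW_class p n (0 :: 'f::field inf_poly) = \<zero>\<^bsub>PW_alg p n\<^esub>"
proof -
  interpret comm_algebra "PW_alg p n :: ('f, 'f inf_poly set set) module" by (rule comm_algebra_PW)
  have "PW_class p n (0 :: 'f inf_poly) \<in> carrier (PW_alg p n)" by (simp add: carrier_PW)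
  then show ?thesis using PW_class_hom(2)[of p n 0 "0 :: 'f inf_poly"] by simp
qed

lemma PW_class_monomial_not_reduced:
  assumes "Poly_Mapping.lookup m i \<ge> p"
  shows "PW_class p n (monomial m :: 'f::field inf_poly) = \<zero>\<^bsub>PW_alg p n\<^esub>"
proof -
  interpret comm_algebra "poly_alg :: ('f, 'f inf_poly) module" by (rule comm_algebra_poly)
  define m' where "m' = m - Poly_Mapping.single i p"
  have "m = m' + Poly_Mapping.single i p"
    by (rule poly_mapping_eqI) (use assms in \<open>auto simp: m'_def lookup_add lookup_minus lookup_single when_def\<close>)
  then have "monomial m = monomial m' * (pvar i ^ p :: 'f inf_poly)"
    by (simp add: pvar_power monomial_def mult_single)
  moreover have "pvar i ^ p \<in> (pow_ideal p :: 'f inf_poly set)"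
  proof -
    have "{pvar i ^ p | i. True} \<subseteq> (pow_ideal p :: 'f inf_poly set)"
      unfolding pow_ideal_def by (rule genideal_self) (simp add: poly_alg_def)
    then show ?thesis by blast
  qed
  ultimately have "monomial m \<in> (pow_ideal p :: 'f inf_poly set)"
    using ideal.I_l_closed[OF ideal_pow, of "pvar i ^ p" p "monomial m'"] by (simp add: poly_alg_def)
  then have "P_class p (monomial m :: 'f inf_poly) = pow_ideal p"
    unfolding P_class_def by (intro coset_eq_zero[OF comm_algebra_poly ideal_pow, THEN iffD2]) (simp_all add: carrier_poly)
  also have "\<dots> = P_class p 0"
    unfolding P_class_def
    using additive_subgroup.zero_closed[OF ideal.axioms(1)[OF ideal_pow[of p]]]
    by (intro coset_eq_zero[OF comm_algebra_poly ideal_pow, THEN iffD2, symmetric]) (simp_all add: poly_alg_def)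
  finally show ?thesis using PW_class_zero by (metis PW_class_def)
qed

lemma PW_class_monomial_heavy:
  assumes "weight p m > n"
  shows "PW_class p n (monomial m :: 'f::field inf_poly) = \<zero>\<^bsub>PW_alg p n\<^esub>"
proof -
  interpret comm_algebra "P_alg p :: ('f, 'f inf_poly set) module" by (rule comm_algebra_P)
  have "P_class p (monomial m :: 'f inf_poly) \<in> W_ideal p n"
    unfolding W_ideal_eq using genideal_self[OF W_gens_closed] assms by blast
  then have "PW_class p n (monomial m :: 'f inf_poly) = W_ideal p n"
    unfolding PW_class_def using coset_eq_zero[OF comm_algebra_P ideal_W] P_class_closed by blast
  also have "\<dots> = \<zero>\<^bsub>PW_alg p n\<^esub>"
    unfolding PW_alg_def by (rule quot_alg_simps(3)[OF comm_algebra_P ideal_W, symmetric])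
  finally show ?thesis .
qed

text \<open>A monomial that is too heavy or has an exponent of at least \<open>p\<close> is zero in
  the quotient; any other one is recovered from its weight. Independence is settled later, by the
  images in \<open>C\<close>.\<close>

lemma spans_PW:
  assumes "p > 1"
  shows "spans (PW_alg p n :: ('f::field, _) module) ((\<lambda>w. PW_class p n (monomial (digits p w))) ` {..n})"
  unfolding spans_def
proof (intro allI impI subsetI, elim conjE)
  fix S :: "'f inf_poly set set set" and y :: "'f inf_poly set set"
  assume S: "lin_closed (PW_alg p n) S" "(\<lambda>w. PW_class p n (monomial (digits p w))) ` {..n} \<subseteq> S"
    and y: "y \<in> carrier (PW_alg p n)"
  have mono: "PW_class p n (monomial m :: 'f inf_poly) \<in> S" for m
  proof -
    consider "weight p m > n" | i where "Poly_Mapping.lookup m i \<ge> p"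
      | "weight p m \<le> n" "\<And>i. Poly_Mapping.lookup m i < p" by (meson not_le)
    then show ?thesis
    proof cases
      case 3
      then have "m = digits p (weight p m)" using digits_weight[OF assms] by simp
      then show ?thesis using S(2) 3(1) by force
    qed (use S(1) in \<open>simp_all add: lin_closed_def PW_class_monomial_heavy PW_class_monomial_not_reduced\<close>)
  qed
  have "PW_class p n f \<in> S" for f :: "'f inf_poly"
  proof -
    have "Poly_Mapping.keys f \<subseteq> UNIV" by simp
    then show ?thesis
    proof (induction rule: poly_mapping_single_induct)
      case zero
      show ?case using S(1) by (simp add: PW_class_zero lin_closed_def)
    next
      case (single s c)
      have "Poly_Mapping.map ((*) c) (monomial s) = Poly_Mapping.single s c" by (simp add: monomial_def)
      then have "PW_class p n (Poly_Mapping.single s c) = c \<odot>\<^bsub>PW_alg p n\<^esub> PW_class p n (monomial s)"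
        using PW_class_hom(2)[of p n c "monomial s"] by simp
      then show ?case using S(1) mono[of s] by (simp add: lin_closed_def)
    next
      case (add u v)
      then show ?case using S(1) by (simp add: PW_class_hom(1) lin_closed_def)
    qed
  qed
  then show "y \<in> S" using y by (auto simp: carrier_PW)
qed

text \<open>\<open>E i\<close> stands for \<open>x ^ i / i!\<close>, cut off above degree
  \<open>n\<close>. The law is stated with binomial coefficients since \<open>i!\<close> is zero in
  the field for \<open>i \<ge> p\<close>.\<close>

locale divided_powers = C: comm_algebra C for C :: "('f::field, 'c) module" +
  fixes p n :: nat and E :: "nat \<Rightarrow> 'c"
  assumes char_p: "CHAR('f) = p" and prime_p: "Factorial_Ring.prime p"
    and E_closed: "E i \<in> carrier C"
    and E_0: "E 0 = \<one>\<^bsub>C\<^esub>"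
    and E_mult: "E i \<otimes>\<^bsub>C\<^esub> E j = of_nat ((i + j) choose i) \<odot>\<^bsub>C\<^esub> E (i + j)"
    and E_big: "k > n \<Longrightarrow> E k = \<zero>\<^bsub>C\<^esub>"
begin

lemma p_gt_1: "p > 1"
  using prime_p by (rule prime_gt_1_nat)

lemma E_pow: "\<exists>\<gamma>. E a [^]\<^bsub>C\<^esub> (k :: nat) = \<gamma> \<odot>\<^bsub>C\<^esub> E (k * a)"
proof (induction k)
  case 0
  have "E a [^]\<^bsub>C\<^esub> (0 :: nat) = 1 \<odot>\<^bsub>C\<^esub> E (0 * a)" by (simp add: E_0)
  then show ?case ..
next
  case (Suc k)
  then obtain \<gamma> where "E a [^]\<^bsub>C\<^esub> k = \<gamma> \<odot>\<^bsub>C\<^esub> E (k * a)" by blast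
  then have "E a [^]\<^bsub>C\<^esub> Suc k = (\<gamma> * of_nat ((k * a + a) choose (k * a))) \<odot>\<^bsub>C\<^esub> E (Suc k * a)"
    by (simp add: E_closed C.smult_assoc2 E_mult C.smult_assoc1 add.commute)
  then show ?case ..
qed

text \<open>Multiplying the factors one by one produces binomial coefficients. The last is
  \<open>p * a choose a\<close>, which is \<open>p\<close> times
  \<open>(p * a - 1) choose (a - 1)\<close> and so vanishes in the field.\<close>

lemma E_pow_p:
  assumes "a > 0"
  shows "E a [^]\<^bsub>C\<^esub> p = \<zero>\<^bsub>C\<^esub>"
proof -
  obtain k where k: "p = Suc k" using p_gt_1 by (cases p) auto
  obtain \<gamma> where g: "E a [^]\<^bsub>C\<^esub> k = \<gamma> \<odot>\<^bsub>C\<^esub> E (k * a)" using E_pow by blast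
  have "a * (p * a choose a) = a * (p * ((p * a - 1) choose (a - 1)))"
    using times_binomial_minus1_eq[OF assms, of "p * a"] by auto
  then have "p dvd (p * a choose a)" using assms by simp
  moreover have "p * a choose a = ((k * a + a) choose (k * a))"
    using binomial_symmetric[of a "p * a"] k by (simp add: add.commute)
  ultimately have z: "of_nat ((k * a + a) choose (k * a)) = (0 :: 'f)"
    using char_p by (simp add: of_nat_eq_0_iff_char_dvd)
  have "E a [^]\<^bsub>C\<^esub> p = (\<gamma> \<odot>\<^bsub>C\<^esub> E (k * a)) \<otimes>\<^bsub>C\<^esub> E a" unfolding k by (simp add: g)
  also have "\<dots> = \<gamma> \<odot>\<^bsub>C\<^esub> (of_nat ((k * a + a) choose (k * a)) \<odot>\<^bsub>C\<^esub> E (k * a + a))"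
    by (simp add: C.smult_assoc2 E_closed E_mult)
  also have "\<dots> = \<zero>\<^bsub>C\<^esub>" unfolding z by (simp add: E_closed)
  finally show ?thesis .
qed

text \<open>The variable of weight \<open>p ^ i\<close> is sent to the divided power of that degree.\<close>

definition \<mu> :: "(nat \<Rightarrow>\<^sub>0 nat) \<Rightarrow> 'c" where
  "\<mu> m = (\<Otimes>\<^bsub>C\<^esub>i\<in>Poly_Mapping.keys m. E (p ^ i) [^]\<^bsub>C\<^esub> Poly_Mapping.lookup m i)"

lemma \<mu>_superset:
  assumes "finite S" "Poly_Mapping.keys m \<subseteq> S"
  shows "\<mu> m = (\<Otimes>\<^bsub>C\<^esub>i\<in>S. E (p ^ i) [^]\<^bsub>C\<^esub> Poly_Mapping.lookup m i)"
  unfolding \<mu>_def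
  by (rule C.finprod_mono_neutral_cong_left) (use assms in \<open>auto simp: in_keys_iff E_closed\<close>)

lemma \<mu>_closed: "\<mu> m \<in> carrier C"
  unfolding \<mu>_def by (intro C.finprod_closed) (auto simp: E_closed)

lemma \<mu>_add: "\<mu> (m + m') = \<mu> m \<otimes>\<^bsub>C\<^esub> \<mu> m'"
proof -
  let ?S = "Poly_Mapping.keys m \<union> Poly_Mapping.keys m'"
  have "\<mu> (m + m') = (\<Otimes>\<^bsub>C\<^esub>i\<in>?S. E (p ^ i) [^]\<^bsub>C\<^esub> Poly_Mapping.lookup (m + m') i)"
    by (rule \<mu>_superset) (simp_all add: Poly_Mapping.keys_add)
  also have "\<dots> = (\<Otimes>\<^bsub>C\<^esub>i\<in>?S. E (p ^ i) [^]\<^bsub>C\<^esub> Poly_Mapping.lookup m i \<otimes>\<^bsub>C\<^esub> E (p ^ i) [^]\<^bsub>C\<^esub> Poly_Mapping.lookup m' i)"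
    by (rule C.finprod_cong') (auto simp: lookup_add C.nat_pow_mult E_closed)
  also have "\<dots> = (\<Otimes>\<^bsub>C\<^esub>i\<in>?S. E (p ^ i) [^]\<^bsub>C\<^esub> Poly_Mapping.lookup m i) \<otimes>\<^bsub>C\<^esub> (\<Otimes>\<^bsub>C\<^esub>i\<in>?S. E (p ^ i) [^]\<^bsub>C\<^esub> Poly_Mapping.lookup m' i)"
    by (rule C.finprod_multf) (auto simp: E_closed)
  also have "\<dots> = \<mu> m \<otimes>\<^bsub>C\<^esub> \<mu> m'" by (simp add: \<mu>_superset[symmetric])
  finally show ?thesis .
qed

lemma \<mu>_weight: "\<exists>\<gamma>. \<mu> m = \<gamma> \<odot>\<^bsub>C\<^esub> E (weight p m)"
proof -
  have "\<exists>\<gamma>. (\<Otimes>\<^bsub>C\<^esub>i\<in>K. E (p ^ i) [^]\<^bsub>C\<^esub> Poly_Mapping.lookup m i) = \<gamma> \<odot>\<^bsub>C\<^esub> E (\<Sum>i\<in>K. Poly_Mapping.lookup m i * p ^ i)"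
    if "finite K" for K
    using that
  proof (induction K rule: finite_induct)
    case empty
    have "(\<Otimes>\<^bsub>C\<^esub>i\<in>{}. E (p ^ i) [^]\<^bsub>C\<^esub> Poly_Mapping.lookup m i) = 1 \<odot>\<^bsub>C\<^esub> E (\<Sum>i\<in>{}. Poly_Mapping.lookup m i * p ^ i)"
      by (simp add: E_0)
    then show ?case ..
  next
    case (insert i K)
    let ?a = "Poly_Mapping.lookup m i * p ^ i" and ?b = "\<Sum>i\<in>K. Poly_Mapping.lookup m i * p ^ i"
    obtain \<gamma> where g: "(\<Otimes>\<^bsub>C\<^esub>i\<in>K. E (p ^ i) [^]\<^bsub>C\<^esub> Poly_Mapping.lookup m i) = \<gamma> \<odot>\<^bsub>C\<^esub> E ?b"
      using insert.IH by blast
    obtain \<delta> where d: "E (p ^ i) [^]\<^bsub>C\<^esub> Poly_Mapping.lookup m i = \<delta> \<odot>\<^bsub>C\<^esub> E ?a"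
      using E_pow by blast
    have "(\<Otimes>\<^bsub>C\<^esub>i\<in>insert i K. E (p ^ i) [^]\<^bsub>C\<^esub> Poly_Mapping.lookup m i) = (\<delta> \<odot>\<^bsub>C\<^esub> E ?a) \<otimes>\<^bsub>C\<^esub> (\<gamma> \<odot>\<^bsub>C\<^esub> E ?b)"
      using insert.hyps by (simp add: C.finprod_insert E_closed Pi_def g d)
    also have "\<dots> = (\<gamma> * (\<delta> * of_nat ((?a + ?b) choose ?a))) \<odot>\<^bsub>C\<^esub> E (?a + ?b)"
      by (simp add: C.smult_assoc2 C.smult_r C.smult_assoc1 E_closed E_mult)
    finally show ?case using insert.hyps by auto
  qed
  from this[of "Poly_Mapping.keys m"] show ?thesis by (simp add: \<mu>_def weight_def)
qed

text \<open>The factor that raises the exponent from \<open>k\<close> to \<open>k + 1\<close>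
  contributes \<open>((k + 1) * p ^ N + w) choose p ^ N\<close>. In the field this is
  \<open>k + 1\<close>, which is nonzero below \<open>p\<close>.\<close>

lemma E_times_pow:
  assumes "w < p ^ N" "k < p"
  shows "\<exists>\<gamma>. \<gamma> \<noteq> 0 \<and> E w \<otimes>\<^bsub>C\<^esub> E (p ^ N) [^]\<^bsub>C\<^esub> k = \<gamma> \<odot>\<^bsub>C\<^esub> E (w + k * p ^ N)"
  using assms(2)
proof (induction k)
  case 0
  have "E w \<otimes>\<^bsub>C\<^esub> E (p ^ N) [^]\<^bsub>C\<^esub> (0::nat) = 1 \<odot>\<^bsub>C\<^esub> E (w + 0 * p ^ N)" by (simp add: E_closed)
  then show ?case using one_neq_zero by blast
next
  case (Suc k)
  then obtain \<gamma> where g: "\<gamma> \<noteq> 0" "E w \<otimes>\<^bsub>C\<^esub> E (p ^ N) [^]\<^bsub>C\<^esub> k = \<gamma> \<odot>\<^bsub>C\<^esub> E (w + k * p ^ N)" by auto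
  let ?c = "of_nat ((w + k * p ^ N + p ^ N) choose (w + k * p ^ N)) :: 'f"
  have "((w + k * p ^ N + p ^ N) choose (w + k * p ^ N)) = ((Suc k * p ^ N + w) choose (p ^ N))"
    using binomial_symmetric[of "p ^ N" "Suc k * p ^ N + w"] by (simp add: algebra_simps)
  then have "?c = of_nat (Suc k)" using of_nat_choose_leading_digit[OF char_p prime_p assms(1)] by metis
  then have c: "?c \<noteq> 0" using char_p Suc.prems by (auto simp only: of_nat_eq_0_iff_char_dvd dest: dvd_imp_le)
  have "E w \<otimes>\<^bsub>C\<^esub> E (p ^ N) [^]\<^bsub>C\<^esub> Suc k = (\<gamma> \<odot>\<^bsub>C\<^esub> E (w + k * p ^ N)) \<otimes>\<^bsub>C\<^esub> E (p ^ N)"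
    by (simp add: E_closed C.m_assoc[symmetric] g(2))
  also have "\<dots> = (\<gamma> * ?c) \<odot>\<^bsub>C\<^esub> E (w + k * p ^ N + p ^ N)"
    by (simp add: C.smult_assoc2 E_closed E_mult C.smult_assoc1)
  also have "E (w + k * p ^ N + p ^ N) = E (w + Suc k * p ^ N)" by (simp add: algebra_simps)
  finally have "E w \<otimes>\<^bsub>C\<^esub> E (p ^ N) [^]\<^bsub>C\<^esub> Suc k = (\<gamma> * ?c) \<odot>\<^bsub>C\<^esub> E (w + Suc k * p ^ N)" .
  moreover have "\<gamma> * ?c \<noteq> 0" using c g(1) by simp
  ultimately show ?case by blast
qed

text \<open>Digits are added from the lowest upwards. The partial weight stays below
  \<open>p ^ N\<close>, so the next digit is always a leading one and no carry occurs.\<close>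

lemma \<mu>_reduced:
  assumes "\<And>i. Poly_Mapping.lookup m i < p"
  shows "\<exists>\<gamma>. \<gamma> \<noteq> 0 \<and> \<mu> m = \<gamma> \<odot>\<^bsub>C\<^esub> E (weight p m)"
proof -
  obtain N where N: "Poly_Mapping.keys m \<subseteq> {..<N}" using keys_bound by blast
  have "(\<Sum>i<N. Poly_Mapping.lookup m i * p ^ i) < p ^ N \<and>
    (\<exists>\<gamma>. \<gamma> \<noteq> 0 \<and> (\<Otimes>\<^bsub>C\<^esub>i\<in>{..<N}. E (p ^ i) [^]\<^bsub>C\<^esub> Poly_Mapping.lookup m i) = \<gamma> \<odot>\<^bsub>C\<^esub> E (\<Sum>i<N. Poly_Mapping.lookup m i * p ^ i))"
    for N
  proof (induction N)
    case 0
    have "(\<Otimes>\<^bsub>C\<^esub>i\<in>{..<0::nat}. E (p ^ i) [^]\<^bsub>C\<^esub> Poly_Mapping.lookup m i) = 1 \<odot>\<^bsub>C\<^esub> E (\<Sum>i<0. Poly_Mapping.lookup m i * p ^ i)"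
      by (simp add: E_0)
    moreover have "(\<Sum>i<0. Poly_Mapping.lookup m i * p ^ i) < p ^ 0" by simp
    ultimately show ?case using one_neq_zero by blast
  next
    case (Suc N)
    let ?w = "\<Sum>i<N. Poly_Mapping.lookup m i * p ^ i" and ?k = "Poly_Mapping.lookup m N"
    have lt: "?w < p ^ N" using Suc by simp
    obtain \<gamma> where g: "\<gamma> \<noteq> 0" "(\<Otimes>\<^bsub>C\<^esub>i\<in>{..<N}. E (p ^ i) [^]\<^bsub>C\<^esub> Poly_Mapping.lookup m i) = \<gamma> \<odot>\<^bsub>C\<^esub> E ?w"
      using Suc by blast
    obtain \<delta> where d: "\<delta> \<noteq> 0" "E ?w \<otimes>\<^bsub>C\<^esub> E (p ^ N) [^]\<^bsub>C\<^esub> ?k = \<delta> \<odot>\<^bsub>C\<^esub> E (?w + ?k * p ^ N)"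
      using E_times_pow[OF lt assms[of N]] by blast
    have "(\<Otimes>\<^bsub>C\<^esub>i\<in>{..<Suc N}. E (p ^ i) [^]\<^bsub>C\<^esub> Poly_Mapping.lookup m i) = E (p ^ N) [^]\<^bsub>C\<^esub> ?k \<otimes>\<^bsub>C\<^esub> (\<gamma> \<odot>\<^bsub>C\<^esub> E ?w)"
      unfolding lessThan_Suc by (subst C.finprod_insert) (auto simp: E_closed g(2))
    also have "\<dots> = \<gamma> \<odot>\<^bsub>C\<^esub> (E ?w \<otimes>\<^bsub>C\<^esub> E (p ^ N) [^]\<^bsub>C\<^esub> ?k)"
      using C.m_comm[of "E (p ^ N) [^]\<^bsub>C\<^esub> ?k" "E ?w"] by (simp add: C.smult_r E_closed)
    also have "\<dots> = (\<gamma> * \<delta>) \<odot>\<^bsub>C\<^esub> E (?w + ?k * p ^ N)"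
      unfolding d(2) by (simp add: C.smult_assoc1 E_closed)
    finally have eq: "(\<Otimes>\<^bsub>C\<^esub>i\<in>{..<Suc N}. E (p ^ i) [^]\<^bsub>C\<^esub> Poly_Mapping.lookup m i)
      = (\<gamma> * \<delta>) \<odot>\<^bsub>C\<^esub> E (\<Sum>i<Suc N. Poly_Mapping.lookup m i * p ^ i)" by simp
    have "?w + ?k * p ^ N < p ^ N + ?k * p ^ N" using lt by simp
    also have "\<dots> = Suc ?k * p ^ N" by simp
    also have "\<dots> \<le> p * p ^ N" using assms[of N] by (intro mult_le_mono1) simp
    finally have "(\<Sum>i<Suc N. Poly_Mapping.lookup m i * p ^ i) < p ^ Suc N" by simp
    moreover have "\<gamma> * \<delta> \<noteq> 0" using g(1) d(1) by simp
    ultimately show ?case using eq by blast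
  qed
  then show ?thesis by (simp add: \<mu>_superset[OF _ N] weight_eq_sum[OF N])
qed

lemma \<mu>_one: "\<mu> 0 = \<one>\<^bsub>C\<^esub>"
  by (simp add: \<mu>_def)

lemma \<mu>_ext_hom: "mext C \<mu> \<in> alg_hom poly_alg C"
  and \<mu>_ext_monomial: "mext C \<mu> (monomial m) = \<mu> m"
proof -
  note props = comm_monoid_exp C.comm_algebra_axioms
  show "mext C \<mu> \<in> alg_hom poly_alg C"
    unfolding poly_alg_eq by (rule mext_hom[OF props]) (simp_all add: \<mu>_closed \<mu>_add \<mu>_one)
  have "mext C \<mu> (Poly_Mapping.single m 1) = 1 \<odot>\<^bsub>C\<^esub> \<mu> m"
    by (rule mext_single[OF props]) (simp_all add: \<mu>_closed \<mu>_add \<mu>_one)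
  then show "mext C \<mu> (monomial m) = \<mu> m" by (simp add: monomial_def \<mu>_closed)
qed

text \<open>The \<open>p\<close>-th powers vanish by \<open>E_pow_p\<close> and the heavy monomials
  by \<open>E_big\<close>, so the map descends through both quotients. Nonzero multiples of
  \<open>E w\<close> suffice, as the scalars can be divided out.\<close>

lemma PW_hom:
  "\<exists>\<phi> \<in> alg_hom (PW_alg p n) C. \<forall>w. \<exists>\<gamma>. \<gamma> \<noteq> 0 \<and> \<phi> (PW_class p n (monomial (digits p w))) = \<gamma> \<odot>\<^bsub>C\<^esub> E w"
proof -
  have z: "mext C \<mu> f = \<zero>\<^bsub>C\<^esub>" if f: "f \<in> pow_ideal p" for f
  proof (rule genideal_in_kernel[OF comm_algebra_poly C.comm_algebra_axioms \<mu>_ext_hom])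
    show "mext C \<mu> s = \<zero>\<^bsub>C\<^esub>" if s: "s \<in> {pvar i ^ p | i. True}" for s
    proof -
      obtain i where "s = pvar i ^ p" using s by blast
      then have "mext C \<mu> s = \<mu> (Poly_Mapping.single i p)" by (simp add: pvar_power \<mu>_ext_monomial)
      also have "\<dots> = E (p ^ i) [^]\<^bsub>C\<^esub> p"
        by (subst \<mu>_superset[of "{i}"]) (auto simp: E_closed)
      also have "\<dots> = \<zero>\<^bsub>C\<^esub>" using p_gt_1 by (intro E_pow_p) simp
      finally show ?thesis .
    qed
    show "f \<in> genideal poly_alg {pvar i ^ p | i. True}" using f by (simp add: pow_ideal_def)
  qed (simp add: poly_alg_def)
  obtain k where k: "k \<in> alg_hom (P_alg p) C" "\<And>f. k (P_class p f) = mext C \<mu> f"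
    using quot_hom[OF comm_algebra_poly ideal_pow C.comm_algebra_axioms \<mu>_ext_hom z]
    unfolding P_alg_def P_class_def by (auto simp: poly_alg_def)
  have z': "k y = \<zero>\<^bsub>C\<^esub>" if y: "y \<in> W_ideal p n" for y
  proof (rule genideal_in_kernel[OF comm_algebra_P C.comm_algebra_axioms k(1) W_gens_closed])
    show "k s = \<zero>\<^bsub>C\<^esub>" if s: "s \<in> {P_class p (monomial m) | m. weight p m > n}" for s
    proof -
      obtain m where m: "s = P_class p (monomial m)" "weight p m > n" using s by blast
      obtain \<gamma> where "\<mu> m = \<gamma> \<odot>\<^bsub>C\<^esub> E (weight p m)" using \<mu>_weight by blast
      then show ?thesis using m by (simp add: k(2) \<mu>_ext_monomial E_big)
    qed
    show "y \<in> genideal (P_alg p) {P_class p (monomial m) | m. weight p m > n}"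
      using y by (simp add: W_ideal_eq)
  qed
  obtain \<phi> where \<phi>: "\<phi> \<in> alg_hom (PW_alg p n) C" "\<And>y. y \<in> carrier (P_alg p) \<Longrightarrow> \<phi> (W_ideal p n +>\<^bsub>P_alg p\<^esub> y) = k y"
    using quot_hom[OF comm_algebra_P ideal_W C.comm_algebra_axioms k(1) z'] unfolding PW_alg_def by blast
  have "\<exists>\<gamma>. \<gamma> \<noteq> 0 \<and> \<phi> (PW_class p n (monomial (digits p w))) = \<gamma> \<odot>\<^bsub>C\<^esub> E w" for w
  proof -
    have "\<phi> (PW_class p n (monomial (digits p w))) = \<mu> (digits p w)"
      unfolding PW_class_def by (simp add: \<phi>(2) P_class_closed k(2) \<mu>_ext_monomial)
    moreover have "Poly_Mapping.lookup (digits p w) i < p" for i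
      using p_gt_1 by (simp add: lookup_digits)
    then obtain \<gamma> where "\<gamma> \<noteq> 0" "\<mu> (digits p w) = \<gamma> \<odot>\<^bsub>C\<^esub> E (weight p (digits p w))"
      using \<mu>_reduced by blast
    ultimately show ?thesis by (auto simp: weight_digits[OF p_gt_1])
  qed
  with \<phi>(1) show ?thesis by blast
qed

end

section \<open>The dual polar algebra\<close>

locale dual_polar = symplectic_space B d Q
  for B :: "'k::{field,finite} ^ 'n \<Rightarrow> 'k ^ 'n \<Rightarrow> 'k" and d :: nat and Q :: int +
  fixes C :: "('f::field, ('k ^ 'n) set \<Rightarrow> ('k ^ 'n) set \<Rightarrow> 'f) module" and q :: 'f
  assumes C_eq: "C = dual_polar_algebra B d" and q_eq: "q = of_int Q" and d_pos: "d > 0"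
begin

text \<open>The matrices of the adjacency algebra, indexed by the intersection dimension
  \<open>j = d - i\<close> instead of the relation index \<open>i\<close>.\<close>

definition fm :: "(nat \<Rightarrow> 'f) \<Rightarrow> ('k ^ 'n) set \<Rightarrow> ('k ^ 'n) set \<Rightarrow> 'f" where
  "fm g x y = (if x \<in> X \<and> y \<in> X then g (vec.dim (x \<inter> y)) else 0)"

lemma fm_sym: "fm g x y = fm g y x"
  by (simp add: fm_def Int_commute)

lemma fm_eqI: "(\<And>j. j \<le> d \<Longrightarrow> g j = g' j) \<Longrightarrow> fm g = fm g'"
  by (auto simp: fm_def fun_eq_iff dim_Int_X_le)

lemma fm_eq_zeroD:
  assumes "fm g = (\<lambda>x y. 0)" "j \<le> d"
  shows "g j = 0"
proof -
  obtain x y where "x \<in> X" "y \<in> X" "vec.dim (x \<inter> y) = j" using ex_dim_Int[OF assms(2)] by blast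
  then show ?thesis using fun_cong[OF fun_cong[OF assms(1)], of x y] by (simp add: fm_def)
qed

lemma carrier_C: "carrier C = range fm"
proof -
  have eq: "(\<lambda>x y. \<Sum>i\<le>d. c i * adjacency_matrix (dual_polar_rel B d i) x y) = fm (\<lambda>j. c (d - j))"
    for c :: "nat \<Rightarrow> 'f"
  proof (intro ext)
    fix x y
    show "(\<Sum>i\<le>d. c i * adjacency_matrix (dual_polar_rel B d i) x y) = fm (\<lambda>j. c (d - j)) x y"
    proof (cases "x \<in> X \<and> y \<in> X")
      case True
      then have le: "vec.dim (x \<inter> y) \<le> d" using dim_Int_X_le by blast
      have "(\<Sum>i\<le>d. c i * adjacency_matrix (dual_polar_rel B d i) x y)
          = (\<Sum>i\<le>d. if i = d - vec.dim (x \<inter> y) then c i else 0)"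
        using True le by (intro sum.cong) (auto simp: adjacency_matrix_def dual_polar_rel_def)
      also have "\<dots> = fm (\<lambda>j. c (d - j)) x y" using True by (simp add: fm_def)
      finally show ?thesis .
    qed (auto simp: fm_def adjacency_matrix_def dual_polar_rel_def)
  qed
  have "range fm \<subseteq> range (\<lambda>c. fm (\<lambda>j. c (d - j)))"
  proof
    fix M assume "M \<in> range fm"
    then obtain g where "M = fm g" by blast
    also have "\<dots> = fm (\<lambda>j. (\<lambda>i. g (d - i)) (d - j))" by (rule fm_eqI) simp
    finally show "M \<in> range (\<lambda>c. fm (\<lambda>j. c (d - j)))" by (rule range_eqI[of _ _ "\<lambda>i. g (d - i)"])
  qed
  then have "range (\<lambda>c. fm (\<lambda>j. c (d - j))) = range fm" by blast
  then show ?thesis unfolding C_eq dual_polar_algebra_def adjacency_algebra_def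
    by (simp add: eq full_SetCompr_eq)
qed

lemma C_simps:
  "M \<otimes>\<^bsub>C\<^esub> N = (\<lambda>x y. \<Sum>z\<in>X. M x z * N z y)"
  "\<one>\<^bsub>C\<^esub> = (\<lambda>x y. if x \<in> X \<and> x = y then 1 else 0)"
  "\<zero>\<^bsub>C\<^esub> = (\<lambda>x y. 0)"
  "M \<oplus>\<^bsub>C\<^esub> N = (\<lambda>x y. M x y + N x y)"
  "c \<odot>\<^bsub>C\<^esub> M = (\<lambda>x y. c * M x y)"
  by (simp_all add: C_eq dual_polar_algebra_def adjacency_algebra_def)

section \<open>The basis over the field\<close>

definition b :: "nat \<Rightarrow> ('k ^ 'n) set \<Rightarrow> ('k ^ 'n) set \<Rightarrow> 'f" where
  "b k = fm (\<lambda>j. gbinom q j (d - k))"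

lemma b_closed: "b k \<in> carrier C"
  by (simp add: b_def carrier_C)

lemma b_of_int: "k \<le> d \<Longrightarrow> x \<in> X \<Longrightarrow> y \<in> X \<Longrightarrow> b k x y = of_int (b_int k x y)"
  by (simp add: b_def fm_def b_int_def of_int_gbinom flip: q_eq)

lemma sum_b: "(\<lambda>x y. \<Sum>m\<le>d. c m * b m x y) = fm (\<lambda>j. \<Sum>e\<le>j. c (d - e) * gbinom q j e)"
proof (intro ext)
  fix x y
  show "(\<Sum>m\<le>d. c m * b m x y) = fm (\<lambda>j. \<Sum>e\<le>j. c (d - e) * gbinom q j e) x y"
  proof (cases "x \<in> X \<and> y \<in> X")
    case True
    define j where "j = vec.dim (x \<inter> y)"
    have j: "j \<le> d" using True dim_Int_X_le by (simp add: j_def)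
    have "(\<Sum>m\<le>d. c m * b m x y) = (\<Sum>m\<le>d. c m * gbinom q j (d - m))"
      using True by (simp add: b_def fm_def j_def)
    also have "\<dots> = (\<Sum>e\<le>d. c (d - e) * gbinom q j e)"
      by (rule sum.reindex_bij_witness[of _ "\<lambda>e. d - e" "\<lambda>e. d - e"]) auto
    also have "\<dots> = (\<Sum>e\<le>j. c (d - e) * gbinom q j e)"
      using j by (intro sum.mono_neutral_right) (auto simp: gbinom_eq_0)
    finally show ?thesis using True by (simp add: fm_def j_def)
  qed (auto simp: fm_def b_def)
qed

text \<open>The Gaussian coefficients \<open>gbinom q j e\<close> form a triangular matrix with ones
  on the diagonal, and every \<open>j \<le> d\<close> is realised by a pair of subspaces.\<close>

lemma b_indep:
  assumes "(\<lambda>x y. \<Sum>m\<le>d. c m * b m x y) = (\<lambda>x y. 0)" "m \<le> d"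
  shows "c m = 0"
proof -
  have z: "(\<Sum>e\<le>j. c (d - e) * gbinom q j e) = 0" if "j \<le> d" for j
    using fm_eq_zeroD[OF assms(1)[unfolded sum_b] that] .
  have "c (d - j) = 0" if "j \<le> d" for j
    using that
  proof (induction j rule: less_induct)
    case (less j)
    have "(\<Sum>e\<le>j. c (d - e) * gbinom q j e) = (\<Sum>e\<in>{j}. c (d - e) * gbinom q j e)"
      using less by (intro sum.mono_neutral_right) auto
    then show ?case using z[OF less.prems] by simp
  qed
  from this[of "d - m"] show ?thesis using assms(2) by simp
qed

lemma b_gen:
  assumes "M \<in> carrier C"
  shows "\<exists>c. M = (\<lambda>x y. \<Sum>m\<le>d. c m * b m x y)"
proof -
  obtain g where g: "M = fm g" using assms by (auto simp: carrier_C)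
  \<comment> \<open>Forward substitution in the unitriangular system: the equation for
    \<open>j = n\<close> fixes \<open>h n\<close> and leaves the earlier ones untouched.\<close>
  have "\<exists>h. \<forall>j<n. (\<Sum>e\<le>j. h e * gbinom q j e) = g j" for n
  proof (induction n)
    case (Suc n)
    then obtain h where h: "\<forall>j<n. (\<Sum>e\<le>j. h e * gbinom q j e) = g j" by blast
    let ?h = "h(n := g n - (\<Sum>e<n. h e * gbinom q n e))"
    have "(\<Sum>e\<le>j. ?h e * gbinom q j e) = g j" if "j < Suc n" for j
    proof (cases "j = n")
      case True
      have "(\<Sum>e<n. ?h e * gbinom q n e) = (\<Sum>e<n. h e * gbinom q n e)" by (intro sum.cong) auto
      then show ?thesis using True by (simp add: lessThan_Suc_atMost[symmetric])
    next
      case False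
      then have "(\<Sum>e\<le>j. ?h e * gbinom q j e) = (\<Sum>e\<le>j. h e * gbinom q j e)"
        using that by (intro sum.cong) auto
      then show ?thesis using h that False by simp
    qed
    then show ?case by blast
  qed simp
  then obtain h where h: "\<forall>j<Suc d. (\<Sum>e\<le>j. h e * gbinom q j e) = g j" by blast
  have "M = fm (\<lambda>j. \<Sum>e\<le>j. h (d - (d - e)) * gbinom q j e)"
    unfolding g
  proof (rule fm_eqI)
    fix j assume j: "j \<le> d"
    then have "(\<Sum>e\<le>j. h (d - (d - e)) * gbinom q j e) = (\<Sum>e\<le>j. h e * gbinom q j e)"
      by (intro sum.cong) simp_all
    then show "g j = (\<Sum>e\<le>j. h (d - (d - e)) * gbinom q j e)" using h j by simp
  qed
  also have "\<dots> = (\<lambda>x y. \<Sum>m\<le>d. h (d - m) * b m x y)"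
    by (rule sum_b[symmetric])
  finally show ?thesis by (rule exI[of _ "\<lambda>m. h (d - m)"])
qed

lemma sum_b_closed: "(\<lambda>x y. \<Sum>m\<le>d. c m * b m x y) \<in> carrier C"
  by (simp add: sum_b carrier_C)

lemma b_mult:
  assumes "k \<le> d" "l \<le> d"
  shows "b k \<otimes>\<^bsub>C\<^esub> b l = (\<lambda>x y. \<Sum>m\<le>d. lin_coeff q d k l m * b m x y)"
proof (intro ext)
  fix x y
  show "(b k \<otimes>\<^bsub>C\<^esub> b l) x y = (\<Sum>m\<le>d. lin_coeff q d k l m * b m x y)"
  proof (cases "x \<in> X \<and> y \<in> X")
    case True
    then have x: "x \<in> X" and y: "y \<in> X" by auto
    have "(b k \<otimes>\<^bsub>C\<^esub> b l) x y = of_int (\<Sum>z\<in>X. b_int k x z * b_int l z y)"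
      using assms x y by (simp add: C_simps b_of_int)
    also have "\<dots> = of_int (\<Sum>m\<le>d. lin_coeff Q d k l m * b_int m x y)"
      using b_int_mult[OF d_pos assms x y] by simp
    also have "\<dots> = (\<Sum>m\<le>d. lin_coeff q d k l m * b m x y)"
      using x y by (simp add: of_int_lin_coeff b_of_int flip: q_eq)
    finally show ?thesis .
  qed (auto simp: C_simps b_def fm_def)
qed

lemma mult_sum_b:
  "(\<lambda>x y. \<Sum>k\<le>d. c k * b k x y) \<otimes>\<^bsub>C\<^esub> (\<lambda>x y. \<Sum>l\<le>d. c' l * b l x y) =
    (\<lambda>x y. \<Sum>m\<le>d. (\<Sum>k\<le>d. \<Sum>l\<le>d. c k * c' l * lin_coeff q d k l m) * b m x y)"
proof (intro ext)
  fix x y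
  have "((\<lambda>x y. \<Sum>k\<le>d. c k * b k x y) \<otimes>\<^bsub>C\<^esub> (\<lambda>x y. \<Sum>l\<le>d. c' l * b l x y)) x y
    = (\<Sum>z\<in>X. \<Sum>k\<le>d. \<Sum>l\<le>d. c k * c' l * (b k x z * b l z y))"
    by (simp add: C_simps sum_product algebra_simps)
  also have "\<dots> = (\<Sum>k\<le>d. \<Sum>z\<in>X. \<Sum>l\<le>d. c k * c' l * (b k x z * b l z y))"
    by (rule sum.swap)
  also have "\<dots> = (\<Sum>k\<le>d. \<Sum>l\<le>d. \<Sum>z\<in>X. c k * c' l * (b k x z * b l z y))"
    by (intro sum.cong[OF refl] sum.swap)
  also have "\<dots> = (\<Sum>k\<le>d. \<Sum>l\<le>d. c k * c' l * (b k \<otimes>\<^bsub>C\<^esub> b l) x y)"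
    by (simp add: C_simps sum_distrib_left)
  also have "\<dots> = (\<Sum>k\<le>d. \<Sum>l\<le>d. \<Sum>m\<le>d. c k * c' l * lin_coeff q d k l m * b m x y)"
    by (intro sum.cong[OF refl]) (simp add: b_mult sum_distrib_left mult.assoc)
  also have "\<dots> = (\<Sum>k\<le>d. \<Sum>m\<le>d. \<Sum>l\<le>d. c k * c' l * lin_coeff q d k l m * b m x y)"
    by (intro sum.cong[OF refl] sum.swap)
  also have "\<dots> = (\<Sum>m\<le>d. \<Sum>k\<le>d. \<Sum>l\<le>d. c k * c' l * lin_coeff q d k l m * b m x y)"
    by (rule sum.swap)
  also have "\<dots> = (\<Sum>m\<le>d. (\<Sum>k\<le>d. \<Sum>l\<le>d. c k * c' l * lin_coeff q d k l m) * b m x y)"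
    by (simp add: sum_distrib_right)
  finally show "((\<lambda>x y. \<Sum>k\<le>d. c k * b k x y) \<otimes>\<^bsub>C\<^esub> (\<lambda>x y. \<Sum>l\<le>d. c' l * b l x y)) x y =
    (\<Sum>m\<le>d. (\<Sum>k\<le>d. \<Sum>l\<le>d. c k * c' l * lin_coeff q d k l m) * b m x y)" .
qed

lemma mult_closed:
  assumes "M \<in> carrier C" "N \<in> carrier C"
  shows "M \<otimes>\<^bsub>C\<^esub> N \<in> carrier C"
proof -
  obtain c c' where "M = (\<lambda>x y. \<Sum>m\<le>d. c m * b m x y)" "N = (\<lambda>x y. \<Sum>m\<le>d. c' m * b m x y)"
    using b_gen assms by meson
  then show ?thesis by (simp only: mult_sum_b sum_b_closed)
qed

text \<open>All matrices of the algebra are symmetric, products included, and transposing a product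
  interchanges its factors.\<close>

lemma mult_comm:
  assumes "M \<in> carrier C" "N \<in> carrier C"
  shows "M \<otimes>\<^bsub>C\<^esub> N = N \<otimes>\<^bsub>C\<^esub> M"
proof (intro ext)
  fix x y
  have sym: "L x y = L y x" if "L \<in> carrier C" for L x y
    using that fm_sym by (auto simp: carrier_C)
  have "(M \<otimes>\<^bsub>C\<^esub> N) x y = (M \<otimes>\<^bsub>C\<^esub> N) y x" by (rule sym[OF mult_closed[OF assms]])
  also have "\<dots> = (\<Sum>z\<in>X. M y z * N z x)" by (simp add: C_simps)
  also have "\<dots> = (\<Sum>z\<in>X. N x z * M z y)"
    by (intro sum.cong[OF refl]) (simp add: sym[OF assms(1), of y] sym[OF assms(2), of _ x] mult.commute)
  finally show "(M \<otimes>\<^bsub>C\<^esub> N) x y = (N \<otimes>\<^bsub>C\<^esub> M) x y" by (simp add: C_simps)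
qed

lemma b_0: "b 0 = \<one>\<^bsub>C\<^esub>"
proof (intro ext)
  fix x y
  show "b 0 x y = \<one>\<^bsub>C\<^esub> x y"
    using dim_Int_X_eq[of x y] dim_Int_X_le[of x y] dim_X[of x]
    by (auto simp: b_def fm_def C_simps gbinom_eq_0)
qed

lemma fm_add: "fm g \<oplus>\<^bsub>C\<^esub> fm g' = fm (\<lambda>j. g j + g' j)"
  and fm_smult: "c \<odot>\<^bsub>C\<^esub> fm g = fm (\<lambda>j. c * g j)"
  and fm_zero: "\<zero>\<^bsub>C\<^esub> = fm (\<lambda>_. 0)"
  by (simp_all add: C_simps fm_def fun_eq_iff)

lemma add_closed: "M \<in> carrier C \<Longrightarrow> N \<in> carrier C \<Longrightarrow> M \<oplus>\<^bsub>C\<^esub> N \<in> carrier C"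
  by (auto simp: carrier_C fm_add)

lemma smult_closed: "M \<in> carrier C \<Longrightarrow> c \<odot>\<^bsub>C\<^esub> M \<in> carrier C"
  by (auto simp: carrier_C fm_smult)

lemma zero_closed: "\<zero>\<^bsub>C\<^esub> \<in> carrier C"
  by (simp add: carrier_C fm_zero)

lemma mult_assoc: "(L \<otimes>\<^bsub>C\<^esub> M) \<otimes>\<^bsub>C\<^esub> N = L \<otimes>\<^bsub>C\<^esub> (M \<otimes>\<^bsub>C\<^esub> N)"
proof (intro ext)
  fix x y
  have "((L \<otimes>\<^bsub>C\<^esub> M) \<otimes>\<^bsub>C\<^esub> N) x y = (\<Sum>z\<in>X. \<Sum>w\<in>X. L x w * M w z * N z y)"
    by (simp add: C_simps sum_distrib_right)
  also have "\<dots> = (\<Sum>w\<in>X. \<Sum>z\<in>X. L x w * M w z * N z y)" by (rule sum.swap)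
  also have "\<dots> = (L \<otimes>\<^bsub>C\<^esub> (M \<otimes>\<^bsub>C\<^esub> N)) x y" by (simp add: C_simps sum_distrib_left mult.assoc)
  finally show "((L \<otimes>\<^bsub>C\<^esub> M) \<otimes>\<^bsub>C\<^esub> N) x y = (L \<otimes>\<^bsub>C\<^esub> (M \<otimes>\<^bsub>C\<^esub> N)) x y" .
qed

lemma mult_one: "M \<in> carrier C \<Longrightarrow> \<one>\<^bsub>C\<^esub> \<otimes>\<^bsub>C\<^esub> M = M"
proof (intro ext)
  fix x y assume "M \<in> carrier C"
  then obtain g where g: "M = fm g" by (auto simp: carrier_C)
  have "(\<one>\<^bsub>C\<^esub> \<otimes>\<^bsub>C\<^esub> M) x y = (\<Sum>z\<in>X. if x = z then M x y else 0)"
    unfolding C_simps by (intro sum.cong) auto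
  also have "\<dots> = M x y" by (simp add: g fm_def)
  finally show "(\<one>\<^bsub>C\<^esub> \<otimes>\<^bsub>C\<^esub> M) x y = M x y" .
qed

sublocale C: comm_algebra C
proof -
  interpret cring C
  proof (rule cringI)
    show "abelian_group C"
    proof (rule abelian_groupI)
      show "\<exists>N\<in>carrier C. N \<oplus>\<^bsub>C\<^esub> M = \<zero>\<^bsub>C\<^esub>" if "M \<in> carrier C" for M
        using smult_closed[OF that, of "- 1"] by (intro bexI) (auto simp: C_simps)
    qed (auto simp: add_closed zero_closed, auto simp: C_simps algebra_simps)
    show "Group.comm_monoid C"
      by (rule comm_monoidI) (use b_closed[of 0] in \<open>auto simp: mult_closed b_0 mult_assoc mult_one intro: mult_comm\<close>)
  qed (simp add: C_simps algebra_simps sum.distrib)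
  show "comm_algebra C"
    by unfold_locales
      (auto simp: smult_closed, auto simp: C_simps algebra_simps sum_distrib_left)
qed

lemma finsum_C:
  assumes "finite K" "\<And>k. k \<in> K \<Longrightarrow> f k \<in> carrier C"
  shows "(\<Oplus>\<^bsub>C\<^esub>k\<in>K. f k) = (\<lambda>x y. \<Sum>k\<in>K. f k x y)"
  using assms
proof (induction K rule: finite_induct)
  case empty
  show ?case by (simp add: C_simps)
next
  case (insert k K)
  then have "(\<Oplus>\<^bsub>C\<^esub>k\<in>insert k K. f k) = f k \<oplus>\<^bsub>C\<^esub> (\<Oplus>\<^bsub>C\<^esub>k\<in>K. f k)"
    by (intro C.finsum_insert) auto
  then show ?case using insert by (simp add: C_simps)
qed

text \<open>\<open>b 1\<close> is \<open>A\<^sub>1\<close> plus the scalar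
  \<open>qint q d = - t_eig q d 0\<close>, so \<open>s l\<close> is the diagonal entry at
  \<open>b l\<close> of multiplication by \<open>b 1\<close>.\<close>

definition s :: "nat \<Rightarrow> 'f" where "s l = t_eig q d l - t_eig q d 0"

lemma b_neq_zero: "k \<le> d \<Longrightarrow> b k \<noteq> \<zero>\<^bsub>C\<^esub>"
proof
  assume k: "k \<le> d" "b k = \<zero>\<^bsub>C\<^esub>"
  have "(\<lambda>x y. \<Sum>m\<le>d. (if m = k then 1 else 0) * b m x y) = b k"
    using k(1) by (simp add: if_distrib[of "\<lambda>c. c * _"] cong: if_cong)
  then have "(1 :: 'f) = 0" using b_indep[of "\<lambda>m. if m = k then 1 else 0" k] k by (simp add: C_simps)
  then show False by simp
qed

lemma b_1_mult:
  assumes "l \<le> d"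
  shows "b 1 \<otimes>\<^bsub>C\<^esub> b l = (if l < d then qint q (Suc l) \<odot>\<^bsub>C\<^esub> b (Suc l) else \<zero>\<^bsub>C\<^esub>) \<oplus>\<^bsub>C\<^esub> s l \<odot>\<^bsub>C\<^esub> b l"
proof (intro ext)
  fix x y
  have c: "lin_coeff q d 1 l m = (if m = Suc l then qint q m else 0) + (if m = l then s l else 0)" if "m \<le> d" for m
    using lin_coeff_Suc[OF that, of q 0 l] by (cases m) (auto simp: lin_coeff_0 s_def)
  have "(b 1 \<otimes>\<^bsub>C\<^esub> b l) x y = (\<Sum>m\<le>d. ((if m = Suc l then qint q m else 0) + (if m = l then s l else 0)) * b m x y)"
    unfolding b_mult[OF d_pos[unfolded Suc_le_eq[symmetric], folded One_nat_def] assms]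
    by (intro sum.cong) (simp_all only: c atMost_iff)
  also have "\<dots> = (\<Sum>m\<le>d. if m = Suc l then qint q m * b m x y else 0) + (\<Sum>m\<le>d. if m = l then s l * b m x y else 0)"
    unfolding sum.distrib[symmetric] by (intro sum.cong) (auto simp: algebra_simps)
  also have "\<dots> = (if l < d then qint q (Suc l) * b (Suc l) x y else 0) + s l * b l x y"
    using assms by simp
  finally show "(b 1 \<otimes>\<^bsub>C\<^esub> b l) x y = ((if l < d then qint q (Suc l) \<odot>\<^bsub>C\<^esub> b (Suc l) else \<zero>\<^bsub>C\<^esub>) \<oplus>\<^bsub>C\<^esub> s l \<odot>\<^bsub>C\<^esub> b l) x y"
    by (simp add: C_simps)
qed

text \<open>If \<open>s l\<close> differed from \<open>s d\<close>, then \<open>b 1 - s l\<close> would be a unit of the local algebra, so \<open>b l\<close>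
  would lie in the ideal generated by \<open>b (l + 1)\<close>, which is contained in the span of
  \<open>b (l + 1), \<dots>, b d\<close>.\<close>

lemma local_imp_s_eq:
  assumes loc: "local_algebra C" and l: "l < d"
  shows "s l = s d"
proof (rule ccontr)
  assume ne: "s l \<noteq> s d"
  define u where "u = (\<lambda>l. b 1 \<oplus>\<^bsub>C\<^esub> (- s l) \<odot>\<^bsub>C\<^esub> \<one>\<^bsub>C\<^esub>)"
  have u_closed: "u l \<in> carrier C" for l by (simp add: u_def b_closed)
  have u_mult: "u l \<otimes>\<^bsub>C\<^esub> b l = (if l < d then qint q (Suc l) \<odot>\<^bsub>C\<^esub> b (Suc l) else \<zero>\<^bsub>C\<^esub>)" if "l \<le> d" for l
  proof -
    have "u l \<otimes>\<^bsub>C\<^esub> b l = b 1 \<otimes>\<^bsub>C\<^esub> b l \<oplus>\<^bsub>C\<^esub> (- s l) \<odot>\<^bsub>C\<^esub> b l"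
      by (simp add: u_def C.l_distr b_closed C.smult_assoc2)
    also have "\<dots> = (if l < d then qint q (Suc l) \<odot>\<^bsub>C\<^esub> b (Suc l) else \<zero>\<^bsub>C\<^esub>)"
      unfolding b_1_mult[OF that] by (simp add: C_simps fun_eq_iff)
    finally show ?thesis .
  qed
  have unit_cancel: "v = inv\<^bsub>C\<^esub> w \<otimes>\<^bsub>C\<^esub> (w \<otimes>\<^bsub>C\<^esub> v)" if w: "w \<in> Units C" and v: "v \<in> carrier C" for v w
  proof -
    have "inv\<^bsub>C\<^esub> w \<otimes>\<^bsub>C\<^esub> (w \<otimes>\<^bsub>C\<^esub> v) = (inv\<^bsub>C\<^esub> w \<otimes>\<^bsub>C\<^esub> w) \<otimes>\<^bsub>C\<^esub> v"
      using w v by (intro C.m_assoc[symmetric]) auto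
    then show ?thesis using w v by simp
  qed
  have nonunit_d: "u d \<notin> Units C"
  proof
    assume u: "u d \<in> Units C"
    have "b d = inv\<^bsub>C\<^esub> (u d) \<otimes>\<^bsub>C\<^esub> (u d \<otimes>\<^bsub>C\<^esub> b d)"
      by (rule unit_cancel[OF u b_closed])
    also have "\<dots> = \<zero>\<^bsub>C\<^esub>" using u u_mult[of d] by simp
    finally show False using b_neq_zero by simp
  qed
  have unit_l: "u l \<in> Units C"
  proof (rule ccontr)
    assume "u l \<notin> Units C"
    then have "u l \<oplus>\<^bsub>C\<^esub> (- 1) \<odot>\<^bsub>C\<^esub> u d \<notin> Units C"
      using local_algebra_nonunits[OF C.comm_algebra_axioms loc] u_closed nonunit_d by blast
    moreover have "u l \<oplus>\<^bsub>C\<^esub> (- 1) \<odot>\<^bsub>C\<^esub> u d = (s d - s l) \<odot>\<^bsub>C\<^esub> \<one>\<^bsub>C\<^esub>"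
      by (simp add: u_def C_simps fun_eq_iff algebra_simps)
    moreover have "(s d - s l) \<odot>\<^bsub>C\<^esub> \<one>\<^bsub>C\<^esub> \<in> Units C"
    proof -
      have "(inverse (s d - s l) \<odot>\<^bsub>C\<^esub> \<one>\<^bsub>C\<^esub>) \<otimes>\<^bsub>C\<^esub> ((s d - s l) \<odot>\<^bsub>C\<^esub> \<one>\<^bsub>C\<^esub>) = \<one>\<^bsub>C\<^esub>"
        using ne by (simp add: C.smult_assoc2 flip: C.smult_assoc1)
      then show ?thesis
        using C.m_comm[of "inverse (s d - s l) \<odot>\<^bsub>C\<^esub> \<one>\<^bsub>C\<^esub>" "(s d - s l) \<odot>\<^bsub>C\<^esub> \<one>\<^bsub>C\<^esub>"]
        unfolding Units_def by auto
    qed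
    ultimately show False by simp
  qed
  define v where "v = qint q (Suc l) \<odot>\<^bsub>C\<^esub> inv\<^bsub>C\<^esub> (u l)"
  have v: "v \<in> carrier C" using unit_l by (simp add: v_def)
  have "b l = inv\<^bsub>C\<^esub> (u l) \<otimes>\<^bsub>C\<^esub> (u l \<otimes>\<^bsub>C\<^esub> b l)"
    by (rule unit_cancel[OF unit_l b_closed])
  also have "\<dots> = v \<otimes>\<^bsub>C\<^esub> b (Suc l)"
    using unit_l l u_mult[of l] by (simp add: v_def C.smult_r C.smult_assoc2 b_closed)
  also have "\<dots> = b (Suc l) \<otimes>\<^bsub>C\<^esub> v" by (rule mult_comm[OF v b_closed])
  finally have bl: "b l = b (Suc l) \<otimes>\<^bsub>C\<^esub> v" .
  obtain c where c: "v = (\<lambda>x y. \<Sum>m\<le>d. c m * b m x y)" using b_gen[OF v] by blast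
  define \<delta> where "\<delta> k m = (if m = k then 1 else 0 :: 'f)" for k m :: nat
  have db: "(\<lambda>x y. \<Sum>m\<le>d. \<delta> k m * b m x y) = b k" if "k \<le> d" for k
    using that by (simp add: \<delta>_def if_distrib[of "\<lambda>c. c * _"] cong: if_cong)
  define r where "r m = (\<Sum>k\<le>d. \<Sum>i\<le>d. \<delta> (Suc l) k * c i * lin_coeff q d k i m)" for m
  have "b (Suc l) \<otimes>\<^bsub>C\<^esub> v = (\<lambda>x y. \<Sum>m\<le>d. r m * b m x y)"
    using mult_sum_b[of "\<delta> (Suc l)" c] db[of "Suc l"] l unfolding c r_def by simp
  then have "(\<lambda>x y. \<Sum>m\<le>d. \<delta> l m * b m x y) = (\<lambda>x y. \<Sum>m\<le>d. r m * b m x y)"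
    using bl db[of l] l by simp
  then have "(\<lambda>x y. \<Sum>m\<le>d. (\<delta> l m - r m) * b m x y) = (\<lambda>x y. 0)"
    by (simp add: fun_eq_iff left_diff_distrib sum_subtractf)
  then have "\<delta> l l - r l = 0" using b_indep[of "\<lambda>m. \<delta> l m - r m" l] l by simp
  \<comment> \<open>The coefficient of \<open>b l\<close> in any product with
    \<open>b (Suc l)\<close> contains \<open>gbinom q l (Suc l) = 0\<close>.\<close>
  moreover have "r l = 0"
    unfolding r_def by (intro sum.neutral ballI) (auto simp: \<delta>_def lin_coeff_def gbinom_eq_0)
  ultimately show False by (simp add: \<delta>_def)
qed

text \<open>The common value of the \<open>s l\<close> is \<open>s 0 = 0\<close>. Then
  \<open>l = 1\<close> gives \<open>q ^ (d - 1) = - q\<close>, which settles \<open>d = 1\<close>.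
  For \<open>d \<ge> 3\<close> the case \<open>l = 2\<close> leaves \<open>q = - 1\<close> or
  \<open>q ^ (d - 2) = - q\<close>; the latter implies \<open>q ^ 2 = q\<close>, hence
  \<open>q = 1\<close>, and \<open>l = 1\<close> becomes \<open>2 = 0\<close>.\<close>

lemma local_imp_q_minus_one:
  assumes loc: "local_algebra C" and q0: "q \<noteq> 0" and two: "(2 :: 'f) \<noteq> 0" and d: "odd d"
  shows "q = - 1"
proof -
  have s: "s l = qint q l * (q ^ (d - l) + q)" if "l \<le> d" for l
    using t_eig_diff[of 0 l d q] that by (simp add: s_def)
  have z: "s l = 0" if "l \<le> d" for l
    using local_imp_s_eq[OF loc, of l] local_imp_s_eq[OF loc, of 0] s[of 0] d_pos that by (cases "l = d") auto
  have 1: "q ^ (d - 1) + q = 0" using s[of 1] z[of 1] d_pos by simp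
  show ?thesis
  proof (cases "d = 1")
    case True
    then show ?thesis using 1 by (simp add: eq_neg_iff_add_eq_0 add.commute)
  next
    case False
    then have d3: "d \<ge> 3" using d d_pos by (cases d) (auto elim!: oddE)
    have "(1 + q) * (q ^ (d - 2) + q) = 0"
      using s[of 2] z[of 2] d3 by (simp add: qint_def numeral_2_eq_2)
    then consider "1 + q = 0" | "q ^ (d - 2) + q = 0" by auto
    then show ?thesis
    proof cases
      case 1
      then show ?thesis by (simp add: eq_neg_iff_add_eq_0 add.commute)
    next
      case 2
      have "d - 1 = Suc (d - 2)" using d3 by simp
      then have "q * q ^ (d - 2) + q = 0" using 1 by simp
      moreover have "q ^ (d - 2) = - q" using 2 by (simp add: eq_neg_iff_add_eq_0)
      ultimately have "q * (1 - q) = 0" by (simp add: algebra_simps)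
      then have "q = 1" using q0 by simp
      then show ?thesis using 1 two by simp
    qed
  qed
qed

lemma tensor_iso:
  assumes char: "CHAR('f) = p" and p: "Factorial_Ring.prime p" and q: "q = - 1" and d: "d = 2 * d' + 1"
  shows "alg_isomorphic C (tensor_alg (PW_alg p d') (PW_alg p 1))"
proof -
  \<comment> \<open>The even-indexed elements are the divided powers of the first factor,
    \<open>1\<close> and \<open>b 1\<close> those of the second; each \<open>b m\<close> will be
    \<open>E (m div 2)\<close> times \<open>E' (m mod 2)\<close>.\<close>
  define E where "E i = (if i \<le> d' then b (2 * i) else \<zero>\<^bsub>C\<^esub>)" for i
  define E' where "E' i = (if i = 0 then \<one>\<^bsub>C\<^esub> else if i = 1 then b 1 else \<zero>\<^bsub>C\<^esub>)" for i :: nat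
  have odd: "odd d" using d by simp
  have qi: "qint q l = (if even l then 0 else 1)" for l unfolding q by (rule qint_minus_one)
  have b1: "b 1 \<otimes>\<^bsub>C\<^esub> b l = (if even l then b (Suc l) else \<zero>\<^bsub>C\<^esub>)" if "l \<le> d" for l
  proof -
    have "s l = qint q l * (q ^ (d - l) + q)"
      using t_eig_diff[of 0 l d q] that by (simp add: s_def)
    \<comment> \<open>For even \<open>l\<close> the first factor vanishes; for odd \<open>l\<close>
      the exponent \<open>d - l\<close> is even and the second one is \<open>1 - 1\<close>.\<close>
    also have "\<dots> = 0" using odd that by (cases "even l") (auto simp: q qint_minus_one)
    finally have "s l = 0" .
    moreover have "l < d" if "even l" using odd \<open>l \<le> d\<close> that by (cases "l = d") auto
    ultimately show ?thesis using b_1_mult[OF that] that by (auto simp: qi b_closed)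
  qed
  have E_mult: "E i \<otimes>\<^bsub>C\<^esub> E j = of_nat ((i + j) choose i) \<odot>\<^bsub>C\<^esub> E (i + j)" for i j
  proof (cases "i \<le> d' \<and> j \<le> d'")
    case True
    have "b (2 * i) \<otimes>\<^bsub>C\<^esub> b (2 * j) = (\<lambda>x y. \<Sum>m\<le>d. (if m = 2 * (i + j) then of_nat ((i + j) choose i) else 0) * b m x y)"
    proof -
      have le: "2 * i \<le> d" "2 * j \<le> d" "i \<le> d" using True d by auto
      have "lin_coeff q d (2 * i) (2 * j) m = (if m = 2 * (i + j) then of_nat ((i + j) choose i) else 0)" if "m \<le> d" for m
        unfolding q by (rule lin_coeff_minus_one[OF odd le(3) that])
      then show ?thesis unfolding b_mult[OF le(1,2)] by (intro ext sum.cong) simp_all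
    qed
    \<comment> \<open>If \<open>i + j > d'\<close>, then \<open>2 * (i + j)\<close> exceeds
      \<open>d\<close> and no term of the sum survives, in agreement with \<open>E (i + j)\<close>
      being zero.\<close>
    also have "\<dots> = of_nat ((i + j) choose i) \<odot>\<^bsub>C\<^esub> E (i + j)"
      by (auto simp: E_def C_simps d if_distrib[of "\<lambda>c. c * _"] fun_eq_iff cong: if_cong)
    finally show ?thesis using True by (simp add: E_def)
  next
    case False
    then show ?thesis by (auto simp: E_def b_closed)
  qed
  have E'_mult: "E' i \<otimes>\<^bsub>C\<^esub> E' j = of_nat ((i + j) choose i) \<odot>\<^bsub>C\<^esub> E' (i + j)" for i j
  proof -
    have "b 1 \<otimes>\<^bsub>C\<^esub> b 1 = \<zero>\<^bsub>C\<^esub>" using b1[of 1] d by simp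
    moreover consider "i = 0" | "j = 0" | "i = 1" "j = 1" | "i + j > 2" "i > 0" "j > 0" by linarith
    ultimately show ?thesis by cases (auto simp: E'_def b_closed)
  qed
  interpret dE: divided_powers C p d' E
    by unfold_locales (use char p E_mult in \<open>auto simp: E_def b_closed b_0\<close>)
  interpret dE': divided_powers C p 1 E'
    by unfold_locales (use char p E'_mult in \<open>auto simp: E'_def b_closed\<close>)
  obtain \<phi> \<gamma> where \<phi>: "\<phi> \<in> alg_hom (PW_alg p d') C" and \<gamma>: "\<And>w. \<gamma> w \<noteq> 0"
    "\<And>w. \<phi> (PW_class p d' (monomial (digits p w))) = \<gamma> w \<odot>\<^bsub>C\<^esub> E w"
    using dE.PW_hom by metis
  obtain \<psi> \<delta> where \<psi>: "\<psi> \<in> alg_hom (PW_alg p 1) C" and \<delta>: "\<And>w. \<delta> w \<noteq> 0"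
    "\<And>w. \<psi> (PW_class p 1 (monomial (digits p w))) = \<delta> w \<odot>\<^bsub>C\<^esub> E' w"
    using dE'.PW_hom by metis
  let ?e = "\<lambda>w. PW_class p d' (monomial (digits p w)) :: 'f inf_poly set set"
  let ?x = "\<lambda>w. PW_class p 1 (monomial (digits p w)) :: 'f inf_poly set set"
  let ?K = "{..d'} \<times> {..1::nat}"
  have prod: "\<phi> (?e (fst k)) \<otimes>\<^bsub>C\<^esub> \<psi> (?x (snd k)) = (\<gamma> (fst k) * \<delta> (snd k)) \<odot>\<^bsub>C\<^esub> b (2 * fst k + snd k)"
    if k: "k \<in> ?K" for k
  proof -
    have "E (fst k) \<otimes>\<^bsub>C\<^esub> E' (snd k) = b (2 * fst k + snd k)"
    proof (cases "snd k = 0")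
      case True
      then show ?thesis using k by (auto simp: E_def E'_def b_closed)
    next
      case False
      then have "snd k = 1" using k by auto
      moreover have "b (2 * fst k) \<otimes>\<^bsub>C\<^esub> b 1 = b (Suc (2 * fst k))"
        using b1[of "2 * fst k"] k C.m_comm[OF b_closed b_closed, of "2 * fst k" 1] by (auto simp: d)
      ultimately show ?thesis using k by (auto simp: E_def E'_def)
    qed
    then show ?thesis unfolding \<gamma>(2) \<delta>(2)
      by (simp add: C.smult_assoc2 C.smult_r C.smult_assoc1 b_closed dE.E_closed dE'.E_closed mult.commute[of "\<gamma> _"])
  qed
  let ?i = "\<lambda>k :: nat \<times> nat. 2 * fst k + snd k"
  \<comment> \<open>As \<open>d = 2 * d' + 1\<close>, the map
    \<open>(i, j) \<mapsto> 2 * i + j\<close> is a bijection from the index pairs onto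
    \<open>{..d}\<close>; the products are the basis \<open>b\<close> up to nonzero scalars.\<close>
  have sum_eq: "(\<Oplus>\<^bsub>C\<^esub>k\<in>?K. c k \<odot>\<^bsub>C\<^esub> (\<phi> (?e (fst k)) \<otimes>\<^bsub>C\<^esub> \<psi> (?x (snd k)))) =
     (\<lambda>x y. \<Sum>m\<le>d. (let k = (m div 2, m mod 2) in c k * \<gamma> (fst k) * \<delta> (snd k)) * b m x y)" for c
  proof -
    have "(\<Oplus>\<^bsub>C\<^esub>k\<in>?K. c k \<odot>\<^bsub>C\<^esub> (\<phi> (?e (fst k)) \<otimes>\<^bsub>C\<^esub> \<psi> (?x (snd k)))) =
      (\<Oplus>\<^bsub>C\<^esub>k\<in>?K. (c k * \<gamma> (fst k) * \<delta> (snd k)) \<odot>\<^bsub>C\<^esub> b (?i k))"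
    proof (rule C.finsum_cong'[OF refl])
      show "c k \<odot>\<^bsub>C\<^esub> (\<phi> (?e (fst k)) \<otimes>\<^bsub>C\<^esub> \<psi> (?x (snd k))) = (c k * \<gamma> (fst k) * \<delta> (snd k)) \<odot>\<^bsub>C\<^esub> b (?i k)"
        if "k \<in> ?K" for k
        unfolding prod[OF that] mult.assoc by (rule C.smult_assoc1[OF b_closed, symmetric])
    qed (simp add: b_closed)
    also have "\<dots> = (\<lambda>x y. \<Sum>k\<in>?K. c k * \<gamma> (fst k) * \<delta> (snd k) * b (?i k) x y)"
      by (subst finsum_C) (auto simp: b_closed, simp add: C_simps)
    also have "\<dots> = (\<lambda>x y. \<Sum>m\<le>d. (let k = (m div 2, m mod 2) in c k * \<gamma> (fst k) * \<delta> (snd k)) * b m x y)"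
    proof (intro ext)
      fix x y
      show "(\<Sum>k\<in>?K. c k * \<gamma> (fst k) * \<delta> (snd k) * b (?i k) x y) =
        (\<Sum>m\<le>d. (let k = (m div 2, m mod 2) in c k * \<gamma> (fst k) * \<delta> (snd k)) * b m x y)"
        unfolding d
        by (rule sum.reindex_bij_witness[of _ "\<lambda>m. (m div 2, m mod 2)" ?i]) (auto simp: Let_def)
    qed
    finally show ?thesis .
  qed
  interpret tensor_setup "PW_alg p d'" "PW_alg p 1" C \<phi> \<psi> "{..d'}" "{..1::nat}" ?e ?x
  proof (intro tensor_setup.intro tensor_setup_axioms.intro comm_algebra_PW C.comm_algebra_axioms \<phi> \<psi> spans_PW dE.p_gt_1)
    show "?e i \<in> carrier (PW_alg p d')" "?x i \<in> carrier (PW_alg p 1)" for i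
      by (simp_all add: carrier_PW)
    show "\<exists>c. y = (\<Oplus>\<^bsub>C\<^esub>k\<in>?K. c k \<odot>\<^bsub>C\<^esub> (\<phi> (?e (fst k)) \<otimes>\<^bsub>C\<^esub> \<psi> (?x (snd k))))" if y: "y \<in> carrier C" for y
    proof -
      obtain c where c: "y = (\<lambda>x y. \<Sum>m\<le>d. c m * b m x y)" using b_gen[OF y] by blast
      have "y = (\<Oplus>\<^bsub>C\<^esub>k\<in>?K. (c (?i k) / (\<gamma> (fst k) * \<delta> (snd k))) \<odot>\<^bsub>C\<^esub> (\<phi> (?e (fst k)) \<otimes>\<^bsub>C\<^esub> \<psi> (?x (snd k))))"
        unfolding sum_eq c by (intro ext sum.cong) (auto simp: Let_def \<gamma>(1) \<delta>(1))
      then show ?thesis by (rule exI[of _ "\<lambda>k. c (?i k) / (\<gamma> (fst k) * \<delta> (snd k))"])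
    qed
    show "c k = 0" if z: "(\<Oplus>\<^bsub>C\<^esub>k\<in>?K. c k \<odot>\<^bsub>C\<^esub> (\<phi> (?e (fst k)) \<otimes>\<^bsub>C\<^esub> \<psi> (?x (snd k)))) = \<zero>\<^bsub>C\<^esub>"
      and k: "k \<in> ?K" for c k
    proof -
      have "(\<lambda>x y. \<Sum>m\<le>d. (let k = (m div 2, m mod 2) in c k * \<gamma> (fst k) * \<delta> (snd k)) * b m x y) = (\<lambda>x y. 0)"
        using z unfolding sum_eq by (simp only: C_simps)
      moreover have "?i k \<le> d" using k d by auto
      ultimately have "(let k = (?i k div 2, ?i k mod 2) in c k * \<gamma> (fst k) * \<delta> (snd k)) = 0"
        by (rule b_indep)
      moreover have "(?i k div 2, ?i k mod 2) = k" using k by (cases k) auto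
      ultimately show ?thesis using \<gamma>(1) \<delta>(1) by (auto simp: Let_def)
    qed
  qed auto
  show ?thesis by (rule alg_isomorphic_tensor)
qed

end

theorem theorem2:
  fixes p q d' :: nat
    and B :: "'k::{field,finite} ^ 'n \<Rightarrow> 'k ^ 'n \<Rightarrow> 'k"
  assumes "CHAR('f::field) = p" and "odd p"
    and "CARD('k) = q" and "odd q" and "\<not> p dvd q"
    and "CARD('n) = 2 * (2 * d' + 1)"
    and "symplectic_form B" and "nondegenerate B"
    and "local_algebra (dual_polar_algebra B (2 * d' + 1) ::
           ('f, ('k ^ 'n) set \<Rightarrow> ('k ^ 'n) set \<Rightarrow> 'f) module)"
  shows "alg_isomorphic
           (dual_polar_algebra B (2 * d' + 1) ::
             ('f, ('k ^ 'n) set \<Rightarrow> ('k ^ 'n) set \<Rightarrow> 'f) module)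
           (tensor_alg (PW_alg p d') (PW_alg p 1))"
proof -
  interpret dual_polar B "2 * d' + 1" "int q" "dual_polar_algebra B (2 * d' + 1) ::
      ('f, ('k ^ 'n) set \<Rightarrow> ('k ^ 'n) set \<Rightarrow> 'f) module" "of_nat q"
    by unfold_locales (use assms in auto)
  \<comment> \<open>The characteristic of a field is zero or a prime, and zero is not odd.\<close>
  have p: "Factorial_Ring.prime p"
    using prime_CHAR_semidom[where 'a = 'f] assms(1,2) by (cases "p = 0") auto
  have "\<not> p dvd 2" using p assms(2) by (metis primes_dvd_imp_eq two_is_prime_nat even_numeral dvd_refl)
  then have "(2 :: 'f) \<noteq> 0"
    using of_nat_eq_0_iff_char_dvd[where 'a = 'f, of 2] assms(1) by simp
  moreover have "(of_nat q :: 'f) \<noteq> 0" using assms(1,5) by (simp add: of_nat_eq_0_iff_char_dvd)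
  ultimately have "(of_nat q :: 'f) = - 1" using assms(9) by (intro local_imp_q_minus_one) auto
  then show ?thesis by (intro tensor_iso[OF assms(1) p]) auto
qed

end
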